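(* Let $\Omega$ be a lens and suppose that $\tilde\Omega$ is an extension of $\Omega$. For a fixed filtration $\mathcal{F}$ on a standard probability space $(X,\mathfrak{A},\mu)$ and a number $\alpha\in(0,1)$ admissible for this filtration, the following two assertions are equivalent. (1) For every $\varphi\in\boldsymbol{A}_\Omega^{\mathcal{F}}$ such that the martingale $\{F_n\}_{n\ge0}$ generated by $\varphi$ and $\mathcal{F}$ is an $\alpha$-martingale, the monotonic rearrangement $\varphi^*$ belongs to $\boldsymbol{A}_{\tilde\Omega}$. (2) The domain $\tilde\Omega$ is an $\alpha$-extension of $\Omega$.
   Context: **Lenses.** Let $\Omega_0,\Omega_1\subset\mathbb{R}^2$ be unbounded open strictly convex domains such that $\mathrm{cl}\,\Omega_1\subset\Omega_0$ and such that the cone property holds: any ray lying inside $\Omega_0$ can be shifted (translated) to lie inside $\Omega_1$. The set $\Omega=\mathrm{cl}(\Omega_0\setminus\Omega_1)$ is called a lens. Its fixed boundary is $\partial_{\mathrm{fixed}}\Omega=\partial\Omega_0$ and its free boundary is $\partial_{\mathrm{free}}\Omega=\partial\Omega_1$. **Extensions.** A lens $\tilde\Omega$ is called an extension of a lens $\Omega$ if $\Omega\subset\tilde\Omega$ and $\partial_{\mathrm{fixed}}\Omega=\partial_{\mathrm{fixed}}\tilde\Omega$. For $\alpha\in(0,1)$, a lens $\tilde\Omega$ is called an $\alpha$-extension of $\Omega$ if for every pair of points $x,y\in\Omega$ such that the point $z=\alpha x+(1-\alpha)y$ together with the whole segment $[z,y]$ is contained in $\Omega$, we have $[x,y]\subset\tilde\Omega$.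 **Averages and the class $\boldsymbol{A}_\Omega$.** For an integrable vector-valued function $\varphi$ and a set $\omega$ of positive measure, $\langle\varphi\rangle_\omega=\frac1{\mu(\omega)}\int_\omega\varphi\,d\mu$. For an interval $J\subset\mathbb{R}$ (with Lebesgue measure), a summable function $\varphi\colon J\to\partial\Omega_0$ belongs to the class $\boldsymbol{A}_\Omega$ if $\langle\varphi\rangle_I\in\Omega$ for every subinterval $I\subset J$. **Monotonic rearrangement.** There is a line $\ell\subset\mathbb{R}^2$ such that the orthogonal projection $P_\ell$ onto $\ell$ is injective on $\partial\Omega_0$. A function with values in $\partial\Omega_0$ on an interval is called monotone if its composition with $P_\ell$ is monotone. The monotonic rearrangement of $\varphi\colon X\to\partial\Omega_0$ is the function $\varphi^*\colon[0,1]\to\partial\Omega_0$ that is monotone (say, non-increasing) and has the same distribution as $\varphi$. **Filtrations.** $(X,\mathfrak{A},\mu)$ is a standard probability space. A filtration is an increasing sequence $\mathcal{F}=\{\mathcal{F}_n\}_{n\ge0}$ of finite subalgebras of $\mathfrak{A}$ with $\mathcal{F}_0=\{\varnothing,X\}$ such that $\mathfrak{A}$ is generated by $\{\mathcal{F}_n\}_{n\ge0}$ mod 0. $A(\mathcal{F})$ denotes the set of all atoms of all $\mathcal{F}_n$, $n\ge0$. The martingale $\{F_n\}_{n\ge 0}$ generated by $f\in L^1(X)$ and $\mathcal{F}$ is given by $F_n|_\omega=\langle f\rangle_\omega$ for each atom $\omega$ of $\mathcal{F}_n$. The class $\boldsymbol{A}_\Omega^{\mathcal{F}}$ consists of the integrable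 functions $\varphi\colon X\to\partial\Omega_0$ such that $\langle\varphi\rangle_\omega\in\Omega$ for every $\omega\in A(\mathcal{F})$. If $\omega_n$ is an atom of $\mathcal{F}_n$, $\omega_{n+1}$ an atom of $\mathcal{F}_{n+1}$ and $\omega_{n+1}\subset\omega_n$, then $\omega_n$ is called a parent and $\omega_{n+1}$ its child. $\mathcal{F}$ is called binary if every parent has at most two children. **$\alpha$-martingales.** Let $\mathcal{F}$ be a binary filtration and $\{F_n\}$ the martingale generated by $\varphi\in\boldsymbol{A}_\Omega^{\mathcal{F}}$ and $\mathcal{F}$. It is called an $\alpha$-martingale if for all $\omega\in A(\mathcal{F})$ the following holds: if $\omega',\omega''$ are children of $\omega$ (taken in either order) and the segment $[\langle\varphi\rangle_{\omega''},\langle\varphi\rangle_\omega]$ is not contained in $\Omega$, then $|\langle\varphi\rangle_{\omega'}-\langle\varphi\rangle_\omega|\ge\alpha|\langle\varphi\rangle_{\omega'}-\langle\varphi\rangle_{\omega''}|$. For an arbitrary filtration $\mathcal{F}$ and $\varphi\in\boldsymbol{A}_\Omega^{\mathcal{F}}$, the martingale $\{F_n\}$ generated by $\varphi$ and $\mathcal{F}$ is called an $\alpha$-martingale if there exists a binary filtration $\tilde{\mathcal{F}}=\{\tilde{\mathcal{F}}_m\}_{m\ge0}$ such that $\varphi\in\boldsymbol{A}_\Omega^{\tilde{\mathcal{F}}}$, the martingale $\{\tilde F_m\}_{m\ge0}$ generated by $\varphi$ and $\tilde{\mathcal{F}}$ is an $\alpha$-martingale, and $F_n=\tilde F_{m_n}$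 for some increasing sequence $\{m_n\}_n$. **Admissibility.** A positive number $\alpha$ is admissible for $\mathcal{F}$ if there exist $n\ge0$, an atom $\omega$ of $\mathcal{F}_n$, and a set $\omega'\in\mathcal{F}_{n+1}$ (an element of the algebra, not necessarily an atom) such that $\omega'\subset\omega$ and $\mu(\omega')=\alpha\mu(\omega)$.
   Formalization: The standard probability space is taken to be non-atomic (isomorphic mod 0 to [0,1] with Lebesgue measure); with atoms the equivalence fails, e.g. for a two-point space with equal masses, α = 1/2 and a parabolic strip Ω with Ω̃ = Ω. *)

theory Defs
  imports "HOL-Probability.Probability"
begin

definition strictly_convex :: "'a::euclidean_space set \<Rightarrow> bool" where
  "strictly_convex S \<longleftrightarrow>
     convex S \<and> (\<forall>x\<in>closure S. \<forall>y\<in>closure S. x \<noteq> y \<longrightarrow> open_segment x y \<subseteq> interior S)"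

definition ray :: "'a::real_vector \<Rightarrow> 'a \<Rightarrow> 'a set" where
  "ray p d = {p + t *\<^sub>R d | t. 0 \<le> t}"

definition cone_property :: "'a::real_vector set \<Rightarrow> 'a set \<Rightarrow> bool" where
  "cone_property U V \<longleftrightarrow>
     (\<forall>p d. d \<noteq> 0 \<and> ray p d \<subseteq> U \<longrightarrow> (\<exists>v. (+) v ` ray p d \<subseteq> V))"

text \<open>
  A lens is represented by the pair of domains that bound it, so that its fixed boundary is part
  of the data; the lens as a subset of the plane is \<open>region\<close>.
\<close>

record lens =
  outer :: "(real^2) set"
  inner_dom :: "(real^2) set"

definition is_lens :: "lens \<Rightarrow> bool" where
  "is_lens L \<longleftrightarrow>
     open (outer L) \<and> strictly_convex (outer L) \<and> \<not> bounded (outer L) \<and>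
     open (inner_dom L) \<and> strictly_convex (inner_dom L) \<and> \<not> bounded (inner_dom L) \<and>
     closure (inner_dom L) \<subseteq> outer L \<and>
     cone_property (outer L) (inner_dom L)"

definition region :: "lens \<Rightarrow> (real^2) set" where
  "region L = closure (outer L - inner_dom L)"

definition fixed_boundary :: "lens \<Rightarrow> (real^2) set" where
  "fixed_boundary L = frontier (outer L)"

definition extension :: "lens \<Rightarrow> lens \<Rightarrow> bool" where
  "extension L L' \<longleftrightarrow> is_lens L' \<and> region L \<subseteq> region L' \<and> fixed_boundary L = fixed_boundary L'"

definition alpha_extension :: "real \<Rightarrow> lens \<Rightarrow> lens \<Rightarrow> bool" where
  "alpha_extension \<alpha> L L' \<longleftrightarrow> is_lens L' \<and>
     (\<forall>x\<in>region L. \<forall>y\<in>region L.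
        closed_segment (\<alpha> *\<^sub>R x + (1 - \<alpha>) *\<^sub>R y) y \<subseteq> region L \<longrightarrow> closed_segment x y \<subseteq> region L')"

definition average :: "'a measure \<Rightarrow> 'a set \<Rightarrow> ('a \<Rightarrow> 'b::euclidean_space) \<Rightarrow> 'b" where
  "average M A f = (1 / measure M A) *\<^sub>R (LINT x:A|M. f x)"

text \<open>
  The condition \<open>0 < measure lebesgue I\<close> leaves out the degenerate intervals, on which averages
  are not defined, and also those of infinite length.
\<close>

definition class_A :: "lens \<Rightarrow> real set \<Rightarrow> (real \<Rightarrow> real^2) set" where
  "class_A L J = {\<phi>. set_integrable lebesgue J \<phi> \<and> (\<forall>t\<in>J. \<phi> t \<in> fixed_boundary L) \<and>
     (\<forall>I. is_interval I \<and> I \<subseteq> J \<and> 0 < measure lebesgue I \<longrightarrow> average lebesgue I \<phi> \<in> region L)}"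

text \<open>
  \<open>\<psi>\<close> is a monotonic rearrangement of \<open>\<phi>\<close>. The unit vector \<open>e\<close> spans the line \<open>\<ell>\<close>, and
  \<open>e \<bullet> x\<close> is the coordinate of the orthogonal projection of \<open>x\<close> onto \<open>\<ell>\<close>. All admissible lines
  induce the same order on the fixed boundary up to reversal, and \<open>\<psi>\<close> is determined
  up to a null set and the reflection \<open>t \<mapsto> 1 - t\<close>, neither of which affects membership in
  \<open>class_A L {0..1}\<close>. Monotonicity is not required at the end points 0 and 1: if the projection of
  \<open>\<phi>\<close> is essentially unbounded, there is no function with finite values that is monotone on the
  whole closed interval.
\<close>

definition monotonic_rearrangement ::
    "lens \<Rightarrow> 'a measure \<Rightarrow> ('a \<Rightarrow> real^2) \<Rightarrow> (real \<Rightarrow> real^2) \<Rightarrow> bool" where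
  "monotonic_rearrangement L M \<phi> \<psi> \<longleftrightarrow>
     (\<forall>t\<in>{0..1}. \<psi> t \<in> fixed_boundary L) \<and>
     (\<exists>e. norm e = 1 \<and> inj_on (\<lambda>x. e \<bullet> x) (fixed_boundary L) \<and>
          antimono_on {0<..<1} (\<lambda>t. e \<bullet> \<psi> t)) \<and>
     \<psi> \<in> borel_measurable (lebesgue_on {0..1}) \<and>
     distr (lebesgue_on {0..1}) borel \<psi> = distr M borel \<phi>"

text \<open>
  A standard probability space is understood to be non-atomic: isomorphic mod 0 to the unit
  interval with Lebesgue measure. Passing to the completion covers both the Borel and the complete
  version of the notion.
\<close>

definition isomorphic_mod_0 :: "'a measure \<Rightarrow> 'b measure \<Rightarrow> bool" where
  "isomorphic_mod_0 M N \<longleftrightarrow>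
     (\<exists>S\<in>sets M. \<exists>T\<in>sets N. \<exists>f.
        space M - S \<in> null_sets M \<and> space N - T \<in> null_sets N \<and> bij_betw f S T \<and>
        (\<forall>A. A \<subseteq> S \<longrightarrow> (A \<in> sets M \<longleftrightarrow> f ` A \<in> sets N)) \<and>
        (\<forall>A\<in>sets M. A \<subseteq> S \<longrightarrow> emeasure N (f ` A) = emeasure M A))"

definition standard_prob_space :: "'a measure \<Rightarrow> bool" where
  "standard_prob_space M \<longleftrightarrow>
     prob_space M \<and> isomorphic_mod_0 (completion M) (lebesgue_on {0..1::real})"

definition finite_filtration :: "'a measure \<Rightarrow> (nat \<Rightarrow> 'a set set) \<Rightarrow> bool" where
  "finite_filtration M F \<longleftrightarrow>
     (\<forall>n. algebra (space M) (F n) \<and> finite (F n) \<and> F n \<subseteq> sets M) \<and>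
     mono F \<and> F 0 = {{}, space M} \<and>
     (\<forall>A\<in>sets M. \<exists>B\<in>sigma_sets (space M) (\<Union>n. F n). sym_diff A B \<in> null_sets M)"

text \<open>
  Atoms are taken mod 0: atoms of measure zero, over which averages are not defined, are
  disregarded throughout.
\<close>

definition atoms :: "'a measure \<Rightarrow> 'a set set \<Rightarrow> 'a set set" where
  "atoms M \<A> = {\<omega>\<in>\<A>. 0 < measure M \<omega> \<and> (\<forall>B\<in>\<A>. B \<subseteq> \<omega> \<longrightarrow> B = {} \<or> B = \<omega>)}"

text \<open>
  Children depend on the level \<open>n\<close>: a set may be an atom of several consecutive algebras.
\<close>

definition children :: "'a measure \<Rightarrow> (nat \<Rightarrow> 'a set set) \<Rightarrow> nat \<Rightarrow> 'a set \<Rightarrow> 'a set set" where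
  "children M F n \<omega> = {\<omega>'\<in>atoms M (F (Suc n)). \<omega>' \<subseteq> \<omega>}"

definition binary_filtration :: "'a measure \<Rightarrow> (nat \<Rightarrow> 'a set set) \<Rightarrow> bool" where
  "binary_filtration M F \<longleftrightarrow>
     finite_filtration M F \<and> (\<forall>n. \<forall>\<omega>\<in>atoms M (F n). card (children M F n \<omega>) \<le> 2)"

definition martingale ::
    "'a measure \<Rightarrow> (nat \<Rightarrow> 'a set set) \<Rightarrow> ('a \<Rightarrow> real^2) \<Rightarrow> nat \<Rightarrow> 'a \<Rightarrow> real^2" where
  "martingale M F f n x = (\<Sum>\<omega>\<in>atoms M (F n). indicator \<omega> x *\<^sub>R average M \<omega> f)"

definition class_A_filtration ::
    "lens \<Rightarrow> 'a measure \<Rightarrow> (nat \<Rightarrow> 'a set set) \<Rightarrow> ('a \<Rightarrow> real^2) set" where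
  "class_A_filtration L M F = {\<phi>. integrable M \<phi> \<and> (\<forall>x\<in>space M. \<phi> x \<in> fixed_boundary L) \<and>
     (\<forall>n. \<forall>\<omega>\<in>atoms M (F n). average M \<omega> \<phi> \<in> region L)}"

definition binary_alpha_martingale ::
    "real \<Rightarrow> lens \<Rightarrow> 'a measure \<Rightarrow> (nat \<Rightarrow> 'a set set) \<Rightarrow> ('a \<Rightarrow> real^2) \<Rightarrow> bool" where
  "binary_alpha_martingale \<alpha> L M F \<phi> \<longleftrightarrow>
     binary_filtration M F \<and> \<phi> \<in> class_A_filtration L M F \<and>
     (\<forall>n. \<forall>\<omega>\<in>atoms M (F n). \<forall>\<omega>'\<in>children M F n \<omega>. \<forall>\<omega>''\<in>children M F n \<omega>.
        \<omega>' \<noteq> \<omega>'' \<and> \<not> closed_segment (average M \<omega>'' \<phi>) (average M \<omega> \<phi>) \<subseteq> region L \<longrightarrow>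
        norm (average M \<omega>' \<phi> - average M \<omega> \<phi>) \<ge> \<alpha> * norm (average M \<omega>' \<phi> - average M \<omega>'' \<phi>))"

text \<open>
  For a binary filtration this subsumes the previous notion: take \<open>F'\<close> to be \<open>F\<close>
  and \<open>m\<close> the identity.
\<close>

definition alpha_martingale ::
    "real \<Rightarrow> lens \<Rightarrow> 'a measure \<Rightarrow> (nat \<Rightarrow> 'a set set) \<Rightarrow> ('a \<Rightarrow> real^2) \<Rightarrow> bool" where
  "alpha_martingale \<alpha> L M F \<phi> \<longleftrightarrow>
     (\<exists>F' m. binary_alpha_martingale \<alpha> L M F' \<phi> \<and> strict_mono m \<and>
        (\<forall>n. AE x in M. martingale M F \<phi> n x = martingale M F' \<phi> (m n) x))"

definition admissible :: "real \<Rightarrow> 'a measure \<Rightarrow> (nat \<Rightarrow> 'a set set) \<Rightarrow> bool" where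
  "admissible \<alpha> M F \<longleftrightarrow> 0 < \<alpha> \<and>
     (\<exists>n. \<exists>\<omega>\<in>atoms M (F n). \<exists>\<omega>'\<in>F (Suc n). \<omega>' \<subseteq> \<omega> \<and> measure M \<omega>' = \<alpha> * measure M \<omega>)"

end

theory Submission
  imports Defs
begin

text \<open>
  A lens with nonempty fixed boundary has a simple shape in suitable coordinates, and if the fixed
  boundary is empty, so is the lens. The outer domain contains a ray in some unit
  direction \<open>N\<close>; by strict convexity and the cone property, moving any point of the closure of either
  domain in the direction \<open>N\<close> leads into that domain (\<open>upward\<close>). If \<open>e\<close> is a unit vector orthogonal
  to \<open>N\<close>, both domains lie above the graph of a convex function of the abscissa \<open>e \<bullet> v\<close>, and the
  lens is the strip between the two graphs.

  \<^emph>\<open>Rearrangements in the class force an \<open>\<alpha>\<close>-extension.\<close>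
  Let \<open>x, y\<close> violate the \<open>\<alpha>\<close>-extension property: the segment from \<open>\<alpha> x + (1 - \<alpha>) y\<close> to \<open>y\<close> lies in
  the small lens, but \<open>[x, y]\<close> meets the inner domain of the large one. Moving \<open>y\<close> outwards along the
  line keeps the violation, so \<open>y\<close> may be taken on the fixed boundary
  (\<open>bad_pair_reaches_boundary\<close>). A line through \<open>x\<close> parallel to a suitable supporting line of the
  inner domain cuts the outer domain in a chord \<open>[p, q]\<close> that stays in the lens
  (\<open>chord_through_point\<close>). By admissibility there are an atom \<open>\<omega>\<close> and \<open>W \<subseteq> \<omega>\<close> in the next algebra
  with \<open>\<mu>(W) = \<alpha> \<mu>(\<omega>)\<close>. Let \<open>\<phi>\<close> be \<open>y\<close> off \<open>W\<close> and take on \<open>W\<close> the values \<open>p\<close> and \<open>q\<close> with average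
  \<open>x\<close>. Refine the filtration by adding one set at a time, starting at the critical level with \<open>W\<close>:
  all averages then lie in \<open>[\<alpha> x + (1 - \<alpha>) y, y]\<close> or in \<open>[p, q]\<close>, and the only split that can
  have a bad segment is the one of \<open>\<omega>\<close>, where the jump condition holds with equality
  (\<open>one_jump_alpha_martingale\<close>). The rearrangement takes the values \<open>p, q, y\<close> in this order, hence its
  averages over initial intervals sweep out the forbidden part of \<open>[x, y]\<close>.

  \<^emph>\<open>An \<open>\<alpha>\<close>-extension puts the rearrangements into the class.\<close>
  The jump condition and the \<open>\<alpha>\<close>-extension property together say that the averages over two siblings
  are joined by a segment in the large lens (\<open>alpha_children_segment\<close>). From here on the inner domain
  is that of the large lens. Functions that are convex on
  the segments of the large lens therefore satisfy Jensen's inequality along the martingale. One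
  family of such functions suffices. Take a supporting line of the inner domain that touches it at
  \<open>w\<close>, and the affine function that vanishes on this line and grows in the direction \<open>N\<close>; keep the
  positive part of it to the left of \<open>w\<close>, and put \<open>0\<close> to the right (\<open>wedge\<close>). The jump of this function
  is located above \<open>w\<close>, inside the inner domain, so it is invisible from the lens. Since the martingale
  converges in \<open>L\<^sup>1\<close>, the inequality passes to \<open>\<phi>\<close> (\<open>wedge_jensen\<close>), and it depends on the distribution
  of \<open>\<phi>\<close> only, so it holds for the rearrangement \<open>\<psi>\<close>.

  Now suppose that the average \<open>z\<close> of \<open>\<psi>\<close> over an interval lies in the inner domain. The mean \<open>x\<close> of \<open>\<psi>\<close>
  does not, so \<open>[z, x]\<close> leaves the inner domain at a point \<open>y\<close>. The mean lies on or below a supporting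
  line at \<open>y\<close> while \<open>z\<close> lies above it, so \<open>\<psi>\<close> goes below this line on one of the two complementary
  intervals, say on the one whose values lie to the left. Let \<open>A\<close> be the value of \<open>\<psi>\<close> at the common end
  point, and take the supporting line through \<open>A\<close> that touches the inner domain to the right of \<open>A\<close>
  (\<open>tangent_from_boundary_point\<close>). Then \<open>x\<close> lies above this line and to the left of the point of
  contact (\<open>left_of_tangency_point\<close>), while on the boundary to the right of \<open>A\<close> the corresponding wedge
  function vanishes. Jensen's inequality now bounds the height of \<open>x\<close> over the line by the contribution
  of the left tail alone; but the interval contributes a positive amount to this height and the
  right tail a nonnegative one, which is a contradiction
  (\<open>no_interval_with_tail_below_support\<close>).
\<close>

section \<open>Convex sets, rays and lenses\<close>

text \<open>
  The boundary points are included on the left and excluded on the right: this is how a recession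
  direction of a strictly convex open set behaves, and it is the form in which such directions are
  always applied below.
\<close>

definition upward :: "'a::euclidean_space set \<Rightarrow> 'a \<Rightarrow> bool" where
  "upward S N \<longleftrightarrow> (\<forall>v\<in>closure S. \<forall>t>0. v + t *\<^sub>R N \<in> S)"

lemma upwardD: "upward S N \<Longrightarrow> v \<in> closure S \<Longrightarrow> 0 < t \<Longrightarrow> v + t *\<^sub>R N \<in> S"
  by (simp add: upward_def)

lemma strictly_convex_segment:
  fixes S :: "'a::euclidean_space set"
  assumes "open S" "strictly_convex S" "x \<in> closure S" "y \<in> closure S" "x \<noteq> y"
  shows "open_segment x y \<subseteq> S"
  using assms by (auto simp: strictly_convex_def interior_open)

lemma segment_from_open:
  fixes S :: "'a::euclidean_space set"
  assumes "open S" "convex S" "x \<in> S" "y \<in> closure S"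
  shows "open_segment x y \<subseteq> S"
  using in_interior_closure_convex_segment[of S x y] assms by (simp add: interior_open)

lemma convex_combination_in_open:
  fixes S :: "'a::euclidean_space set"
  assumes "open S" "convex S" "x \<in> S" "y \<in> closure S" "0 < u" "u \<le> 1"
  shows "u *\<^sub>R x + (1 - u) *\<^sub>R y \<in> S"
proof (cases "u = 1 \<or> x = y")
  case True
  then show ?thesis using assms(3) by (auto simp: algebra_simps)
next
  case False
  then have "u *\<^sub>R x + (1 - u) *\<^sub>R y \<in> open_segment x y"
    using assms by (auto simp: in_segment intro!: exI[of _ "1-u"])
  then show ?thesis using segment_from_open[OF assms(1-4)] by blast
qed

lemma closed_convex_contains_parallel_ray:
  assumes C: "closed C" "convex C" and ray: "\<And>t. 0 \<le> t \<Longrightarrow> u + t *\<^sub>R d \<in> C"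
    and v: "v \<in> C" and t: "0 \<le> t"
  shows "v + t *\<^sub>R (d::'a::real_normed_vector) \<in> C"
proof -
  \<comment> \<open>points on the segments from \<open>v\<close> to points farther and farther along the given ray\<close>
  let ?f = "\<lambda>n::nat. (1 - 1/real (Suc n)) *\<^sub>R v + (1/real (Suc n)) *\<^sub>R (u + (real (Suc n) * t) *\<^sub>R d)"
  have inC: "?f n \<in> C" for n
    using t by (intro convexD[OF C(2) v ray]) auto
  have eq: "?f n = (1 - 1/real (Suc n)) *\<^sub>R v + (1/real (Suc n)) *\<^sub>R u + t *\<^sub>R d" for n
    by (simp add: scaleR_right_distrib)
  have lim0: "(\<lambda>n. 1/real (Suc n)) \<longlonglongrightarrow> 0"
    using LIMSEQ_inverse_real_of_nat by (simp add: inverse_eq_divide)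
  have "(\<lambda>n. (1 - 1/real (Suc n)) *\<^sub>R v + (1/real (Suc n)) *\<^sub>R u + t *\<^sub>R d)
      \<longlonglongrightarrow> (1 - 0) *\<^sub>R v + 0 *\<^sub>R u + t *\<^sub>R d"
    by (intro tendsto_intros lim0)
  then have "?f \<longlonglongrightarrow> v + t *\<^sub>R d" unfolding eq by simp
  then show ?thesis by (rule closed_sequentially[OF C(1) inC])
qed

text \<open>
  A translate of the ray starts at every point \<open>v\<close> of the closure, and \<open>v + t N\<close> is the midpoint of
  two distinct points of the closure, hence in the open set by strict convexity.
\<close>

lemma upward_if_contains_ray:
  assumes S: "open S" "strictly_convex S" and "N \<noteq> 0"
    and ray: "\<And>t. 0 \<le> t \<Longrightarrow> u + t *\<^sub>R N \<in> closure S"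
  shows "upward S N"
  unfolding upward_def
proof (intro ballI allI impI)
  fix v t assume v: "v \<in> closure S" and t: "(0::real) < t"
  have cv: "convex S" using S by (simp add: strictly_convex_def)
  have "v + (2*t) *\<^sub>R N \<in> closure S"
    using closed_convex_contains_parallel_ray[of "closure S" u N v "2*t"] ray v t cv
    by (auto intro: convex_closure)
  moreover have "v + t *\<^sub>R N \<in> open_segment v (v + (2*t) *\<^sub>R N)"
    using \<open>N \<noteq> 0\<close> t by (auto simp: in_segment algebra_simps intro!: exI[of _ "1/2"])
  moreover have "v \<noteq> v + (2*t) *\<^sub>R N" using \<open>N \<noteq> 0\<close> t by simp
  ultimately show "v + t *\<^sub>R N \<in> S" using strictly_convex_segment[OF S v] by blast
qed

text \<open>
  The directions from \<open>u\<close> to points that escape to infinity accumulate at some unit vector, and the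
  ray in this limit direction is a limit of segments in the set.
\<close>

lemma unbounded_closed_convex_contains_ray:
  fixes C :: "'a::euclidean_space set"
  assumes C: "closed C" "convex C" "\<not> bounded C" and u: "u \<in> C"
  obtains d where "norm d = 1" "\<And>t. 0 \<le> t \<Longrightarrow> u + t *\<^sub>R d \<in> C"
proof -
  have "\<exists>v\<in>C. real n + 1 \<le> norm (v - u)" for n
  proof (rule ccontr)
    assume "\<not> ?thesis"
    then have "\<forall>v\<in>C. dist u v \<le> real n + 1" by (auto simp: dist_norm norm_minus_commute)
    then show False using C(3) by (meson bounded_def)
  qed
  then obtain v where v: "\<And>n. v n \<in> C" "\<And>n. real n + 1 \<le> norm (v n - u)" by metis
  \<comment> \<open>directions of points that escape to infinity\<close>
  define d where "d n = (1 / norm (v n - u)) *\<^sub>R (v n - u)" for n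
  have pos: "norm (v n - u) > 0" for n using v(2)[of n] by linarith
  have nd: "d n \<in> sphere 0 1" for n using pos[of n] by (auto simp: d_def)
  obtain l r where l: "l \<in> sphere 0 1" "strict_mono r" "(d \<circ> r) \<longlonglongrightarrow> l"
    using compact_sphere[of 0 1] nd unfolding compact_eq_seq_compact_metric seq_compact_def by blast
  have "u + t *\<^sub>R l \<in> C" if t: "0 \<le> t" for t
  proof -
    have "eventually (\<lambda>n. u + t *\<^sub>R d (r n) \<in> C) sequentially"
    proof (rule eventually_sequentiallyI[of "nat \<lceil>t\<rceil>"])
      fix n assume n: "nat \<lceil>t\<rceil> \<le> n"
      have "t \<le> real n" using n by linarith
      also have "\<dots> \<le> real (r n)" using seq_suble[OF l(2)] by simp
      finally have le: "t / norm (v (r n) - u) \<le> 1" using v(2)[of "r n"] pos[of "r n"] by (simp add: field_simps)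
      have "(1 - t / norm (v (r n) - u)) *\<^sub>R u + (t / norm (v (r n) - u)) *\<^sub>R v (r n) \<in> C"
        using le t v(1) u pos[of "r n"] by (intro convexD[OF C(2)]) auto
      then show "u + t *\<^sub>R d (r n) \<in> C" by (simp add: d_def algebra_simps)
    qed
    moreover have "(\<lambda>n. u + t *\<^sub>R d (r n)) \<longlonglongrightarrow> u + t *\<^sub>R l"
      using l(3) by (intro tendsto_intros) (simp add: o_def)
    ultimately show ?thesis using Lim_in_closed_set[OF C(1)] by (metis sequentially_bot)
  qed
  then show thesis using that[of l] l(1) by auto
qed

lemma is_lensD:
  assumes "is_lens L"
  shows "open (outer L)" "strictly_convex (outer L)" "\<not> bounded (outer L)" "convex (outer L)"
    "open (inner_dom L)" "strictly_convex (inner_dom L)" "\<not> bounded (inner_dom L)" "convex (inner_dom L)"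
    "closure (inner_dom L) \<subseteq> outer L" "cone_property (outer L) (inner_dom L)"
    "inner_dom L \<subseteq> outer L" "outer L \<noteq> {}" "inner_dom L \<noteq> {}"
  using assms closure_subset[of "inner_dom L"] unfolding is_lens_def by (auto simp: strictly_convex_def)

lemma lens_inner_upward_ray:
  assumes L: "is_lens L" and "N \<noteq> 0" and ray: "\<And>t. 0 \<le> t \<Longrightarrow> u + t *\<^sub>R N \<in> outer L"
  shows "upward (inner_dom L) N"
proof -
  have "ray u N \<subseteq> outer L" using ray by (auto simp: ray_def)
  then obtain v where "(+) v ` ray u N \<subseteq> inner_dom L"
    using is_lensD(10)[OF L] \<open>N \<noteq> 0\<close> unfolding cone_property_def by blast
  then have "(v + u) + t *\<^sub>R N \<in> closure (inner_dom L)" if "0 \<le> t" for t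
    using that closure_subset[of "inner_dom L"] by (auto simp: ray_def image_subset_iff add.assoc)
  then show ?thesis using upward_if_contains_ray is_lensD[OF L] \<open>N \<noteq> 0\<close> by metis
qed

lemma lens_inner_upward:
  assumes L: "is_lens L" and "N \<noteq> 0" and up: "upward (outer L) N"
  shows "upward (inner_dom L) N"
proof -
  obtain u where u: "u \<in> outer L" using is_lensD[OF L] by auto
  have "u + t *\<^sub>R N \<in> outer L" if "0 \<le> t" for t
    using u upwardD[OF up, of u t] that closure_subset[of "outer L"] by (cases "t = 0") auto
  then show ?thesis using lens_inner_upward_ray[OF L \<open>N \<noteq> 0\<close>] by blast
qed

text \<open>
  The closure adds exactly the fixed boundary: the closure of the inner domain lies in the open
  outer domain, so near the fixed boundary the difference of the two domains is the whole outer
  domain.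
\<close>

lemma region_iff:
  assumes L: "is_lens L"
  shows "v \<in> region L \<longleftrightarrow> v \<in> closure (outer L) \<and> v \<notin> inner_dom L"
proof
  assume v: "v \<in> region L"
  have "region L \<subseteq> closure (outer L)" unfolding region_def by (rule closure_mono) auto
  moreover have "region L \<inter> inner_dom L = {}"
    unfolding region_def using is_lensD(5)[OF L] open_Int_closure_eq_empty by blast
  ultimately show "v \<in> closure (outer L) \<and> v \<notin> inner_dom L" using v by blast
next
  assume v: "v \<in> closure (outer L) \<and> v \<notin> inner_dom L"
  show "v \<in> region L"
  proof (cases "v \<in> outer L")
    case True
    then show ?thesis using v closure_subset[of "outer L - inner_dom L"] by (auto simp: region_def)
  next
    case False
    then have vn: "v \<in> - closure (inner_dom L)" using is_lensD(9)[OF L] by blast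
    have "v \<in> closure (- closure (inner_dom L) \<inter> outer L)"
      using v vn open_Int_closure_subset[of "- closure (inner_dom L)" "outer L"] by blast
    also have "\<dots> \<subseteq> region L" unfolding region_def
      by (rule closure_mono) (use closure_subset in auto)
    finally show ?thesis .
  qed
qed

lemma fixed_boundary_iff:
  assumes L: "is_lens L"
  shows "v \<in> fixed_boundary L \<longleftrightarrow> v \<in> closure (outer L) \<and> v \<notin> outer L"
  using is_lensD(1)[OF L] by (auto simp: fixed_boundary_def frontier_def interior_open)

lemma fixed_boundary_subset_region:
  assumes L: "is_lens L" shows "fixed_boundary L \<subseteq> region L"
  using is_lensD(11)[OF L] by (auto simp: region_iff[OF L] fixed_boundary_iff[OF L])

text \<open>
  Two convex open sets that meet and have the same frontier coincide, because each is connected.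
  The two outer domains meet because the part of the first one next to its boundary belongs to the
  lens, hence to the larger lens.
\<close>

lemma extension_outer_eq:
  assumes L: "is_lens L" and E: "extension L L'"
  shows "outer L' = outer L"
proof -
  have L': "is_lens L'" and R: "region L \<subseteq> region L'" and F: "frontier (outer L) = frontier (outer L')"
    using E by (auto simp: extension_def fixed_boundary_def)
  note l = is_lensD[OF L] and l' = is_lensD[OF L']
  have sub: "U \<subseteq> V" if "open U" "convex U" "U \<inter> V \<noteq> {}" "frontier U = frontier V" for U V :: "(real^2) set"
  proof (rule ccontr)
    assume "\<not> U \<subseteq> V"
    then have "U \<inter> frontier V \<noteq> {}" using connected_Int_frontier[of U V] that convex_connected by blast
    then show False using that(1,4) by (auto simp: frontier_def interior_open)
  qed
  have "outer L \<inter> outer L' \<noteq> {}"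
  proof (cases "frontier (outer L) = {}")
    case True
    then have "outer L = UNIV" using l(12) frontier_eq_empty by blast
    then show ?thesis using l' by auto
  next
    case False
    then obtain p where p: "p \<in> fixed_boundary L" by (auto simp: fixed_boundary_def)
    then have pc: "p \<in> closure (outer L)" "p \<in> - closure (inner_dom L)"
      using l(9) by (auto simp: fixed_boundary_iff[OF L])
    then obtain q where q: "q \<in> outer L" "q \<in> - closure (inner_dom L)"
      using open_Int_closure_eq_empty[of "- closure (inner_dom L)" "outer L"] by blast
    let ?W = "outer L \<inter> - closure (inner_dom L)"
    have "?W \<subseteq> region L" using closure_subset[of "outer L"] closure_subset[of "inner_dom L"] by (auto simp: region_iff[OF L])
    also have "\<dots> \<subseteq> closure (outer L')" using R region_iff[OF L'] by blast
    finally have "?W \<subseteq> interior (closure (outer L'))"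
      by (intro interior_maximal) (auto intro: l(1))
    then have "?W \<subseteq> outer L'" using convex_interior_closure[OF l'(4)] l'(1) by (simp add: interior_open)
    then show ?thesis using q by blast
  qed
  then show ?thesis using sub[of "outer L" "outer L'"] sub[of "outer L'" "outer L"] F l l' by blast
qed

lemma extension_inner_subset:
  assumes L: "is_lens L" and E: "extension L L'"
  shows "inner_dom L' \<subseteq> inner_dom L"
proof
  fix v assume v: "v \<in> inner_dom L'"
  have L': "is_lens L'" and R: "region L \<subseteq> region L'" using E by (auto simp: extension_def)
  have "v \<notin> region L" using R v region_iff[OF L'] by blast
  moreover have "v \<in> closure (outer L)"
    using v is_lensD(11)[OF L'] extension_outer_eq[OF L E] closure_subset by blast
  ultimately show "v \<in> inner_dom L" using region_iff[OF L] by blast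
qed

section \<open>Chords of a lens\<close>

text \<open>
  With \<open>N\<close> as the upward direction, \<open>e \<bullet> v\<close> is the abscissa of \<open>v\<close>.
\<close>

lemma planar_coordinates:
  fixes e N v :: "real^2"
  assumes "norm e = 1" "norm N = 1" "e \<bullet> N = 0"
  shows "v = (e \<bullet> v) *\<^sub>R e + (N \<bullet> v) *\<^sub>R N"
proof -
  define a b c d where "a = e$1" "b = e$2" "c = N$1" "d = N$2"
  have h: "a*a + b*b = 1" "c*c + d*d = 1" "a*c + b*d = 0"
    using assms by (simp_all add: a_b_c_d_def norm_eq_1 inner_vec_def sum_2)
  have "c = - b * (a*d - b*c)" "d = a * (a*d - b*c)" using h by algebra+
  then have "a*a + c*c = 1" "a*b + c*d = 0" "b*b + d*d = 1" using h by algebra+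
  then have "v$1 = (a * v$1 + b * v$2) * a + (c * v$1 + d * v$2) * c"
     "v$2 = (a * v$1 + b * v$2) * b + (c * v$1 + d * v$2) * d" by algebra+
  then show ?thesis
    by (simp add: vec_eq_iff forall_2 inner_vec_def sum_2 a_b_c_d_def)
qed

lemma exists_unit_orthogonal:
  fixes v :: "real^2"
  obtains w where "norm w = norm v" "v \<bullet> w = 0"
proof
  define w :: "real^2" where "w = vector [- v$2, v$1]"
  show "norm w = norm v" by (simp add: w_def norm_eq_sqrt_inner inner_vec_def sum_2)
  show "v \<bullet> w = 0" by (simp add: w_def inner_vec_def sum_2)
qed

lemma same_abscissa_difference:
  fixes e N u v :: "real^2"
  assumes "norm e = 1" "norm N = 1" "e \<bullet> N = 0" "e \<bullet> u = e \<bullet> v"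
  shows "u = v + (N \<bullet> u - N \<bullet> v) *\<^sub>R N"
  using planar_coordinates[OF assms(1-3), of "u - v"] assms(4) by (simp add: inner_diff_right algebra_simps)

lemma above_closure_point_in:
  fixes e N u v :: "real^2"
  assumes "upward S N" "norm e = 1" "norm N = 1" "e \<bullet> N = 0"
    and "v \<in> closure S" "e \<bullet> u = e \<bullet> v" "N \<bullet> v < N \<bullet> u"
  shows "u \<in> S"
proof -
  have "u = v + (N \<bullet> u - N \<bullet> v) *\<^sub>R N"
    using same_abscissa_difference[OF assms(2-4,6)] .
  then show ?thesis using upwardD[OF assms(1,5)] assms(7) by (metis diff_gt_0_iff_gt)
qed

lemma inj_on_boundary_of_upward:
  fixes e N :: "real^2"
  assumes "is_lens L" "upward (outer L) N" "norm e = 1" "norm N = 1" "e \<bullet> N = 0"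
  shows "inj_on (\<lambda>v. e \<bullet> v) (fixed_boundary L)"
proof (rule inj_onI)
  fix u v assume uv: "u \<in> fixed_boundary L" "v \<in> fixed_boundary L" "e \<bullet> u = e \<bullet> v"
  have "N \<bullet> u = N \<bullet> v"
    using above_closure_point_in[OF assms(2-5), of v u] above_closure_point_in[OF assms(2-5), of u v] uv
    by (metis fixed_boundary_iff[OF assms(1)] less_linear)
  then show "u = v" using planar_coordinates[OF assms(3-5)] uv(3) by metis
qed

lemma ray_meets_fixed_boundary:
  assumes L: "is_lens L" and x: "x \<in> closure (outer L)" and t: "0 \<le> t" "x + t *\<^sub>R d \<notin> outer L"
  obtains s where "0 \<le> s" "x + s *\<^sub>R d \<in> fixed_boundary L"
proof (cases "x \<in> outer L")
  case False
  then show thesis using that[of 0] x by (simp add: fixed_boundary_iff[OF L])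
next
  case True
  have "closed_segment x (x + t *\<^sub>R d) \<inter> frontier (outer L) \<noteq> {}"
    using True t by (intro connected_Int_frontier) auto
  then obtain u where u: "0 \<le> u" "(1 - u) *\<^sub>R x + u *\<^sub>R (x + t *\<^sub>R d) \<in> frontier (outer L)"
    by (auto simp: in_segment)
  have "(1 - u) *\<^sub>R x + u *\<^sub>R (x + t *\<^sub>R d) = x + (u*t) *\<^sub>R d" by (simp add: algebra_simps)
  then show thesis using that[of "u*t"] u t by (simp add: fixed_boundary_def)
qed

lemma open_half_space_strict:
  assumes "open S" "a \<noteq> 0" "\<And>v. v \<in> S \<Longrightarrow> b \<le> a \<bullet> v" "v \<in> S"
  shows "b < a \<bullet> (v::'a::euclidean_space)"
proof -
  obtain r where r: "0 < r" "ball v r \<subseteq> S" using assms(1,4) openE by blast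
  have "v - (r / (2 * norm a)) *\<^sub>R a \<in> ball v r" using r(1) assms(2) by (simp add: dist_norm)
  then have "b \<le> a \<bullet> (v - (r / (2 * norm a)) *\<^sub>R a)" using r assms(3) by blast
  also have "\<dots> = a \<bullet> v - (r / (2 * norm a)) * (a \<bullet> a)" by (simp add: inner_diff_right)
  also have "\<dots> < a \<bullet> v" using r(1) assms(2) by (simp add: mult_pos_pos)
  finally show ?thesis .
qed

text \<open>
  The line through \<open>x\<close> is parallel to a supporting line that really touches the inner domain, at \<open>w\<close>;
  an arbitrary separating line would not do, as it could be parallel to an asymptote, and then it
  would not cut the outer domain in a bounded chord.
\<close>

lemma supporting_slab:
  assumes L: "is_lens L" and x: "x \<notin> inner_dom L"
  obtains a w where "a \<noteq> 0" "w \<in> closure (inner_dom L)" "a \<bullet> x \<le> a \<bullet> w"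
    "\<And>v. v \<in> inner_dom L \<Longrightarrow> a \<bullet> w < a \<bullet> v"
proof (cases "x \<in> closure (inner_dom L)")
  case True
  obtain a where "a \<noteq> 0" "\<And>v. v \<in> closure (inner_dom L) \<Longrightarrow> a \<bullet> x \<le> a \<bullet> v"
    "\<And>v. v \<in> rel_interior (inner_dom L) \<Longrightarrow> a \<bullet> x < a \<bullet> v"
    using supporting_hyperplane_relative_frontier[of "inner_dom L" x] True is_lensD[OF L] x
    by (auto simp: rel_interior_open)
  then show thesis using that[of a x] True is_lensD(5)[OF L] by (auto simp: rel_interior_open)
next
  case False
  have "convex (closure (inner_dom L))" "closure (inner_dom L) \<noteq> {}" using is_lensD[OF L] by (auto intro: convex_closure)
  then obtain a b w where w: "w \<in> closure (inner_dom L)" "a \<bullet> x < b" "a \<bullet> w = b"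
    "\<And>v. v \<in> closure (inner_dom L) \<Longrightarrow> b \<le> a \<bullet> v"
    using supporting_hyperplane_closed_point[of "closure (inner_dom L)" x] False by auto
  then have "a \<noteq> 0" by auto
  moreover have "b < a \<bullet> v" if "v \<in> inner_dom L" for v
    using open_half_space_strict[OF is_lensD(5)[OF L] \<open>a \<noteq> 0\<close>, of b v] w(4) that closure_subset by blast
  ultimately show thesis using that[of a w] w by auto
qed

lemma closed_segment_param:
  "u \<in> closed_segment a b \<longleftrightarrow> (\<exists>t. 0 \<le> t \<and> t \<le> 1 \<and> u = a + t *\<^sub>R (b - a))"
  by (auto simp: in_segment algebra_simps)

text \<open>
  If \<open>y\<close> moves away from \<open>x\<close>, the segment \<open>[x, y]\<close> grows, the point \<open>\<alpha> x + (1 - \<alpha>) y\<close> moves away from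
  the inner domain, and the line does not return to the inner domain beyond \<open>y\<close>. It does reach the
  fixed boundary: otherwise its direction would be a recession direction of the inner domain, by the
  cone property, and \<open>y\<close> would belong to the inner domain together with \<open>c\<close>.
\<close>

lemma bad_pair_reaches_boundary:
  assumes L: "is_lens L" and x: "x \<in> region L" and y: "y \<in> region L"
    and \<alpha>: "0 < \<alpha>" "\<alpha> < 1"
    and zy: "closed_segment (\<alpha> *\<^sub>R x + (1 - \<alpha>) *\<^sub>R y) y \<subseteq> region L"
    and c: "c \<in> closed_segment x y" "c \<in> inner_dom L"
  obtains y' where "y' \<in> fixed_boundary L" "c \<in> closed_segment x y'"
    "closed_segment (\<alpha> *\<^sub>R x + (1 - \<alpha>) *\<^sub>R y') y' \<subseteq> region L"
proof -
  define d where "d = y - x"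
  have yc: "y \<in> closure (outer L)" "y \<notin> inner_dom L" using y region_iff[OF L] by auto
  obtain u where u: "0 \<le> u" "u \<le> 1" "c = x + u *\<^sub>R d" using c(1) by (auto simp: closed_segment_param d_def)
  have y_eq: "y = x + d" by (simp add: d_def)
  have "u \<noteq> 1" using u c yc by (auto simp: d_def)
  then have u1: "u < 1" using u by simp
  have "x \<notin> inner_dom L" using x region_iff[OF L] by auto
  then have d0: "d \<noteq> 0" using u c by auto
  \<comment> \<open>such a point and \<open>c\<close> would enclose \<open>y\<close>, so \<open>y\<close> would lie in the inner domain\<close>
  have beyond: "x + s *\<^sub>R d \<notin> inner_dom L" if "1 \<le> s" for s
  proof
    assume s: "x + s *\<^sub>R d \<in> inner_dom L"
    define k where "k = (1 - u) / (s - u)"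
    have k: "0 \<le> k" "k \<le> 1" "k * (s - u) = 1 - u" using u1 that by (auto simp: k_def field_simps)
    then have k3: "(1 - k) * u + k * s = 1" by (simp add: algebra_simps)
    have "(1 - k) *\<^sub>R c + k *\<^sub>R (x + s *\<^sub>R d) \<in> inner_dom L"
      using k by (intro convexD[OF is_lensD(8)[OF L] c(2) s]) auto
    also have "(1 - k) *\<^sub>R c + k *\<^sub>R (x + s *\<^sub>R d) = x + ((1 - k) * u + k * s) *\<^sub>R d"
      by (simp add: u(3) algebra_simps)
    finally show False using k3 yc by (simp add: y_eq)
  qed
  have "\<exists>t\<ge>0. y + t *\<^sub>R d \<notin> outer L"
  proof (rule ccontr)
    assume "\<not> ?thesis"
    then have up: "upward (inner_dom L) d" using lens_inner_upward_ray[OF L d0, of y] by auto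
    have "c \<in> closure (inner_dom L)" using c closure_subset by blast
    then have "c + (1 - u) *\<^sub>R d \<in> inner_dom L" using upwardD[OF up] u1 by simp
    also have "c + (1 - u) *\<^sub>R d = x + 1 *\<^sub>R d" by (simp add: u(3) algebra_simps)
    finally show False using beyond[of 1] by simp
  qed
  then obtain s where s: "0 \<le> s" "y + s *\<^sub>R d \<in> fixed_boundary L"
    using ray_meets_fixed_boundary[OF L yc(1)] by blast
  let ?y = "y + s *\<^sub>R d"
  have y': "?y = x + (1 + s) *\<^sub>R d" by (simp add: y_eq algebra_simps)
  have yc': "?y \<in> closure (outer L)" using s(2) fixed_boundary_iff[OF L] by blast
  have "c \<in> closed_segment x ?y"
  proof -
    have "?y - x = (1 + s) *\<^sub>R d" using y' by (simp add: algebra_simps)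
    then have "(u / (1 + s)) *\<^sub>R (?y - x) = u *\<^sub>R d" using s(1) by simp
    moreover have "0 \<le> u / (1 + s)" "u / (1 + s) \<le> 1" using u s(1) by (auto simp: field_simps)
    ultimately show ?thesis unfolding closed_segment_param using u(3) by metis
  qed
  moreover have "closed_segment (\<alpha> *\<^sub>R x + (1 - \<alpha>) *\<^sub>R ?y) ?y \<subseteq> region L"
  proof
    fix v assume "v \<in> closed_segment (\<alpha> *\<^sub>R x + (1 - \<alpha>) *\<^sub>R ?y) ?y"
    then obtain t where t: "0 \<le> t" "t \<le> 1"
      and v: "v = (\<alpha> *\<^sub>R x + (1 - \<alpha>) *\<^sub>R ?y) + t *\<^sub>R (?y - (\<alpha> *\<^sub>R x + (1 - \<alpha>) *\<^sub>R ?y))"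
      by (auto simp: closed_segment_param)
    \<comment> \<open>\<open>k\<close> is the position of \<open>v\<close> on the line, with \<open>x\<close> at \<open>0\<close> and \<open>y\<close> at \<open>1\<close>\<close>
    define k where "k = (1 - \<alpha> + t * \<alpha>) * (1 + s)"
    have vk: "v = x + k *\<^sub>R d" unfolding v y' k_def by (simp add: algebra_simps)
    have a1: "1 - \<alpha> \<le> 1 - \<alpha> + t * \<alpha>" using t \<alpha> by simp
    have "(1 - \<alpha> + t * \<alpha>) * 1 \<le> k" unfolding k_def using a1 \<alpha> s(1) by (intro mult_left_mono) auto
    then have klo: "1 - \<alpha> \<le> k" using a1 by simp
    have "t * \<alpha> \<le> 1 * \<alpha>" using t \<alpha> by (intro mult_right_mono) auto
    then have "k \<le> 1 * (1 + s)" unfolding k_def using s(1) by (intro mult_right_mono) auto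
    then have khi: "k \<le> 1 + s" by simp
    show "v \<in> region L"
    proof (cases "k \<le> 1")
      case True
      have "v \<in> closed_segment (\<alpha> *\<^sub>R x + (1 - \<alpha>) *\<^sub>R y) y"
      proof -
        define r where "r = (k - (1 - \<alpha>)) / \<alpha>"
        have r: "0 \<le> r" "r \<le> 1" "1 - \<alpha> + r * \<alpha> = k" using True klo \<alpha> by (auto simp: r_def)
        have "\<alpha> *\<^sub>R x + (1 - \<alpha>) *\<^sub>R y = x + (1 - \<alpha>) *\<^sub>R d"
          "y - (\<alpha> *\<^sub>R x + (1 - \<alpha>) *\<^sub>R y) = \<alpha> *\<^sub>R d" by (simp_all add: y_eq algebra_simps)
        moreover have "x + (1 - \<alpha>) *\<^sub>R d + r *\<^sub>R \<alpha> *\<^sub>R d = v"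
          unfolding vk r(3)[symmetric] by (simp add: scaleR_left.add add.assoc)
        ultimately show ?thesis unfolding closed_segment_param using r(1,2) by metis
      qed
      then show ?thesis using zy by blast
    next
      case False
      have "v \<in> closed_segment y ?y"
      proof -
        define r where "r = (k - 1) / s"
        have "0 < s" using False khi by simp
        then have r: "0 \<le> r" "r \<le> 1" "1 + r * s = k" using False khi by (auto simp: r_def)
        have "y + r *\<^sub>R (?y - y) = v"
          unfolding vk r(3)[symmetric] by (simp add: y_eq algebra_simps)
        then show ?thesis unfolding closed_segment_param using r(1,2) by metis
      qed
      moreover have "closed_segment y ?y \<subseteq> closure (outer L)"
        using yc yc' is_lensD(4)[OF L] by (intro closed_segment_subset convex_closure) auto
      ultimately show ?thesis using beyond[of k] False region_iff[OF L] vk by auto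
    qed
  qed
  ultimately show thesis using that s(2) by blast
qed

text \<open>
  The chord through \<open>x\<close> has the direction of a supporting line of the inner domain. It is bounded:
  a ray in this direction within the outer domain would make it a recession direction of the inner
  domain, contrary to strict convexity at the point of contact. Since \<open>c\<close> and hence \<open>y\<close> lie strictly on
  the inner side of the chord, the abscissa of \<open>y\<close> is outside the range of the chord; the end
  points are named, and the sign of \<open>e\<close> chosen, so that \<open>q\<close> is between \<open>p\<close> and \<open>y\<close>.
\<close>

lemma chord_through_point:
  assumes L: "is_lens L" and x: "x \<in> region L" and y: "y \<in> fixed_boundary L"
    and c: "c \<in> closed_segment x y" "c \<in> inner_dom L"
  obtains p q l e where "p \<in> fixed_boundary L" "q \<in> fixed_boundary L" "0 \<le> l" "l \<le> 1"
    "x = l *\<^sub>R p + (1 - l) *\<^sub>R q" "closed_segment p q \<subseteq> region L"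
    "norm e = 1" "inj_on (\<lambda>v. e \<bullet> v) (fixed_boundary L)" "e \<bullet> q \<le> e \<bullet> p" "e \<bullet> y \<le> e \<bullet> q"
proof -
  have xc: "x \<in> closure (outer L)" "x \<notin> inner_dom L" using x region_iff[OF L] by auto
  obtain a w where a: "a \<noteq> 0" "w \<in> closure (inner_dom L)" "a \<bullet> x \<le> a \<bullet> w"
    "\<And>v. v \<in> inner_dom L \<Longrightarrow> a \<bullet> w < a \<bullet> v" using supporting_slab[OF L xc(2)] by blast
  obtain d where d: "norm d = norm a" "a \<bullet> d = 0" using exists_unit_orthogonal .
  have exits: "\<exists>t\<ge>0. x + t *\<^sub>R d' \<notin> outer L" if "norm d' = norm a" "a \<bullet> d' = 0" for d'
  proof (rule ccontr)
    assume "\<not> ?thesis"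
    then have "upward (inner_dom L) d'"
      using lens_inner_upward_ray[OF L, of d' x] that(1) a(1) by (metis norm_eq_zero)
    then have "w + 1 *\<^sub>R d' \<in> inner_dom L" using upwardD[of "inner_dom L" d' w 1] a(2) by simp
    then show False using a(4)[of "w + 1 *\<^sub>R d'"] that(2) by (simp add: inner_add_right)
  qed
  obtain s where s: "0 \<le> s" "x + s *\<^sub>R d \<in> fixed_boundary L"
    using exits[OF d] ray_meets_fixed_boundary[OF L xc(1)] by blast
  obtain r where r: "0 \<le> r" "x + r *\<^sub>R (- d) \<in> fixed_boundary L"
    using exits[of "- d"] d ray_meets_fixed_boundary[OF L xc(1), of _ "- d"] by auto
  define p q where "p = x + s *\<^sub>R d" "q = x + r *\<^sub>R (- d)"
  have p: "p \<in> fixed_boundary L" and q: "q \<in> fixed_boundary L" using s r by (auto simp: p_q_def)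
  have pq: "a \<bullet> p = a \<bullet> x" "a \<bullet> q = a \<bullet> x" using d by (auto simp: p_q_def inner_add_right inner_diff_right)
  obtain l where l: "0 \<le> l" "l \<le> 1" "x = l *\<^sub>R p + (1 - l) *\<^sub>R q"
  proof (cases "s + r = 0")
    case True
    then have "s = 0" "r = 0" using s r by auto
    then show ?thesis using that[of 1] by (simp add: p_q_def)
  next
    case False
    then have "s + r > 0" using s r by linarith
    then have "(r / (s + r)) * s = (1 - r / (s + r)) * r" by (simp add: field_simps)
    then have "x = (r / (s + r)) *\<^sub>R p + (1 - r / (s + r)) *\<^sub>R q"
      by (simp add: p_q_def scaleR_right_distrib flip: scaleR_left.add scaleR_add_left) (simp add: algebra_simps)
    then show ?thesis using that[of "r / (s + r)"] \<open>s + r > 0\<close> s r by (auto simp: field_simps)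
  qed
  have lev: "a \<bullet> v = a \<bullet> x" if v: "v \<in> closed_segment p q" for v
  proof -
    obtain u where "v = (1 - u) *\<^sub>R p + u *\<^sub>R q" using v unfolding in_segment by blast
    then show ?thesis using pq by (simp add: inner_add_right left_diff_distrib)
  qed
  have segc: "closed_segment p q \<subseteq> closure (outer L)"
    using p q fixed_boundary_iff[OF L] is_lensD(4)[OF L] by (intro closed_segment_subset convex_closure) auto
  have seg: "closed_segment p q \<subseteq> region L"
    using segc lev a(3,4) region_iff[OF L] by fastforce
  have ay: "a \<bullet> x < a \<bullet> y"
  proof -
    obtain u where u: "0 \<le> u" "c = x + u *\<^sub>R (y - x)" using c by (auto simp: closed_segment_param)
    have "a \<bullet> x < a \<bullet> c" using a(3) a(4)[OF c(2)] by linarith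
    then have "0 < u * (a \<bullet> y - a \<bullet> x)" by (simp add: u(2) inner_add_right inner_diff_right)
    then show ?thesis using u(1) by (simp add: zero_less_mult_iff)
  qed
  obtain u0 where u0: "u0 \<in> closure (outer L)" using is_lensD(12)[OF L] closure_subset by blast
  have "\<not> bounded (closure (outer L))" using is_lensD(3)[OF L] bounded_subset closure_subset by blast
  then obtain N where N: "norm N = 1" "\<And>t. 0 \<le> t \<Longrightarrow> u0 + t *\<^sub>R N \<in> closure (outer L)"
    using unbounded_closed_convex_contains_ray[of "closure (outer L)" u0] u0 is_lensD(4)[OF L]
    by (auto intro: convex_closure)
  have N0: "N \<noteq> 0" using N(1) by auto
  have up: "upward (outer L) N" using upward_if_contains_ray[OF is_lensD(1,2)[OF L] N0 N(2)] .
  have "w + 1 *\<^sub>R N \<in> inner_dom L"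
    using upwardD[OF lens_inner_upward[OF L N0 up] a(2), of 1] by simp
  then have aN: "0 < a \<bullet> N" using a(4) by (force simp: inner_add_right)
  obtain e0 where "norm e0 = norm N" "N \<bullet> e0 = 0" using exists_unit_orthogonal .
  then have e0: "norm e0 = 1" "e0 \<bullet> N = 0" using N by (auto simp: inner_commute)
  have inj0: "inj_on (\<lambda>v. e \<bullet> v) (fixed_boundary L)" if "e = e0 \<or> e = - e0" for e
  proof -
    have "norm e = 1" "e \<bullet> N = 0" using that e0 by auto
    then show ?thesis using inj_on_boundary_of_upward[OF L up _ N(1)] by blast
  qed
  \<comment> \<open>a chord point \<open>v\<close> with the abscissa of \<open>y\<close> would lie on or above \<open>y\<close>, against the order of the levels of \<open>a\<close>\<close>
  have no: "e0 \<bullet> v \<noteq> e0 \<bullet> y" if v: "v \<in> closed_segment p q" for v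
  proof
    assume eq: "e0 \<bullet> v = e0 \<bullet> y"
    have "N \<bullet> y \<le> N \<bullet> v"
      using above_closure_point_in[OF up e0(1) N(1) e0(2), of v y] eq y segc v fixed_boundary_iff[OF L]
      by fastforce
    moreover have "y = v + (N \<bullet> y - N \<bullet> v) *\<^sub>R N"
      using same_abscissa_difference[OF e0(1) N(1) e0(2) eq[symmetric]] .
    then have "a \<bullet> y = a \<bullet> v + (N \<bullet> y - N \<bullet> v) * (a \<bullet> N)" by (metis inner_add_right inner_scaleR_right)
    ultimately show False using ay lev[OF v] aN mult_nonpos_nonneg[of "N \<bullet> y - N \<bullet> v" "a \<bullet> N"] by linarith
  qed
  have out: "e0 \<bullet> y < min (e0 \<bullet> p) (e0 \<bullet> q) \<or> max (e0 \<bullet> p) (e0 \<bullet> q) < e0 \<bullet> y"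
  proof (rule ccontr)
    assume "\<not> ?thesis"
    then have "e0 \<bullet> y \<in> closed_segment (e0 \<bullet> p) (e0 \<bullet> q)" by (auto simp: closed_segment_eq_real_ivl)
    then obtain t where t: "0 \<le> t" "t \<le> 1" "e0 \<bullet> y = (1 - t) *\<^sub>R (e0 \<bullet> p) + t *\<^sub>R (e0 \<bullet> q)" by (auto simp: in_segment)
    have "e0 \<bullet> ((1 - t) *\<^sub>R p + t *\<^sub>R q) = e0 \<bullet> y" using t by (simp add: inner_add_right)
    then show False using no[of "(1 - t) *\<^sub>R p + t *\<^sub>R q"] t by (auto simp: in_segment)
  qed
  have "\<exists>e. (e = e0 \<or> e = - e0) \<and> e \<bullet> y \<le> min (e \<bullet> p) (e \<bullet> q)"
  proof (cases "e0 \<bullet> y < min (e0 \<bullet> p) (e0 \<bullet> q)")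
    case True
    then show ?thesis by (intro exI[of _ e0]) auto
  next
    case False
    then show ?thesis using out by (intro exI[of _ "- e0"]) auto
  qed
  then obtain e where e: "e = e0 \<or> e = - e0" "e \<bullet> y \<le> min (e \<bullet> p) (e \<bullet> q)" by blast
  have e1: "norm e = 1" using e(1) e0 by auto
  show thesis
  proof (cases "e \<bullet> q \<le> e \<bullet> p")
    case True
    then show thesis using that[OF p q l seg e1 inj0[OF e(1)]] e(2) by simp
  next
    case False
    have "x = (1 - l) *\<^sub>R q + (1 - (1 - l)) *\<^sub>R p" using l(3) by simp
    then show thesis using that[OF q p _ _ _ _ e1 inj0[OF e(1)], of "1 - l"] l seg e(2) False
      by (simp add: closed_segment_commute)
  qed
qed

section \<open>Supporting lines of the inner domain\<close>

text \<open>
  The level sets are the lines of slope \<open>m\<close> in the coordinates given by \<open>e\<close> and \<open>N\<close>, and the function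
  increases at unit speed in the direction \<open>N\<close>.
\<close>

definition tilt :: "'a::euclidean_space \<Rightarrow> 'a \<Rightarrow> real \<Rightarrow> 'a \<Rightarrow> real" where
  "tilt e N m v = N \<bullet> v - m * (e \<bullet> v)"

lemma tilt_combination:
  "tilt e N m ((1 - u) *\<^sub>R a + u *\<^sub>R b) = (1 - u) * tilt e N m a + u * tilt e N m b"
  by (simp add: tilt_def inner_add_right algebra_simps)

text \<open>
  A vertical supporting line cannot occur at \<open>y\<close>, because it would contain the point \<open>y + N\<close> of the
  open set.
\<close>

lemma supporting_line_with_slope:
  fixes S :: "(real^2) set"
  assumes S: "open S" "convex S" "upward S N" and eN: "norm e = 1" "norm N = 1" "e \<bullet> N = 0"
    and y: "y \<in> closure S" "y \<notin> S"
  obtains k where "\<And>v. v \<in> closure S \<Longrightarrow> tilt e N k y \<le> tilt e N k v"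
    "\<And>v. v \<in> S \<Longrightarrow> tilt e N k y < tilt e N k v"
proof -
  obtain a where a: "\<And>v. v \<in> closure S \<Longrightarrow> a \<bullet> y \<le> a \<bullet> v" "\<And>v. v \<in> S \<Longrightarrow> a \<bullet> y < a \<bullet> v"
    using supporting_hyperplane_relative_frontier[OF S(2) y(1)] y(2) rel_interior_open[OF S(1)] by metis
  have "y + 1 *\<^sub>R N \<in> S" using upwardD[OF S(3) y(1), of 1] by simp
  then have aN: "0 < a \<bullet> N" using a(2)[of "y + 1 *\<^sub>R N"] by (simp add: inner_add_right)
  define k where "k = - (a \<bullet> e) / (a \<bullet> N)"
  have eq: "tilt e N k v = (a \<bullet> v) / (a \<bullet> N)" for v
  proof -
    have "a \<bullet> v = (e \<bullet> v) * (a \<bullet> e) + (N \<bullet> v) * (a \<bullet> N)"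
      using arg_cong[OF planar_coordinates[OF eN, of v], of "\<lambda>v. a \<bullet> v"] by (simp add: inner_add_right)
    then show ?thesis using aN by (simp add: tilt_def k_def field_simps)
  qed
  show thesis using that[of k] a aN unfolding eq by (simp add: divide_right_mono divide_strict_right_mono)
qed

text \<open>
  The point of the segment with the same abscissa as \<open>P\<close> belongs to the closure, so \<open>P\<close> cannot lie
  above it.
\<close>

lemma boundary_below_segment:
  fixes S :: "(real^2) set"
  assumes S: "open S" "convex S" "upward S N" and eN: "norm e = 1" "norm N = 1" "e \<bullet> N = 0"
    and UV: "U \<in> closure S" "V \<in> closure S" and P: "P \<notin> S"
    and t: "0 \<le> t" "t \<le> 1" "e \<bullet> P = (1 - t) * (e \<bullet> U) + t * (e \<bullet> V)"
  shows "tilt e N m P \<le> (1 - t) * tilt e N m U + t * tilt e N m V"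
    and "V \<in> S \<Longrightarrow> 0 < t \<Longrightarrow> tilt e N m P < (1 - t) * tilt e N m U + t * tilt e N m V"
proof -
  define Q where "Q = (1 - t) *\<^sub>R U + t *\<^sub>R V"
  have Q: "Q \<in> closure S" unfolding Q_def using UV t S(2) by (intro convexD convex_closure) auto
  have eQ: "e \<bullet> P = e \<bullet> Q" using t by (simp add: Q_def inner_add_right)
  have le: "N \<bullet> P \<le> N \<bullet> Q" using above_closure_point_in[OF S(3) eN Q eQ] P by linarith
  have tQ: "tilt e N m Q = (1 - t) * tilt e N m U + t * tilt e N m V" unfolding Q_def by (rule tilt_combination)
  show "tilt e N m P \<le> (1 - t) * tilt e N m U + t * tilt e N m V"
    unfolding tQ[symmetric] using le eQ by (simp add: tilt_def)
  assume "V \<in> S" "0 < t"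
  then have "Q \<in> S" using convex_combination_in_open[OF S(1,2) _ UV(1), of V t] t by (simp add: Q_def add.commute)
  then have "P \<noteq> Q" using P by auto
  then have "N \<bullet> P \<noteq> N \<bullet> Q" using same_abscissa_difference[OF eN eQ] by auto
  then show "tilt e N m P < (1 - t) * tilt e N m U + t * tilt e N m V"
    unfolding tQ[symmetric] using le eQ by (simp add: tilt_def)
qed

lemma real_between:
  fixes a b p :: real
  assumes "(a < p \<and> p \<le> b) \<or> (b \<le> p \<and> p < a)"
  obtains t where "0 < t" "t \<le> 1" "p = (1 - t) * a + t * b"
proof
  show "0 < (p - a) / (b - a)" using assms by (auto simp: zero_less_divide_iff)
  show "(p - a) / (b - a) \<le> 1" using assms by (auto simp: divide_le_eq)
  have "(p - a) / (b - a) * (b - a) = p - a" using assms by auto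
  then show "p = (1 - (p - a) / (b - a)) * a + (p - a) / (b - a) * b" by argo
qed

lemma boundary_strictly_below_segment:
  fixes S :: "(real^2) set"
  assumes S: "open S" "convex S" "upward S N" and eN: "norm e = 1" "norm N = 1" "e \<bullet> N = 0"
    and UV: "U \<in> closure S" "V \<in> S" and P: "P \<notin> S"
    and b: "(e \<bullet> U < e \<bullet> P \<and> e \<bullet> P \<le> e \<bullet> V) \<or> (e \<bullet> V \<le> e \<bullet> P \<and> e \<bullet> P < e \<bullet> U)"
    and m: "tilt e N m U \<le> c" "tilt e N m V \<le> c"
  shows "tilt e N m P < c"
proof -
  obtain t where t: "0 < t" "t \<le> 1" "e \<bullet> P = (1 - t) * (e \<bullet> U) + t * (e \<bullet> V)" using real_between[OF b] .
  have "tilt e N m P < (1 - t) * tilt e N m U + t * tilt e N m V"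
    using boundary_below_segment(2)[OF S eN UV(1) subsetD[OF closure_subset UV(2)] P _ t(2,3) UV(2) t(1)] t(1)
    by simp
  also have "\<dots> \<le> c" using convex_bound_le[OF m, of "1 - t" t] t by simp
  finally show ?thesis .
qed

lemma boundary_same_abscissa:
  fixes S :: "(real^2) set"
  assumes "upward S N" and eN: "norm e = 1" "norm N = 1" "e \<bullet> N = 0"
    and "P \<in> closure S" "P \<notin> S" "Q \<in> closure S" "Q \<notin> S" "e \<bullet> P = e \<bullet> Q"
  shows "P = Q"
proof -
  have "N \<bullet> P = N \<bullet> Q"
    using above_closure_point_in[OF assms(1-4), of P Q] above_closure_point_in[OF assms(1-4), of Q P] assms
    by (metis linorder_neqE_linordered_idom)
  then show ?thesis using same_abscissa_difference[OF eN assms(9)] by simp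
qed

text \<open>
  Among the lines through \<open>A\<close> and a point of the inner domain to the right of \<open>A\<close>, the one with the
  least slope is the supporting line. The minimum is attained: only points on or below the line \<open>Az\<close>
  compete, and these cannot have a larger abscissa than \<open>B\<close>, since otherwise \<open>B\<close> would lie above a
  chord of the outer domain. Without such a \<open>B\<close> the minimum may be missing, namely if the inner
  domain has an asymptote through \<open>A\<close>. The last three conclusions compare the fixed boundary with
  the supporting line: it lies above the line left of \<open>A\<close>, below the line between \<open>A\<close> and the point
  of contact, and again above the line from \<open>B\<close> on.
\<close>

lemma tangent_from_boundary_point:
  fixes e N :: "real^2"
  assumes L: "is_lens L" and up: "upward (outer L) N"
    and eN: "norm e = 1" "norm N = 1" "e \<bullet> N = 0"
    and A: "A \<in> fixed_boundary L" and B: "B \<in> fixed_boundary L" and z: "z \<in> inner_dom L"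
    and AzB: "e \<bullet> A < e \<bullet> z" "e \<bullet> A < e \<bullet> B"
    and k: "tilt e N k z = tilt e N k A" "tilt e N k A \<le> tilt e N k B"
  obtains w m where "w \<in> closure (inner_dom L)" "w \<notin> inner_dom L" "e \<bullet> A < e \<bullet> w"
    "tilt e N m w = tilt e N m A"
    "\<And>v. v \<in> closure (inner_dom L) \<Longrightarrow> tilt e N m A \<le> tilt e N m v"
    "\<And>v. v \<in> inner_dom L \<Longrightarrow> tilt e N m A < tilt e N m v"
    "\<And>P. P \<in> fixed_boundary L \<Longrightarrow> e \<bullet> P \<le> e \<bullet> A \<Longrightarrow> tilt e N m A \<le> tilt e N m P"
    "\<And>P. P \<in> fixed_boundary L \<Longrightarrow> e \<bullet> A \<le> e \<bullet> P \<Longrightarrow> e \<bullet> P < e \<bullet> w \<Longrightarrow> tilt e N m P \<le> tilt e N m A"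
    "\<And>P. P \<in> fixed_boundary L \<Longrightarrow> e \<bullet> B \<le> e \<bullet> P \<Longrightarrow> tilt e N m A \<le> tilt e N m P"
proof -
  let ?O = "outer L" and ?I = "inner_dom L"
  note l = is_lensD[OF L]
  note O = l(1,4) up
  have Ac: "A \<in> closure ?O" "A \<notin> ?O" and Bc: "B \<in> closure ?O" "B \<notin> ?O"
    using A B by (auto simp: fixed_boundary_iff[OF L])
  note same = boundary_same_abscissa[OF up eN]
  note strict = boundary_strictly_below_segment[OF O eN]
  have clI: "v \<in> ?O" if "v \<in> closure ?I" for v using that l(9) by blast
  define K where "K = {v \<in> closure ?I. e \<bullet> A \<le> e \<bullet> v \<and> tilt e N k v \<le> tilt e N k A}"
  have zK: "z \<in> K" using z AzB k closure_subset by (auto simp: K_def)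
  have Kgt: "e \<bullet> A < e \<bullet> v" if v: "v \<in> K" for v
  proof (rule ccontr)
    assume "\<not> ?thesis"
    then have eq: "e \<bullet> A = e \<bullet> v" using v by (simp add: K_def)
    then have "N \<bullet> v \<le> N \<bullet> A" using v by (simp add: K_def tilt_def)
    moreover have "v \<in> ?O" using v clI by (simp add: K_def)
    then have "A \<noteq> v" using Ac by auto
    then have "N \<bullet> A \<noteq> N \<bullet> v" using same_abscissa_difference[OF eN eq] by auto
    ultimately show False
      using above_closure_point_in[OF up eN subsetD[OF closure_subset \<open>v \<in> ?O\<close>] eq] Ac by linarith
  qed
  have Kle: "e \<bullet> v \<le> e \<bullet> B" if v: "v \<in> K" for v
  proof (rule ccontr)
    assume "\<not> ?thesis"
    then have "tilt e N k B < tilt e N k A"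
      using strict[OF Ac(1) _ Bc(2), of v k "tilt e N k A"] v AzB clI by (simp add: K_def)
    then show False using k by simp
  qed
  have closedK: "closed K"
  proof -
    have "K = closure ?I \<inter> {v. e \<bullet> A \<le> e \<bullet> v} \<inter> {v. tilt e N k v \<le> tilt e N k A}" by (auto simp: K_def)
    moreover have "closed {v. tilt e N k v \<le> tilt e N k A}"
      unfolding tilt_def by (intro closed_Collect_le continuous_intros)
    ultimately show ?thesis by (auto intro!: closed_Int closed_Collect_le continuous_intros)
  qed
  have boundedK: "bounded K"
  proof -
    \<comment> \<open>a supporting line of the outer domain bounds the competitors from below\<close>
    obtain j where j: "\<And>v. v \<in> closure ?O \<Longrightarrow> tilt e N j A \<le> tilt e N j v"
      using supporting_line_with_slope[OF O eN Ac] by blast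
    define E where "E = \<bar>e \<bullet> A\<bar> + \<bar>e \<bullet> B\<bar>"
    have "norm v \<le> E + (\<bar>tilt e N k A\<bar> + \<bar>tilt e N j A\<bar> + (\<bar>k\<bar> + \<bar>j\<bar>) * E)" if v: "v \<in> K" for v
    proof -
      have ev: "\<bar>e \<bullet> v\<bar> \<le> E" using Kgt[OF v] Kle[OF v] by (auto simp: E_def)
      have ke: "\<bar>k * (e \<bullet> v)\<bar> \<le> \<bar>k\<bar> * E" "\<bar>j * (e \<bullet> v)\<bar> \<le> \<bar>j\<bar> * E"
        unfolding abs_mult using ev by (auto intro: mult_left_mono)
      have "v \<in> closure ?O" using v clI closure_subset by (auto simp: K_def)
      then have "tilt e N j A \<le> N \<bullet> v - j * (e \<bullet> v)" using j by (simp add: tilt_def)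
      moreover have "N \<bullet> v - k * (e \<bullet> v) \<le> tilt e N k A" using v by (simp add: K_def tilt_def)
      ultimately have "\<bar>N \<bullet> v\<bar> \<le> \<bar>tilt e N k A\<bar> + \<bar>tilt e N j A\<bar> + (\<bar>k\<bar> + \<bar>j\<bar>) * E"
        using ke by (simp add: distrib_right)
      moreover have "norm v \<le> \<bar>e \<bullet> v\<bar> + \<bar>N \<bullet> v\<bar>"
        using norm_triangle_ineq[of "(e \<bullet> v) *\<^sub>R e" "(N \<bullet> v) *\<^sub>R N"] planar_coordinates[OF eN, of v] eN by simp
      ultimately show ?thesis using ev by linarith
    qed
    then show ?thesis unfolding bounded_iff by blast
  qed
  have "continuous_on K (\<lambda>v. (N \<bullet> v - N \<bullet> A) / (e \<bullet> v - e \<bullet> A))"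
    using Kgt by (force intro!: continuous_intros)
  then obtain w where w: "w \<in> K"
    and wmin: "\<And>v. v \<in> K \<Longrightarrow> (N \<bullet> w - N \<bullet> A) / (e \<bullet> w - e \<bullet> A) \<le> (N \<bullet> v - N \<bullet> A) / (e \<bullet> v - e \<bullet> A)"
    using continuous_attains_inf[of K "\<lambda>v. (N \<bullet> v - N \<bullet> A) / (e \<bullet> v - e \<bullet> A)"] closedK boundedK zK
    by (auto simp: compact_eq_bounded_closed)
  define m where "m = (N \<bullet> w - N \<bullet> A) / (e \<bullet> w - e \<bullet> A)"
  have wc: "w \<in> closure ?I" "w \<in> ?O" and wA: "e \<bullet> A < e \<bullet> w" using w Kgt clI by (auto simp: K_def)
  have mw: "tilt e N m w = tilt e N m A" using wA by (simp add: tilt_def m_def field_simps)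
  have mK: "tilt e N m A \<le> tilt e N m v" if v: "v \<in> K" for v
  proof -
    have "m \<le> (N \<bullet> v - N \<bullet> A) / (e \<bullet> v - e \<bullet> A)" using wmin[OF v] by (simp add: m_def)
    then have "m * (e \<bullet> v - e \<bullet> A) \<le> N \<bullet> v - N \<bullet> A" using Kgt[OF v] by (simp add: le_divide_eq)
    then show ?thesis by (simp add: tilt_def algebra_simps)
  qed
  \<comment> \<open>the line \<open>Az\<close> itself competes\<close>
  have mk: "m \<le> k"
  proof -
    have "(k - m) * (e \<bullet> z - e \<bullet> A) \<ge> 0" using mK[OF zK] k(1) by (simp add: tilt_def algebra_simps)
    then show ?thesis using AzB by (simp add: zero_le_mult_iff)
  qed
  have steeper: "tilt e N m A \<le> tilt e N m v" if "tilt e N k A \<le> tilt e N k v" "e \<bullet> A \<le> e \<bullet> v" for v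
    using that mult_right_mono[OF mk, of "e \<bullet> v - e \<bullet> A"] by (simp add: tilt_def algebra_simps)
  have cl: "tilt e N m A \<le> tilt e N m v" if v: "v \<in> closure ?I" for v
  proof (cases "e \<bullet> A \<le> e \<bullet> v")
    case True
    then show ?thesis using v mK[of v] steeper[of v] by (cases "v \<in> K") (auto simp: K_def)
  next
    case False
    show ?thesis
    proof (rule ccontr)
      assume "\<not> ?thesis"
      then show False
        using strict[OF subsetD[OF closure_subset clI[OF v]] wc(2) Ac(2), of m "tilt e N m A"] False wA mw
        by simp
    qed
  qed
  have inn: "tilt e N m A < tilt e N m v" if v: "v \<in> ?I" for v
  proof -
    have eq: "tilt e N m v = (N - m *\<^sub>R e) \<bullet> v" for v by (simp add: tilt_def inner_diff_left)
    have "N \<bullet> (N - m *\<^sub>R e) = 1" using eN by (simp add: inner_diff_right norm_eq_1 inner_commute)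
    then have "N - m *\<^sub>R e \<noteq> 0" by auto
    then show ?thesis
      using open_half_space_strict[OF l(5) _ _ v, of "N - m *\<^sub>R e" "tilt e N m A"] cl closure_subset
      by (auto simp flip: eq)
  qed
  have left: "tilt e N m A \<le> tilt e N m P" if P: "P \<in> fixed_boundary L" "e \<bullet> P \<le> e \<bullet> A" for P
  proof (cases "e \<bullet> P = e \<bullet> A")
    case True
    then have "P = A" using same[OF _ _ Ac] P(1) by (simp add: fixed_boundary_iff[OF L])
    then show ?thesis by simp
  next
    case False
    show ?thesis
    proof (rule ccontr)
      assume "\<not> ?thesis"
      then show False
        using strict[OF _ wc(2) Ac(2), of P m "tilt e N m A"] False P wA mw by (simp add: fixed_boundary_iff[OF L])
    qed
  qed
  have mid: "tilt e N m P \<le> tilt e N m A"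
    if P: "P \<in> fixed_boundary L" "e \<bullet> A \<le> e \<bullet> P" "e \<bullet> P < e \<bullet> w" for P
  proof (cases "e \<bullet> P = e \<bullet> A")
    case True
    then have "P = A" using same[OF _ _ Ac] P(1) by (simp add: fixed_boundary_iff[OF L])
    then show ?thesis by simp
  next
    case False
    then show ?thesis
      using strict[OF Ac(1) wc(2), of P m "tilt e N m A"] P mw by (simp add: fixed_boundary_iff[OF L])
  qed
  have right: "tilt e N m A \<le> tilt e N m P" if P: "P \<in> fixed_boundary L" "e \<bullet> B \<le> e \<bullet> P" for P
  proof (cases "e \<bullet> P = e \<bullet> B")
    case True
    then have "P = B" using same[OF _ _ Bc] P(1) by (simp add: fixed_boundary_iff[OF L])
    then show ?thesis using steeper[of B] AzB k by simp
  next
    case False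
    show ?thesis
    proof (rule ccontr)
      assume neg: "\<not> ?thesis"
      obtain t where t: "0 < t" "t \<le> 1" "e \<bullet> B = (1 - t) * (e \<bullet> A) + t * (e \<bullet> P)"
        using real_between[of "e \<bullet> A" "e \<bullet> B" "e \<bullet> P"] AzB P by auto
      have "tilt e N m B \<le> (1 - t) * tilt e N m A + t * tilt e N m P"
        using boundary_below_segment(1)[OF O eN Ac(1) _ Bc(2) _ t(2,3)] P t(1) by (auto simp: fixed_boundary_iff[OF L])
      also have "\<dots> = tilt e N m A + t * (tilt e N m P - tilt e N m A)" by (simp add: algebra_simps)
      also have "\<dots> < tilt e N m A" using neg t(1) by (simp add: mult_pos_neg)
      finally show False using steeper[of B] AzB k by simp
    qed
  qed
  have "w \<notin> ?I" using inn[of w] mw by auto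
  then show thesis using that[OF wc(1) _ wA mw cl inn left mid right] by blast
qed

text \<open>
  Write \<open>T\<close> for the line of slope \<open>m\<close> through \<open>w\<close>. If the point \<open>y\<close> at which \<open>[z, x]\<close> leaves the convex
  set were to the right of \<open>w\<close>, the supporting line at \<open>y\<close> would be steeper than \<open>T\<close>, hence below \<open>T\<close> on
  the left of \<open>w\<close>, and the point \<open>P\<close> could not lie below it. So \<open>y\<close> is on the left. If \<open>x\<close> were
  on the right, the segment \<open>[y, x]\<close>, which is above \<open>T\<close>, would pass above \<open>w\<close> and thus return to the
  set after having left it.
\<close>

lemma left_of_tangency_point:
  fixes e N :: "real^2"
  assumes S: "convex S" "upward S N" and eN: "norm e = 1" "norm N = 1" "e \<bullet> N = 0"
    and w: "w \<in> closure S" "\<And>v. v \<in> closure S \<Longrightarrow> tilt e N m w \<le> tilt e N m v"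
    and z: "z \<in> S" "tilt e N m w < tilt e N m z" and x: "tilt e N m w < tilt e N m x"
    and y: "y \<in> closed_segment z x" "y \<in> closure S" "y \<notin> S"
      "\<And>v. v \<in> closure S \<Longrightarrow> tilt e N k y \<le> tilt e N k v"
    and P: "e \<bullet> P \<le> e \<bullet> w" "tilt e N m w \<le> tilt e N m P" "tilt e N k P < tilt e N k y"
  shows "e \<bullet> x < e \<bullet> w"
proof (rule ccontr)
  assume xw: "\<not> e \<bullet> x < e \<bullet> w"
  have yw: "e \<bullet> y \<le> e \<bullet> w"
  proof (rule ccontr)
    assume "\<not> ?thesis"
    then have lt: "e \<bullet> w < e \<bullet> y" by simp
    have "(k - m) * (e \<bullet> y - e \<bullet> w) \<ge> 0" using w(2)[OF y(2)] y(4)[OF w(1)] by (simp add: tilt_def algebra_simps)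
    then have "m \<le> k" using lt by (simp add: zero_le_mult_iff)
    then have "(k - m) * (e \<bullet> P) \<le> (k - m) * (e \<bullet> w)" using P(1) by (intro mult_left_mono) auto
    then have "tilt e N k w \<le> tilt e N k P" using P(2) by (simp add: tilt_def algebra_simps)
    then show False using y(4)[OF w(1)] P(3) by simp
  qed
  obtain u where u: "0 \<le> u" "u \<le> 1" "y = z + u *\<^sub>R (x - z)" using y(1) by (auto simp: closed_segment_param)
  have ty: "tilt e N m w < tilt e N m y"
  proof -
    have "y = (1 - u) *\<^sub>R z + u *\<^sub>R x" by (simp add: u(3) algebra_simps)
    then have "tilt e N m y = (1 - u) * tilt e N m z + u * tilt e N m x" by (simp only: tilt_combination)
    moreover have "- ((1 - u) * tilt e N m z + u * tilt e N m x) < - tilt e N m w"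
      using convex_bound_lt[of "- tilt e N m z" "- tilt e N m w" "- tilt e N m x" "1 - u" u] z(2) x u by simp
    ultimately show ?thesis by simp
  qed
  obtain t where t: "0 \<le> t" "t \<le> 1" "e \<bullet> w = (1 - t) * (e \<bullet> y) + t * (e \<bullet> x)"
  proof (cases "e \<bullet> y = e \<bullet> w")
    case True
    then show ?thesis using that[of 0] by simp
  next
    case False
    then have "(e \<bullet> y < e \<bullet> w \<and> e \<bullet> w \<le> e \<bullet> x) \<or> (e \<bullet> x \<le> e \<bullet> w \<and> e \<bullet> w < e \<bullet> y)" using xw yw by simp
    then obtain t where "0 < t" "t \<le> 1" "e \<bullet> w = (1 - t) * (e \<bullet> y) + t * (e \<bullet> x)" using real_between by blast
    then show ?thesis using that[of t] by simp
  qed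
  \<comment> \<open>the point of \<open>[y, x]\<close> directly above \<open>w\<close>\<close>
  define v where "v = (1 - t) *\<^sub>R y + t *\<^sub>R x"
  have ev: "e \<bullet> v = e \<bullet> w" by (simp add: v_def inner_add_right t(3))
  have "- ((1 - t) * tilt e N m y + t * tilt e N m x) < - tilt e N m w"
    using convex_bound_lt[of "- tilt e N m y" "- tilt e N m w" "- tilt e N m x" "1 - t" t] ty x t by simp
  then have "tilt e N m w < tilt e N m v" unfolding v_def tilt_combination by simp
  then have "N \<bullet> w < N \<bullet> v" using ev by (simp add: tilt_def)
  then have vS: "v \<in> S" using above_closure_point_in[OF S(2) eN w(1) ev] by simp
  \<comment> \<open>\<open>y\<close> lies between the points \<open>z\<close> and \<open>v\<close> of the convex set\<close>
  define j where "j = u + t * (1 - u)"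
  have vz: "v = z + j *\<^sub>R (x - z)" by (simp add: v_def u(3) j_def algebra_simps)
  have ju: "u \<le> j" using t u by (simp add: j_def)
  have j0: "0 < j"
  proof (rule ccontr)
    assume "\<not> 0 < j"
    then have "u = 0" using ju u by linarith
    then show False using u(3) y(3) z(1) by simp
  qed
  have "y = (1 - u / j) *\<^sub>R z + (u / j) *\<^sub>R v" using j0 by (simp add: vz u(3) algebra_simps)
  moreover have "(1 - u / j) *\<^sub>R z + (u / j) *\<^sub>R v \<in> S"
    using j0 ju u by (intro convexD[OF S(1) z(1) vS]) auto
  ultimately show False using y(3) by simp
qed

section \<open>Atoms of finite algebras and convergence of martingales\<close>

definition finite_subalgebra :: "'a measure \<Rightarrow> 'a set set \<Rightarrow> bool" where
  "finite_subalgebra M \<A> \<longleftrightarrow> algebra (space M) \<A> \<and> finite \<A> \<and> \<A> \<subseteq> sets M"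

lemma atom_inside_or_disjoint:
  assumes "finite_subalgebra M \<A>" "\<omega> \<in> atoms M \<A>" "A \<in> \<A>"
  shows "\<omega> \<subseteq> A \<or> \<omega> \<inter> A = {}"
proof -
  interpret algebra "space M" \<A> using assms by (simp add: finite_subalgebra_def)
  have "\<omega> \<inter> A \<in> \<A>" using assms by (auto simp: atoms_def)
  then show ?thesis using assms(2) by (auto simp: atoms_def)
qed

lemma atoms_eqI:
  assumes "finite_subalgebra M \<A>" "\<omega> \<in> atoms M \<A>" "\<omega>' \<in> atoms M \<A>" "x \<in> \<omega>" "x \<in> \<omega>'"
  shows "\<omega> = \<omega>'"
  using atom_inside_or_disjoint[OF assms(1,2), of \<omega>'] atom_inside_or_disjoint[OF assms(1,3), of \<omega>] assms
  by (auto simp: atoms_def)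

lemma atom_sets:
  assumes "finite_subalgebra M \<A>" "\<omega> \<in> atoms M \<A>"
  shows "\<omega> \<in> sets M" "\<omega> \<in> \<A>" "0 < measure M \<omega>" "finite (atoms M \<A>)"
  using assms by (auto simp: finite_subalgebra_def atoms_def)

lemma finite_atoms: "finite_subalgebra M \<A> \<Longrightarrow> finite (atoms M \<A>)"
  by (auto simp: finite_subalgebra_def atoms_def)

text \<open>
  The intersection of all members that contain a given point is a minimal member. It is an atom
  unless it has measure zero, and there are only finitely many members of measure zero.
\<close>

lemma AE_in_some_atom:
  assumes "finite_measure M" and A: "finite_subalgebra M \<A>"
  shows "AE x in M. \<exists>\<omega>\<in>atoms M \<A>. x \<in> \<omega>"
proof -
  interpret finite_measure M by fact
  interpret algebra "space M" \<A> using A by (simp add: finite_subalgebra_def)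
  let ?Z = "\<Union>{B\<in>\<A>. measure M B = 0}"
  have null: "?Z \<in> null_sets M"
  proof -
    have "(\<Union>B\<in>{B\<in>\<A>. measure M B = 0}. B) \<in> null_sets M"
    proof (rule null_sets_UN')
      show "countable {B\<in>\<A>. measure M B = 0}" using A by (auto simp: finite_subalgebra_def intro: countable_finite)
    qed (use A in \<open>auto simp: finite_subalgebra_def null_sets_def emeasure_eq_measure\<close>)
    then show ?thesis by simp
  qed
  show ?thesis
  proof (rule AE_I'[OF null], intro subsetI, rule ccontr)
    fix x assume x: "x \<in> {x \<in> space M. \<not> (\<exists>\<omega>\<in>atoms M \<A>. x \<in> \<omega>)}" and nZ: "x \<notin> ?Z"
    define C where "C = (\<Inter>B\<in>{B\<in>\<A>. x \<in> B}. B)"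
    have C: "C \<in> \<A>" unfolding C_def
      using A x by (intro finite_INT) (auto simp: finite_subalgebra_def)
    have xC: "x \<in> C" by (auto simp: C_def)
    have "B = C" if B: "B \<in> \<A>" "B \<subseteq> C" "B \<noteq> {}" for B
    proof (cases "x \<in> B")
      case True
      then show ?thesis using B by (auto simp: C_def)
    next
      case False
      then have "C \<subseteq> C - B" using B C xC by (subst C_def) auto
      then show ?thesis using B by auto
    qed
    moreover have "measure M C > 0" using nZ C xC by (metis (mono_tags, lifting) UnionI mem_Collect_eq zero_less_measure_iff)
    ultimately have "C \<in> atoms M \<A>" using C by (auto simp: atoms_def)
    then show False using x xC by auto
  qed
qed

lemma sum_atoms_eq:
  assumes A: "finite_subalgebra M \<A>" and w: "\<omega> \<in> atoms M \<A>" "x \<in> \<omega>"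
  shows "(\<Sum>\<omega>'\<in>atoms M \<A>. indicator \<omega>' x *\<^sub>R g \<omega>') = (g \<omega> :: 'b::real_vector)"
proof -
  have "(\<Sum>\<omega>'\<in>atoms M \<A>. indicator \<omega>' x *\<^sub>R g \<omega>') = (\<Sum>\<omega>'\<in>atoms M \<A>. if \<omega>' = \<omega> then g \<omega> else 0)"
    using atoms_eqI[OF A w(1)] w by (intro sum.cong) (auto simp: indicator_def)
  then show ?thesis using w finite_atoms[OF A] by simp
qed

lemma martingale_on_atom:
  assumes "finite_subalgebra M (F n)" "\<omega> \<in> atoms M (F n)" "x \<in> \<omega>"
  shows "martingale M F f n x = average M \<omega> f"
  unfolding martingale_def using sum_atoms_eq[OF assms] .

lemma integral_eq_sum_atoms:
  fixes f :: "'a \<Rightarrow> 'b::{banach, second_countable_topology}"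
  assumes M: "finite_measure M" and A: "finite_subalgebra M \<A>" and f: "integrable M f" and B: "B \<in> \<A>"
  shows "(LINT x:B|M. f x) = (\<Sum>\<omega>\<in>{\<omega>\<in>atoms M \<A>. \<omega> \<subseteq> B}. LINT x:\<omega>|M. f x)"
proof -
  interpret finite_measure M by fact
  have int: "integrable M (\<lambda>x. indicator \<omega> x *\<^sub>R f x)" if "\<omega> \<in> atoms M \<A>" for \<omega>
    using f atom_sets[OF A that] by (intro integrable_mult_indicator) auto
  have "(LINT x:B|M. f x) = (LINT x|M. (\<Sum>\<omega>\<in>{\<omega>\<in>atoms M \<A>. \<omega> \<subseteq> B}. indicator \<omega> x *\<^sub>R f x))"
    unfolding set_lebesgue_integral_def
  proof (rule integral_cong_AE)
    show "(\<lambda>x. indicator B x *\<^sub>R f x) \<in> borel_measurable M"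
      using f B A by (intro borel_measurable_integrable integrable_mult_indicator) (auto simp: finite_subalgebra_def)
    show "(\<lambda>x. \<Sum>\<omega>\<in>{\<omega> \<in> atoms M \<A>. \<omega> \<subseteq> B}. indicator \<omega> x *\<^sub>R f x) \<in> borel_measurable M"
      using int by (intro borel_measurable_integrable Bochner_Integration.integrable_sum) auto
    show "AE x in M. indicator B x *\<^sub>R f x = (\<Sum>\<omega>\<in>{\<omega> \<in> atoms M \<A>. \<omega> \<subseteq> B}. indicator \<omega> x *\<^sub>R f x)"
      using AE_in_some_atom[OF M A]
    proof eventually_elim
      case (elim x)
      then obtain \<omega> where w: "\<omega> \<in> atoms M \<A>" "x \<in> \<omega>" by blast
      have "(\<Sum>\<omega>\<in>{\<omega> \<in> atoms M \<A>. \<omega> \<subseteq> B}. indicator \<omega> x *\<^sub>R f x)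
          = (\<Sum>\<omega>'\<in>atoms M \<A>. indicator \<omega>' x *\<^sub>R (if \<omega>' \<subseteq> B then f x else 0))"
        unfolding sum.inter_filter[OF finite_atoms[OF A]] by (intro sum.cong) auto
      also have "\<dots> = (if \<omega> \<subseteq> B then f x else 0)" using sum_atoms_eq[OF A w] .
      also have "\<dots> = indicator B x *\<^sub>R f x"
        using atom_inside_or_disjoint[OF A w(1) B] w(2) by (auto simp: indicator_def)
      finally show ?case by simp
    qed
  qed
  also have "\<dots> = (\<Sum>\<omega>\<in>{\<omega>\<in>atoms M \<A>. \<omega> \<subseteq> B}. LINT x:\<omega>|M. f x)"
    unfolding set_lebesgue_integral_def using int by (intro Bochner_Integration.integral_sum) auto
  finally show ?thesis .
qed

lemma set_integral_one_measure:
  assumes "finite_measure M" "B \<in> sets M"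
  shows "(LINT x:B|M. 1::real) = measure M B"
  using assms unfolding set_lebesgue_integral_def by simp

lemma measure_eq_sum_atoms:
  assumes M: "finite_measure M" and A: "finite_subalgebra M \<A>" and B: "B \<in> \<A>"
  shows "measure M B = (\<Sum>\<omega>\<in>{\<omega>\<in>atoms M \<A>. \<omega> \<subseteq> B}. measure M \<omega>)"
proof -
  interpret finite_measure M by fact
  have "(LINT x:B|M. 1::real) = (\<Sum>\<omega>\<in>{\<omega>\<in>atoms M \<A>. \<omega> \<subseteq> B}. LINT x:\<omega>|M. 1)"
    by (rule integral_eq_sum_atoms[OF M A _ B]) simp
  then show ?thesis using set_integral_one_measure[OF M] A B
    by (simp add: finite_subalgebra_def atoms_def subset_iff)
qed

lemma measure_average:
  assumes "0 < measure M A"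
  shows "measure M A *\<^sub>R average M A f = (LINT x:A|M. f x)"
  using assms by (simp add: average_def)

lemma finite_filtrationD:
  assumes "finite_filtration M F"
  shows "finite_subalgebra M (F n)" "mono F" "F 0 = {{}, space M}" "F n \<subseteq> sets M"
  using assms by (auto simp: finite_filtration_def finite_subalgebra_def)

lemma atom_below_atom:
  assumes M: "finite_measure M" and F: "finite_subalgebra M \<A>" "finite_subalgebra M \<B>" "\<A> \<subseteq> \<B>"
    and w: "\<omega>' \<in> atoms M \<B>"
  shows "\<exists>\<omega>\<in>atoms M \<A>. \<omega>' \<subseteq> \<omega>"
proof -
  interpret finite_measure M by fact
  have "\<exists>\<omega>\<in>atoms M \<A>. \<omega>' \<inter> \<omega> \<noteq> {}"
  proof (rule ccontr)
    assume n: "\<not> ?thesis"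
    have "AE x in M. x \<notin> \<omega>'" using AE_in_some_atom[OF M F(1)] by eventually_elim (use n in auto)
    then have "\<omega>' \<in> null_sets M" using atom_sets[OF F(2) w] AE_iff_null_sets by blast
    then show False using atom_sets[OF F(2) w] by (auto simp: measure_def)
  qed
  then show ?thesis using atom_inside_or_disjoint[OF F(2) w] F(3) by (meson atom_sets(2)[OF F(1)] subsetD)
qed

lemma sum_children:
  assumes M: "finite_measure M" and F: "finite_filtration M F"
  shows "(\<Sum>\<omega>'\<in>atoms M (F (Suc n)). g \<omega>') = (\<Sum>\<omega>\<in>atoms M (F n). \<Sum>\<omega>'\<in>children M F n \<omega>. g \<omega>')"
proof -
  note fa = finite_filtrationD[OF F]
  have sub: "F n \<subseteq> F (Suc n)" using monoD[OF fa(2), of n "Suc n"] by simp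
  have eq: "atoms M (F (Suc n)) = (\<Union>\<omega>\<in>atoms M (F n). children M F n \<omega>)"
    using atom_below_atom[OF M fa(1) fa(1) sub] by (auto simp: children_def)
  show ?thesis unfolding eq
  proof (rule sum.UNION_disjoint)
    show "finite (atoms M (F n))" using finite_atoms[OF fa(1)] .
    show "\<forall>\<omega>\<in>atoms M (F n). finite (children M F n \<omega>)" using finite_atoms[OF fa(1)] by (auto simp: children_def)
    show "\<forall>\<omega>\<in>atoms M (F n). \<forall>\<omega>2\<in>atoms M (F n). \<omega> \<noteq> \<omega>2 \<longrightarrow> children M F n \<omega> \<inter> children M F n \<omega>2 = {}"
    proof (intro ballI impI, rule ccontr)
      fix \<omega> \<omega>2 assume w: "\<omega> \<in> atoms M (F n)" "\<omega>2 \<in> atoms M (F n)" "\<omega> \<noteq> \<omega>2"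
        and "children M F n \<omega> \<inter> children M F n \<omega>2 \<noteq> {}"
      then obtain \<eta> where \<eta>: "\<eta> \<in> atoms M (F (Suc n))" "\<eta> \<subseteq> \<omega>" "\<eta> \<subseteq> \<omega>2" by (auto simp: children_def)
      have "\<eta> \<noteq> {}" using \<eta>(1) by (auto simp: atoms_def)
      then show False using atoms_eqI[OF fa(1) w(1,2)] w(3) \<eta> by blast
    qed
  qed
qed

lemma siblings_average:
  fixes f :: "'a \<Rightarrow> 'b::euclidean_space"
  assumes M: "finite_measure M" and F: "finite_filtration M F" and f: "integrable M f"
    and \<omega>: "\<omega> \<in> atoms M (F n)" and C: "children M F n \<omega> = {a, b}" "a \<noteq> b"
  obtains t where "0 < t" "t < 1" "measure M a = (1 - t) * measure M \<omega>" "measure M b = t * measure M \<omega>"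
    "average M \<omega> f = (1 - t) *\<^sub>R average M a f + t *\<^sub>R average M b f"
proof
  note fa = finite_filtrationD(1)[OF F]
  define t where "t = measure M b / measure M \<omega>"
  have inF: "\<omega> \<in> F (Suc n)"
    using atom_sets(2)[OF fa \<omega>] monoD[OF finite_filtrationD(2)[OF F], of n "Suc n"] by auto
  have "a \<in> atoms M (F (Suc n))" "b \<in> atoms M (F (Suc n))" using C(1) by (auto simp: children_def)
  then have p: "0 < measure M \<omega>" "0 < measure M a" "0 < measure M b"
    using atom_sets(3)[OF fa] \<omega> by blast+
  have m: "measure M \<omega> = measure M a + measure M b"
    using measure_eq_sum_atoms[OF M fa inF] C by (simp add: children_def)
  have i: "(LINT x:\<omega>|M. f x) = (LINT x:a|M. f x) + (LINT x:b|M. f x)"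
    using integral_eq_sum_atoms[OF M fa f inF] C by (simp add: children_def)
  show "0 < t" "t < 1" "measure M b = t * measure M \<omega>" using m p by (auto simp: t_def)
  have t1: "1 - t = measure M a / measure M \<omega>" using m p by (simp add: t_def field_simps)
  then show "measure M a = (1 - t) * measure M \<omega>" using p by simp
  show "average M \<omega> f = (1 - t) *\<^sub>R average M a f + t *\<^sub>R average M b f"
    unfolding t1 using p i by (simp add: t_def average_def scaleR_add_right)
qed

lemma jensen_along_filtration:
  assumes M: "finite_measure M" and F: "finite_filtration M F"
    and step: "\<And>n \<omega>. \<omega> \<in> atoms M (F n) \<Longrightarrow>
      measure M \<omega> * r (average M \<omega> f) \<le> (\<Sum>\<omega>'\<in>children M F n \<omega>. measure M \<omega>' * r (average M \<omega>' f))"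
    and sp: "0 < measure M (space M)"
  shows "measure M (space M) * r (average M (space M) f) \<le> (\<Sum>\<omega>\<in>atoms M (F n). measure M \<omega> * r (average M \<omega> f))"
proof (induction n)
  case 0
  have "atoms M (F 0) = {space M}" using sp unfolding finite_filtrationD(3)[OF F] atoms_def by auto
  then show ?case by simp
next
  case (Suc n)
  have "(\<Sum>\<omega>\<in>atoms M (F n). measure M \<omega> * r (average M \<omega> f))
    \<le> (\<Sum>\<omega>\<in>atoms M (F n). \<Sum>\<omega>'\<in>children M F n \<omega>. measure M \<omega>' * r (average M \<omega>' f))"
    by (intro sum_mono step)
  then show ?case using Suc sum_children[OF M F, of "\<lambda>\<omega>. measure M \<omega> * r (average M \<omega> f)" n] by linarith
qed

lemma average_add:
  assumes "integrable M f" "integrable M g" "A \<in> sets M"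
  shows "average M A (\<lambda>x. f x + g x) = average M A f + average M A g"
  unfolding average_def using assms
  by (subst set_integral_add) (auto simp: set_integrable_def scaleR_add_right intro!: integrable_mult_indicator)

lemma martingale_add:
  assumes F: "finite_filtration M F" and f: "integrable M f" "integrable M g"
  shows "martingale M F (\<lambda>x. f x + g x) n x = martingale M F f n x + martingale M F g n x"
  unfolding martingale_def sum.distrib[symmetric]
  using average_add[OF f] atom_sets(1)[OF finite_filtrationD(1)[OF F]]
  by (intro sum.cong) (auto simp: scaleR_add_right)

lemma integrable_martingale:
  assumes M: "finite_measure M" and F: "finite_filtration M F"
  shows "integrable M (martingale M F f n)"
proof -
  interpret finite_measure M by fact
  have "integrable M (\<lambda>x. \<Sum>\<omega>\<in>atoms M (F n). indicator \<omega> x *\<^sub>R average M \<omega> f)"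
    using atom_sets(1)[OF finite_filtrationD(1)[OF F]]
    by (intro Bochner_Integration.integrable_sum integrable_mult_indicator) auto
  then show ?thesis unfolding martingale_def .
qed

lemma martingale_contraction:
  assumes M: "finite_measure M" and F: "finite_filtration M F" and f: "integrable M f"
  shows "(LINT x|M. norm (martingale M F f n x)) \<le> (LINT x|M. norm (f x))"
proof -
  interpret finite_measure M by fact
  note fa = finite_filtrationD(1)[OF F, of n]
  have ms: "\<omega> \<in> sets M" if "\<omega> \<in> atoms M (F n)" for \<omega> using atom_sets(1)[OF fa that] .
  have "(LINT x|M. norm (martingale M F f n x)) \<le> (LINT x|M. (\<Sum>\<omega>\<in>atoms M (F n). indicator \<omega> x * norm (average M \<omega> f)))"
  proof (rule integral_mono)
    show "integrable M (\<lambda>x. norm (martingale M F f n x))" using integrable_martingale[OF M F] by auto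
    show "integrable M (\<lambda>x. \<Sum>\<omega>\<in>atoms M (F n). indicator \<omega> x * norm (average M \<omega> f))"
      using ms by (intro Bochner_Integration.integrable_sum integrable_mult_left integrable_real_indicator) (auto simp: emeasure_eq_measure)
    show "norm (martingale M F f n x) \<le> (\<Sum>\<omega>\<in>atoms M (F n). indicator \<omega> x * norm (average M \<omega> f))" for x
      unfolding martingale_def by (rule order_trans[OF norm_sum]) simp
  qed
  also have "\<dots> = (\<Sum>\<omega>\<in>atoms M (F n). measure M \<omega> * norm (average M \<omega> f))"
    using ms by (subst Bochner_Integration.integral_sum) (auto simp: emeasure_eq_measure intro!: sum.cong)
  also have "\<dots> \<le> (\<Sum>\<omega>\<in>atoms M (F n). LINT x:\<omega>|M. norm (f x))"
  proof (rule sum_mono)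
    fix \<omega> assume w: "\<omega> \<in> atoms M (F n)"
    have "measure M \<omega> * norm (average M \<omega> f) = norm (measure M \<omega> *\<^sub>R average M \<omega> f)" by simp
    also have "\<dots> = norm (LINT x:\<omega>|M. f x)" using measure_average atom_sets(3)[OF fa w] by metis
    also have "\<dots> \<le> (LINT x:\<omega>|M. norm (f x))"
      unfolding set_lebesgue_integral_def by (rule order_trans[OF integral_norm_bound]) simp
    finally show "measure M \<omega> * norm (average M \<omega> f) \<le> (LINT x:\<omega>|M. norm (f x))" .
  qed
  also have "\<dots> = (LINT x:space M|M. norm (f x))"
  proof -
    have "space M \<in> F n" using fa algebra.top by (auto simp: finite_subalgebra_def)
    moreover have "{\<omega>\<in>atoms M (F n). \<omega> \<subseteq> space M} = atoms M (F n)" using ms sets.sets_into_space by blast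
    ultimately show ?thesis using integral_eq_sum_atoms[OF M fa, of "\<lambda>x. norm (f x)" "space M"] f by simp
  qed
  also have "\<dots> = (LINT x|M. norm (f x))" using f by (intro set_integral_space) auto
  finally show ?thesis .
qed

text \<open>
  The functions with this property form a closed subspace of \<open>L\<^sup>1\<close>, because averaging over atoms is a
  contraction; everything therefore reduces to indicator functions of members of the algebras.
\<close>

definition L1_convergent :: "'a measure \<Rightarrow> (nat \<Rightarrow> 'a set set) \<Rightarrow> ('a \<Rightarrow> real^2) \<Rightarrow> bool" where
  "L1_convergent M F f \<longleftrightarrow> (\<forall>\<epsilon>>0. \<exists>n0. \<forall>n\<ge>n0. (LINT x|M. norm (f x - martingale M F f n x)) < \<epsilon>)"

lemma L1_convergent_perturb:
  assumes M: "finite_measure M" and F: "finite_filtration M F" and f: "integrable M f"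
    and close: "\<And>\<epsilon>. 0 < \<epsilon> \<Longrightarrow> \<exists>g. integrable M g \<and> L1_convergent M F g \<and> (LINT x|M. norm (f x - g x)) < \<epsilon>"
  shows "L1_convergent M F f"
  unfolding L1_convergent_def
proof (intro allI impI)
  fix \<epsilon> :: real assume "0 < \<epsilon>"
  then have e3: "0 < \<epsilon> / 3" by simp
  obtain g where g: "integrable M g" "L1_convergent M F g" "(LINT x|M. norm (f x - g x)) < \<epsilon> / 3"
    using close[OF e3] by blast
  obtain n0 where n0: "\<And>n. n \<ge> n0 \<Longrightarrow> (LINT x|M. norm (g x - martingale M F g n x)) < \<epsilon> / 3"
    using g(2) e3 unfolding L1_convergent_def by blast
  have "(LINT x|M. norm (f x - martingale M F f n x)) < \<epsilon>" if n: "n \<ge> n0" for n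
  proof -
    note im = integrable_martingale[OF M F]
    have fg: "integrable M (\<lambda>x. f x - g x)" using f g by simp
    have "martingale M F f n x = martingale M F g n x + martingale M F (\<lambda>x. f x - g x) n x" for x
      using martingale_add[OF F g(1) fg] by simp
    then have dec: "f x - martingale M F f n x = (f x - g x) + (g x - martingale M F g n x)
        - martingale M F (\<lambda>x. f x - g x) n x" for x
      by simp
    have "norm (f x - martingale M F f n x) \<le> norm (f x - g x) + norm (g x - martingale M F g n x)
        + norm (martingale M F (\<lambda>x. f x - g x) n x)" for x
      unfolding dec by norm
    then have "(LINT x|M. norm (f x - martingale M F f n x)) \<le> (LINT x|M. norm (f x - g x) + norm (g x - martingale M F g n x)
        + norm (martingale M F (\<lambda>x. f x - g x) n x))"
      using f g im by (intro integral_mono) auto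
    also have "\<dots> = (LINT x|M. norm (f x - g x)) + (LINT x|M. norm (g x - martingale M F g n x))
        + (LINT x|M. norm (martingale M F (\<lambda>x. f x - g x) n x))"
      using f g im by simp
    also have "\<dots> < \<epsilon> / 3 + \<epsilon> / 3 + \<epsilon> / 3"
      using g(3) n0[OF n] martingale_contraction[OF M F fg, of n] by linarith
    finally show ?thesis by simp
  qed
  then show "\<exists>n0. \<forall>n\<ge>n0. (LINT x|M. norm (f x - martingale M F f n x)) < \<epsilon>" by blast
qed

lemma L1_convergent_add:
  assumes M: "finite_measure M" and F: "finite_filtration M F" and f: "integrable M f" "integrable M g"
    and a: "L1_convergent M F f" "L1_convergent M F g"
  shows "L1_convergent M F (\<lambda>x. f x + g x)"
  unfolding L1_convergent_def
proof (intro allI impI)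
  fix \<epsilon> :: real assume "0 < \<epsilon>"
  then have e2: "0 < \<epsilon> / 2" by simp
  obtain n0 where n0: "\<And>n. n \<ge> n0 \<Longrightarrow> (LINT x|M. norm (f x - martingale M F f n x)) < \<epsilon> / 2"
    using a(1) e2 unfolding L1_convergent_def by blast
  obtain n1 where n1: "\<And>n. n \<ge> n1 \<Longrightarrow> (LINT x|M. norm (g x - martingale M F g n x)) < \<epsilon> / 2"
    using a(2) e2 unfolding L1_convergent_def by blast
  note im = integrable_martingale[OF M F]
  have "(LINT x|M. norm (f x + g x - martingale M F (\<lambda>x. f x + g x) n x)) < \<epsilon>" if n: "n \<ge> max n0 n1" for n
  proof -
    have "norm (f x + g x - martingale M F (\<lambda>x. f x + g x) n x)
        \<le> norm (f x - martingale M F f n x) + norm (g x - martingale M F g n x)" for x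
      unfolding martingale_add[OF F f] by norm
    then have "(LINT x|M. norm (f x + g x - martingale M F (\<lambda>x. f x + g x) n x))
        \<le> (LINT x|M. norm (f x - martingale M F f n x) + norm (g x - martingale M F g n x))"
      using f im by (intro integral_mono) auto
    also have "\<dots> = (LINT x|M. norm (f x - martingale M F f n x)) + (LINT x|M. norm (g x - martingale M F g n x))"
      using f im by simp
    finally show ?thesis using n0[of n] n1[of n] n by simp
  qed
  then show "\<exists>n0. \<forall>n\<ge>n0. (LINT x|M. norm (f x + g x - martingale M F (\<lambda>x. f x + g x) n x)) < \<epsilon>" by blast
qed

lemma L1_convergent_dominated_limit:
  assumes M: "finite_measure M" and F: "finite_filtration M F" and f: "integrable M f"
    and s: "\<And>i. integrable M (s i)" "\<And>i. L1_convergent M F (s i)"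
    and lim: "\<And>x. x \<in> space M \<Longrightarrow> (\<lambda>i. s i x) \<longlonglongrightarrow> f x"
    and dom: "\<And>i x. x \<in> space M \<Longrightarrow> norm (s i x) \<le> w x" and w: "integrable M w"
  shows "L1_convergent M F f"
proof (rule L1_convergent_perturb[OF M F f])
  fix \<epsilon> :: real assume e: "0 < \<epsilon>"
  have "(\<lambda>i. LINT x|M. norm (f x - s i x)) \<longlonglongrightarrow> (LINT x|M. 0)"
  proof (rule integral_dominated_convergence[where w="\<lambda>x. norm (f x) + w x"])
    show "AE x in M. (\<lambda>i. norm (f x - s i x)) \<longlonglongrightarrow> 0"
      using lim by (intro AE_I2) (auto intro!: tendsto_eq_intros)
    show "AE x in M. norm (norm (f x - s i x)) \<le> norm (f x) + w x" for i
    proof (intro AE_I2)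
      fix x assume "x \<in> space M"
      then show "norm (norm (f x - s i x)) \<le> norm (f x) + w x"
        using norm_triangle_ineq4[of "f x" "s i x"] dom[of x i] by simp
    qed
  qed (use f s w in auto)
  then have "eventually (\<lambda>i. (LINT x|M. norm (f x - s i x)) < \<epsilon>) sequentially"
    using e by (auto intro: order_tendstoD(2))
  then obtain i where "(LINT x|M. norm (f x - s i x)) < \<epsilon>" using eventually_happens by fastforce
  then show "\<exists>g. integrable M g \<and> L1_convergent M F g \<and> (LINT x|M. norm (f x - g x)) < \<epsilon>" using s by blast
qed

lemma L1_convergent_cong_AE:
  assumes M: "finite_measure M" and F: "finite_filtration M F" and f: "integrable M f" "integrable M g"
    and ae: "AE x in M. f x = g x" and g: "L1_convergent M F g"
  shows "L1_convergent M F f"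
proof (rule L1_convergent_perturb[OF M F f(1)])
  fix \<epsilon> :: real assume e: "0 < \<epsilon>"
  have "(LINT x|M. norm (f x - g x)) = (LINT x|M. 0)"
    using ae f by (intro integral_cong_AE) auto
  then show "\<exists>g. integrable M g \<and> L1_convergent M F g \<and> (LINT x|M. norm (f x - g x)) < \<epsilon>"
    using f g e by auto
qed

text \<open>
  From level \<open>n0\<close> on every atom is inside \<open>B\<close> or disjoint from it, so the martingale is equal to
  the function.
\<close>

lemma L1_convergent_indicator_algebra:
  assumes M: "finite_measure M" and F: "finite_filtration M F" and B: "B \<in> F n0"
  shows "L1_convergent M F (\<lambda>x. indicator B x *\<^sub>R c)"
  unfolding L1_convergent_def
proof (intro allI impI exI[of _ n0])
  interpret finite_measure M by fact
  fix \<epsilon> :: real and n assume e: "0 < \<epsilon>" and n: "n \<ge> n0"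
  note fa = finite_filtrationD(1)[OF F, of n]
  have BF: "B \<in> F n" using B monoD[OF finite_filtrationD(2)[OF F] n] by blast
  have Bs: "B \<in> sets M" using BF finite_filtrationD(4)[OF F] by blast
  have "(LINT x|M. norm (indicator B x *\<^sub>R c - martingale M F (\<lambda>x. indicator B x *\<^sub>R c) n x)) = (LINT x|M. 0)"
  proof (rule integral_cong_AE)
    show "(\<lambda>x. norm (indicator B x *\<^sub>R c - martingale M F (\<lambda>x. indicator B x *\<^sub>R c) n x)) \<in> borel_measurable M"
      using integrable_martingale[OF M F, of "\<lambda>x. indicator B x *\<^sub>R c" n] Bs by measurable
    show "AE x in M. norm (indicator B x *\<^sub>R c - martingale M F (\<lambda>x. indicator B x *\<^sub>R c) n x) = 0"
      using AE_in_some_atom[OF M fa]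
    proof eventually_elim
      case (elim x)
      then obtain \<omega> where w: "\<omega> \<in> atoms M (F n)" "x \<in> \<omega>" by blast
      note ws = atom_sets[OF fa w(1)]
      have "(LINT y:\<omega>|M. indicator B y *\<^sub>R c) = measure M \<omega> *\<^sub>R indicator B x *\<^sub>R c"
      proof (cases "\<omega> \<subseteq> B")
        case True
        then have eq: "(\<lambda>y. indicator \<omega> y *\<^sub>R indicator B y *\<^sub>R c) = (\<lambda>y. indicator \<omega> y *\<^sub>R c)"
          by (auto simp: indicator_def fun_eq_iff)
        have "x \<in> B" using True w by blast
        then show ?thesis unfolding set_lebesgue_integral_def eq using ws by (simp add: emeasure_eq_measure)
      next
        case False
        then have dj: "\<omega> \<inter> B = {}" using atom_inside_or_disjoint[OF fa w(1) BF] by blast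
        then have eq: "(\<lambda>y. indicator \<omega> y *\<^sub>R indicator B y *\<^sub>R c) = (\<lambda>y. 0)"
          by (auto simp: indicator_def fun_eq_iff)
        have "x \<notin> B" using dj w by blast
        then show ?thesis unfolding set_lebesgue_integral_def eq by simp
      qed
      then show ?case using martingale_on_atom[where F=F and n=n, OF fa w] ws by (simp add: average_def)
    qed
  qed simp
  then show "(LINT x|M. norm (indicator B x *\<^sub>R c - martingale M F (\<lambda>x. indicator B x *\<^sub>R c) n x)) < \<epsilon>" using e by simp
qed

text \<open>
  The sets in question are closed under complements and countable disjoint unions, and the
  algebras of the filtration form a generator that is stable under intersections.
\<close>

lemma L1_convergent_indicator_generated:
  assumes M: "finite_measure M" and F: "finite_filtration M F"
    and A: "A \<in> sigma_sets (space M) (\<Union>n. F n)"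
  shows "\<forall>c. L1_convergent M F (\<lambda>x. indicator A x *\<^sub>R c)"
proof -
  interpret finite_measure M by fact
  have G: "(\<Union>n. F n) \<subseteq> sets M" using finite_filtrationD(4)[OF F] by blast
  have sig: "sigma_sets (space M) (\<Union>n. F n) \<subseteq> sets M" using sets.sigma_sets_subset[OF G] .
  have ind: "integrable M (\<lambda>x. indicator B x *\<^sub>R (c::real^2))" if "B \<in> sets M" for B c
    using that by (intro integrable_mult_indicator) auto
  have Int: "Int_stable (\<Union>n. F n)"
  proof (rule Int_stableI)
    fix a b assume "a \<in> (\<Union>n. F n)" "b \<in> (\<Union>n. F n)"
    then obtain i j where ij: "a \<in> F i" "b \<in> F j" by auto
    have "F i \<subseteq> F (max i j)" "F j \<subseteq> F (max i j)"
      by (auto intro!: monoD[OF finite_filtrationD(2)[OF F], unfolded le_fun_def])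
    then have ab: "a \<in> F (max i j)" "b \<in> F (max i j)" using ij by blast+
    interpret algebra "space M" "F (max i j)" using F by (simp add: finite_filtration_def)
    show "a \<inter> b \<in> (\<Union>n. F n)" using ab by blast
  qed
  have top: "L1_convergent M F (\<lambda>x. indicator (space M) x *\<^sub>R c)" for c
    using finite_filtrationD(3)[OF F] by (intro L1_convergent_indicator_algebra[OF M F, of _ 0]) auto
  show ?thesis
  proof (rule sigma_sets_induct_disjoint[OF Int _ A])
    show "(\<Union>n. F n) \<subseteq> Pow (space M)" using G sets.sets_into_space by blast
    show "\<And>A. A \<in> (\<Union>n. F n) \<Longrightarrow> \<forall>c. L1_convergent M F (\<lambda>x. indicator A x *\<^sub>R c)"
      using L1_convergent_indicator_algebra[OF M F] by blast
    show "\<forall>c. L1_convergent M F (\<lambda>x. indicator {} x *\<^sub>R c)"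
      using L1_convergent_indicator_algebra[OF M F, of "{}" 0] finite_filtrationD(3)[OF F] by blast
  next
    fix A assume A: "A \<in> sigma_sets (space M) (\<Union>n. F n)" "\<forall>c. L1_convergent M F (\<lambda>x. indicator A x *\<^sub>R c)"
    have As: "A \<in> sets M" using A sig by blast
    show "\<forall>c. L1_convergent M F (\<lambda>x. indicator (space M - A) x *\<^sub>R c)"
    proof
      fix c :: "real^2"
      have "L1_convergent M F (\<lambda>x. indicator A x *\<^sub>R (- c))" using A(2) by blast
      note sumap = L1_convergent_add[OF M F ind[OF sets.top] ind[OF As] top this, of c]
      show "L1_convergent M F (\<lambda>x. indicator (space M - A) x *\<^sub>R c)"
      proof (rule L1_convergent_cong_AE[OF M F ind _ _ sumap])
        show "AE x in M. indicator (space M - A) x *\<^sub>R c = indicator (space M) x *\<^sub>R c + indicator A x *\<^sub>R (- c)"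
          by (intro AE_I2) (auto simp: indicator_def)
      qed (use As in \<open>auto intro!: Bochner_Integration.integrable_add ind simp del: scaleR_minus_right\<close>)
    qed
  next
    fix A :: "nat \<Rightarrow> 'a set"
    assume dj: "disjoint_family A" and r: "range A \<subseteq> sigma_sets (space M) (\<Union>n. F n)"
      and ap: "\<And>i. \<forall>c. L1_convergent M F (\<lambda>x. indicator (A i) x *\<^sub>R c)"
    have As: "A i \<in> sets M" for i using r sig by blast
    show "\<forall>c. L1_convergent M F (\<lambda>x. indicator (\<Union>i. A i) x *\<^sub>R c)"
    proof
      fix c :: "real^2"
      have part: "L1_convergent M F (\<lambda>x. indicator (\<Union>i<n. A i) x *\<^sub>R c)" for n
      proof (induction n)
        case 0
        then show ?case using L1_convergent_indicator_algebra[OF M F, of "{}" 0] finite_filtrationD(3)[OF F] by simp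
      next
        case (Suc n)
        have eq: "indicator (\<Union>i<Suc n. A i) x *\<^sub>R c = indicator (\<Union>i<n. A i) x *\<^sub>R c + indicator (A n) x *\<^sub>R c" for x
        proof -
          have "A n \<inter> A i = {}" if "i < n" for i using disjoint_family_onD[OF dj, of n i] that by simp
          then have "x \<notin> (\<Union>i<n. A i) \<or> x \<notin> A n" by blast
          moreover have "(\<Union>i<Suc n. A i) = A n \<union> (\<Union>i<n. A i)" by (simp add: lessThan_Suc)
          ultimately show ?thesis by (cases "x \<in> A n"; cases "x \<in> (\<Union>i<n. A i)") simp_all
        qed
        show ?case unfolding eq using As ap Suc by (intro L1_convergent_add[OF M F ind ind]) auto
      qed
      show "L1_convergent M F (\<lambda>x. indicator (\<Union>i. A i) x *\<^sub>R c)"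
      proof (rule L1_convergent_dominated_limit[OF M F ind])
        show "L1_convergent M F (\<lambda>x. indicator (\<Union>i<n. A i) x *\<^sub>R c)" for n by (rule part)
        show "(\<lambda>n. indicator (\<Union>i<n. A i) x *\<^sub>R c) \<longlonglongrightarrow> indicator (\<Union>i. A i) x *\<^sub>R c" for x
          by (intro tendsto_intros LIMSEQ_indicator_UN)
        show "norm (indicator (\<Union>i<n. A i) x *\<^sub>R c) \<le> norm c" for n x by (auto simp: indicator_def)
      qed (use As in \<open>auto intro!: ind\<close>)
    qed
  qed
qed

lemma martingale_converges_in_L1:
  assumes M: "finite_measure M" and F: "finite_filtration M F" and f: "integrable M f"
  shows "L1_convergent M F f"
  using f
proof (induction rule: integrable_induct)
  case (base A c)
  interpret finite_measure M by fact
  obtain B where B: "B \<in> sigma_sets (space M) (\<Union>n. F n)" "sym_diff A B \<in> null_sets M"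
    using F base(1) unfolding finite_filtration_def by blast
  have Bs: "B \<in> sets M" using B(1) sets.sigma_sets_subset[of "\<Union>n. F n" M] finite_filtrationD(4)[OF F] by blast
  have "AE x in M. x \<notin> sym_diff A B" using AE_not_in[OF B(2)] .
  then have ae: "AE x in M. indicator A x *\<^sub>R c = indicator B x *\<^sub>R c"
    by eventually_elim (auto simp: indicator_def)
  show ?case
    using L1_convergent_indicator_generated[OF M F B(1)] base Bs
    by (intro L1_convergent_cong_AE[OF M F _ _ ae]) (auto intro!: integrable_mult_indicator)
next
  case (add f g)
  then show ?case by (intro L1_convergent_add[OF M F]) auto
next
  case (lim f s)
  then show ?case by (intro L1_convergent_dominated_limit[OF M F, of f s "\<lambda>x. 2 * norm (f x)"]) auto
qed

section \<open>Jensen's inequality for wedge functions\<close>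

text \<open>
  These are the test functions for Jensen's inequality. If the inner domain of a lens touches the line
  of slope \<open>m\<close> through \<open>w\<close> from above, then within the lens the function is continuous and convex
  along segments: its kink runs along the line to the left of \<open>w\<close>, and its jump above \<open>w\<close> is hidden in
  the inner domain.
\<close>

definition wedge :: "'a::euclidean_space \<Rightarrow> 'a \<Rightarrow> real \<Rightarrow> 'a \<Rightarrow> 'a \<Rightarrow> real" where
  "wedge e N m w v = (if e \<bullet> v < e \<bullet> w then max 0 (tilt e N m v - tilt e N m w) else 0)"

lemma wedge_nonneg: "0 \<le> wedge e N m w v" by (simp add: wedge_def)

text \<open>
  If \<open>b\<close> is on the right of \<open>w\<close>, the function is \<open>0\<close> there instead of the positive part of the affine
  function. The only case to worry about is that the segment is above the line at the point under
  consideration; it then has to cross the vertical through \<open>w\<close> on or below the line, so the affine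
  function is nonpositive at \<open>b\<close> and its positive part is \<open>0\<close> as well.
\<close>

lemma wedge_convex_aux:
  fixes e N :: "real^2"
  assumes left: "e \<bullet> a < e \<bullet> w" and t: "0 \<le> t" "t \<le> 1"
    and mid: "e \<bullet> ((1 - t) *\<^sub>R a + t *\<^sub>R b) < e \<bullet> w"
    and low: "\<And>c. c \<in> closed_segment a b \<Longrightarrow> e \<bullet> c = e \<bullet> w \<Longrightarrow> tilt e N m c \<le> tilt e N m w"
  shows "wedge e N m w ((1 - t) *\<^sub>R a + t *\<^sub>R b) \<le> (1 - t) * wedge e N m w a + t * wedge e N m w b"
proof -
  define D where "D v = tilt e N m v - tilt e N m w" for v
  have Dc: "D ((1 - s) *\<^sub>R u + s *\<^sub>R v) = (1 - s) * D u + s * D v" for s u v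
    unfolding D_def tilt_combination by (simp add: algebra_simps)
  define p where "p = (1 - t) *\<^sub>R a + t *\<^sub>R b"
  have wp: "wedge e N m w p = max 0 (D p)" and wa: "wedge e N m w a = max 0 (D a)"
    using mid left by (auto simp: wedge_def D_def p_def)
  have pos: "0 \<le> (1 - t) * max 0 (D a)" "0 \<le> t * wedge e N m w b" using t by (auto simp: wedge_nonneg)
  have le1: "(1 - t) * D a \<le> (1 - t) * max 0 (D a)" using t by (intro mult_left_mono) auto
  have "t * D b \<le> t * wedge e N m w b" if "0 < D p"
  proof (cases "e \<bullet> b < e \<bullet> w")
    case True
    then show ?thesis using t by (intro mult_left_mono) (auto simp: wedge_def D_def)
  next
    case False
    obtain s where s: "0 < s" "s \<le> 1" "e \<bullet> w = (1 - s) * (e \<bullet> p) + s * (e \<bullet> b)"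
      using real_between[of "e \<bullet> p" "e \<bullet> w" "e \<bullet> b"] mid False by (auto simp: p_def)
    \<comment> \<open>the crossing with the vertical through \<open>w\<close>\<close>
    define c where "c = (1 - s) *\<^sub>R p + s *\<^sub>R b"
    have pseg: "p \<in> closed_segment a b" unfolding p_def in_segment using t by blast
    have "c \<in> closed_segment p b" unfolding c_def in_segment using s by (intro exI[of _ s]) simp
    moreover have "closed_segment p b \<subseteq> closed_segment a b" using pseg by (simp add: subset_closed_segment)
    ultimately have "c \<in> closed_segment a b" by blast
    then have "D c \<le> 0" using low[of c] s(3) by (simp add: c_def inner_add_right D_def)
    then have "(1 - s) * D p + s * D b \<le> 0" by (simp add: c_def Dc)
    moreover have "0 \<le> (1 - s) * D p" using that s by simp
    ultimately have "s * D b \<le> 0" by linarith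
    then have "D b \<le> 0" using s(1) by (simp add: mult_le_0_iff)
    then have "t * D b \<le> 0" using t by (simp add: mult_nonneg_nonpos)
    then show ?thesis using pos by linarith
  qed
  then have "max 0 (D p) \<le> (1 - t) * max 0 (D a) + t * wedge e N m w b"
    using pos le1 Dc[of t a b] unfolding p_def[symmetric] by (cases "0 < D p") auto
  then show ?thesis unfolding p_def[symmetric] wp wa .
qed

lemma wedge_convex_on_segments:
  fixes e N :: "real^2"
  assumes L: "is_lens L" and up: "upward (inner_dom L) N" and eN: "norm e = 1" "norm N = 1" "e \<bullet> N = 0"
    and w: "w \<in> closure (inner_dom L)" and seg: "closed_segment a b \<subseteq> region L" and t: "0 \<le> t" "t \<le> 1"
  shows "wedge e N m w ((1 - t) *\<^sub>R a + t *\<^sub>R b) \<le> (1 - t) * wedge e N m w a + t * wedge e N m w b"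
proof -
  have low: "tilt e N m c \<le> tilt e N m w" if c: "c \<in> closed_segment a b" "e \<bullet> c = e \<bullet> w" for c
  proof -
    have "c \<notin> inner_dom L" using c(1) seg region_iff[OF L] by blast
    then have "N \<bullet> c \<le> N \<bullet> w" using above_closure_point_in[OF up eN w c(2)] by linarith
    then show ?thesis using c(2) by (simp add: tilt_def)
  qed
  let ?p = "(1 - t) *\<^sub>R a + t *\<^sub>R b"
  show ?thesis
  proof (cases "e \<bullet> ?p < e \<bullet> w")
    case False
    then have "wedge e N m w ?p = 0" by (simp add: wedge_def)
    then show ?thesis using t wedge_nonneg[of e N m w a] wedge_nonneg[of e N m w b] by simp
  next
    case True
    have "e \<bullet> a < e \<bullet> w \<or> e \<bullet> b < e \<bullet> w"
    proof (rule ccontr)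
      assume "\<not> ?thesis"
      then have "(1 - t) * (e \<bullet> w) + t * (e \<bullet> w) \<le> (1 - t) * (e \<bullet> a) + t * (e \<bullet> b)"
        using t by (intro add_mono mult_left_mono) auto
      then show False using True by (simp add: inner_add_right algebra_simps)
    qed
    then show ?thesis
    proof
      assume "e \<bullet> a < e \<bullet> w"
      then show ?thesis using wedge_convex_aux[of e a w t b N m] t True low by blast
    next
      assume b: "e \<bullet> b < e \<bullet> w"
      have "?p = (1 - (1 - t)) *\<^sub>R b + (1 - t) *\<^sub>R a" by (simp add: add.commute)
      then show ?thesis
        using wedge_convex_aux[OF b, of "1 - t" a N m] t True low
        by (simp add: closed_segment_commute add.commute)
    qed
  qed
qed

text \<open>
  A whole piece of the line around \<open>w\<close> lies in the outer domain, and no boundary point is above it.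
\<close>

lemma boundary_gap_above_tangent:
  fixes e N :: "real^2"
  assumes L: "is_lens L" and up: "upward (outer L) N" and eN: "norm e = 1" "norm N = 1" "e \<bullet> N = 0"
    and w: "w \<in> outer L"
  obtains \<delta> where "0 < \<delta>"
    "\<And>p. p \<in> fixed_boundary L \<Longrightarrow> tilt e N m w < tilt e N m p \<Longrightarrow> \<delta> \<le> \<bar>e \<bullet> p - e \<bullet> w\<bar>"
proof -
  obtain \<rho> where \<rho>: "0 < \<rho>" "ball w \<rho> \<subseteq> outer L" using is_lensD(1)[OF L] w openE by blast
  define \<delta> where "\<delta> = \<rho> / (1 + \<bar>m\<bar>)"
  have d: "0 < \<delta>" "\<delta> * (1 + \<bar>m\<bar>) = \<rho>" using \<rho> by (auto simp: \<delta>_def)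
  have "\<delta> \<le> \<bar>e \<bullet> p - e \<bullet> w\<bar>" if p: "p \<in> fixed_boundary L" "tilt e N m w < tilt e N m p" for p
  proof (rule ccontr)
    assume n: "\<not> ?thesis"
    define h where "h = e \<bullet> p - e \<bullet> w"
    define Q where "Q = w + h *\<^sub>R (e + m *\<^sub>R N)"
    have ee: "e \<bullet> e = 1" "N \<bullet> N = 1" "N \<bullet> e = 0" using eN by (auto simp: norm_eq_1 inner_commute)
    have eQ: "e \<bullet> p = e \<bullet> Q" using ee eN(3) by (simp add: Q_def inner_add_right h_def)
    have "N \<bullet> Q = N \<bullet> w + h * m" using ee by (simp add: Q_def inner_add_right)
    then have NQ: "N \<bullet> Q < N \<bullet> p" using p(2) by (simp add: tilt_def h_def algebra_simps)
    have "norm (e + m *\<^sub>R N) \<le> 1 + \<bar>m\<bar>" using norm_triangle_ineq[of e "m *\<^sub>R N"] eN by simp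
    then have "norm (h *\<^sub>R (e + m *\<^sub>R N)) \<le> \<bar>h\<bar> * (1 + \<bar>m\<bar>)" by (simp add: mult_left_mono)
    also have "\<dots> < \<rho>" unfolding d(2)[symmetric] using n by (intro mult_strict_right_mono) (auto simp: h_def)
    finally have "Q \<in> outer L" using \<rho>(2) by (auto simp: Q_def dist_norm)
    then have "p \<in> outer L" using above_closure_point_in[OF up eN _ eQ NQ] closure_subset by blast
    then show False using p(1) fixed_boundary_iff[OF L] by blast
  qed
  then show thesis using that d(1) by blast
qed

lemma tilt_lipschitz:
  fixes e N :: "'a::euclidean_space"
  assumes "norm e = 1" "norm N = 1"
  shows "\<bar>tilt e N m u - tilt e N m v\<bar> \<le> (1 + \<bar>m\<bar>) * norm (u - v)"
proof -
  have "tilt e N m u - tilt e N m v = N \<bullet> (u - v) - m * (e \<bullet> (u - v))"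
    by (simp add: tilt_def inner_diff_right algebra_simps)
  moreover have "\<bar>N \<bullet> (u - v)\<bar> \<le> norm (u - v)" using Cauchy_Schwarz_ineq2[of N "u - v"] assms by simp
  moreover have "\<bar>m * (e \<bullet> (u - v))\<bar> \<le> \<bar>m\<bar> * norm (u - v)"
    unfolding abs_mult using Cauchy_Schwarz_ineq2[of e "u - v"] assms by (intro mult_left_mono) auto
  ultimately show ?thesis by (simp add: distrib_right)
qed

text \<open>
  The wedge function is not continuous across the vertical through \<open>w\<close>, but a point \<open>p\<close> of the fixed
  boundary above the line and to the right of \<open>w\<close> keeps the distance \<open>\<delta>\<close> from this vertical. The jump
  from \<open>p\<close> to \<open>v\<close> is then paid for by the distance if its height is at most \<open>K\<close>, and the excess over
  \<open>K\<close> is left as an error term.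
\<close>

lemma wedge_near_boundary:
  fixes e N :: "real^2"
  assumes eN: "norm e = 1" "norm N = 1"
    and gap: "0 < \<delta>" "tilt e N m w < tilt e N m p \<Longrightarrow> \<delta> \<le> \<bar>e \<bullet> p - e \<bullet> w\<bar>" and K: "0 \<le> K"
  shows "wedge e N m w v \<le> wedge e N m w p + (1 + \<bar>m\<bar> + K / \<delta>) * norm (v - p)
    + max 0 (tilt e N m p - tilt e N m w - K)"
proof -
  define D where "D v = tilt e N m v - tilt e N m w" for v
  have lip: "D v \<le> D p + (1 + \<bar>m\<bar>) * norm (v - p)"
    using tilt_lipschitz[OF eN, of m v p] by (simp add: D_def)
  have nn: "0 \<le> (1 + \<bar>m\<bar>) * norm (v - p)" "0 \<le> K / \<delta> * norm (v - p)" using K gap(1) by auto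
  show ?thesis
  proof (cases "e \<bullet> v < e \<bullet> w \<and> 0 < D v")
    case False
    then have "wedge e N m w v = 0" by (auto simp: wedge_def D_def)
    then show ?thesis using nn wedge_nonneg[of e N m w p] by (simp add: distrib_right)
  next
    case True
    then have wv: "wedge e N m w v = D v" by (simp add: wedge_def D_def)
    consider "D p \<le> 0" | "0 < D p" "e \<bullet> p < e \<bullet> w" | "0 < D p" "e \<bullet> w \<le> e \<bullet> p" by linarith
    then show ?thesis
    proof cases
      case 1
      then show ?thesis using wv lip nn wedge_nonneg[of e N m w p] by (simp add: distrib_right D_def)
    next
      case 2
      then have "wedge e N m w p = D p" by (simp add: wedge_def D_def)
      then show ?thesis using wv lip nn by (simp add: distrib_right)
    next
      case 3
      have "\<delta> \<le> e \<bullet> p - e \<bullet> w" using gap(2) 3 by (simp add: D_def)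
      also have "\<dots> \<le> e \<bullet> (p - v)" using True by (simp add: inner_diff_right)
      also have "\<dots> \<le> norm (v - p)" using Cauchy_Schwarz_ineq2[of e "p - v"] eN by (simp add: norm_minus_commute)
      finally have "1 \<le> norm (v - p) / \<delta>" using gap(1) by simp
      then have "K * 1 \<le> K * (norm (v - p) / \<delta>)" using K by (intro mult_left_mono) auto
      then have "D p \<le> K / \<delta> * norm (v - p) + max 0 (D p - K)" by simp
      then show ?thesis using wv lip wedge_nonneg[of e N m w p] by (simp add: distrib_right D_def)
    qed
  qed
qed

lemma wedge_measurable [measurable]: "wedge e N m w \<in> borel_measurable borel"
  unfolding wedge_def tilt_def by measurable

lemma integrable_tilt:
  fixes f :: "'a \<Rightarrow> real^2"
  assumes "integrable M f"
  shows "integrable M (\<lambda>x. tilt e N m (f x))"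
  unfolding tilt_def using assms by (intro Bochner_Integration.integrable_diff integrable_mult_right integrable_inner_right) auto

lemma integrable_wedge:
  fixes f :: "'a \<Rightarrow> real^2"
  assumes M: "finite_measure M" and f: "integrable M f"
  shows "integrable M (\<lambda>x. wedge e N m w (f x))"
proof (rule Bochner_Integration.integrable_bound)
  interpret finite_measure M by fact
  show "integrable M (\<lambda>x. tilt e N m (f x) - tilt e N m w)" using integrable_tilt[OF f] by auto
  show "(\<lambda>x. wedge e N m w (f x)) \<in> borel_measurable M"
    by (rule measurable_compose[OF borel_measurable_integrable[OF f] wedge_measurable])
qed (auto simp: wedge_def)

lemma average_whole_space:
  assumes "prob_space M" "integrable M (f :: 'a \<Rightarrow> real^2)"
  shows "average M (space M) f = (LINT x|M. f x)"
proof -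
  interpret prob_space M by fact
  show ?thesis using prob_space assms(2) by (simp add: average_def set_integral_space)
qed

text \<open>
  At each split the wedge function is convex on the segment between the two averages, so its sum
  over the atoms increases with the level and dominates the value at the mean. The passage to the
  limit uses convergence in \<open>L\<^sup>1\<close>: for a fixed truncation height \<open>K\<close> the distance terms vanish as the
  level grows, and the truncation error vanishes as \<open>K\<close> grows by dominated convergence.
\<close>

lemma wedge_jensen:
  fixes e N :: "real^2"
  assumes M: "prob_space M" and F: "finite_filtration M F" and bin: "\<And>n \<omega>. \<omega> \<in> atoms M (F n) \<Longrightarrow> card (children M F n \<omega>) \<le> 2"
    and f: "integrable M f" "\<And>x. x \<in> space M \<Longrightarrow> f x \<in> fixed_boundary L"
    and seg: "\<And>n \<omega> \<omega>' \<omega>''. \<omega> \<in> atoms M (F n) \<Longrightarrow> \<omega>' \<in> children M F n \<omega> \<Longrightarrow> \<omega>'' \<in> children M F n \<omega> \<Longrightarrow> \<omega>' \<noteq> \<omega>'' \<Longrightarrow>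
        closed_segment (average M \<omega>' f) (average M \<omega>'' f) \<subseteq> region L"
    and L: "is_lens L" and up: "upward (outer L) N" and eN: "norm e = 1" "norm N = 1" "e \<bullet> N = 0"
    and w: "w \<in> closure (inner_dom L)"
  shows "wedge e N m w (LINT x|M. f x) \<le> (LINT x|M. wedge e N m w (f x))"
proof -
  interpret prob_space M by fact
  have fm: "finite_measure M" by (rule finite_measure_axioms)
  let ?r = "wedge e N m w"
  have N0: "N \<noteq> 0" using eN by auto
  have upI: "upward (inner_dom L) N" using lens_inner_upward[OF L N0 up] .
  have wO: "w \<in> outer L" using w is_lensD(9)[OF L] by blast
  note fa = finite_filtrationD(1)[OF F]
  have step: "measure M \<omega> * ?r (average M \<omega> f) \<le> (\<Sum>\<omega>'\<in>children M F n \<omega>. measure M \<omega>' * ?r (average M \<omega>' f))"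
    if om: "\<omega> \<in> atoms M (F n)" for n \<omega>
  proof -
    let ?C = "children M F n \<omega>"
    have inF: "\<omega> \<in> F (Suc n)"
      using atom_sets(2)[OF fa om] monoD[OF finite_filtrationD(2)[OF F], of n "Suc n"] by auto
    have fin: "finite ?C" using finite_atoms[OF fa] by (simp add: children_def)
    have ms: "measure M \<omega> = (\<Sum>\<omega>'\<in>?C. measure M \<omega>')"
      using measure_eq_sum_atoms[OF fm fa inF] by (simp add: children_def)
    have isum: "(LINT x:\<omega>|M. f x) = (\<Sum>\<omega>'\<in>?C. LINT x:\<omega>'|M. f x)"
      using integral_eq_sum_atoms[OF fm fa f(1) inF] by (simp add: children_def)
    have pos: "0 < measure M \<omega>" using atom_sets(3)[OF fa om] .
    have "card ?C \<noteq> 0" using ms pos fin by auto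
    then consider "card ?C = 1" | "card ?C = 2" using bin[OF om] by linarith
    then show ?thesis
    proof cases
      case 1
      then obtain a where a: "?C = {a}" by (auto simp: card_1_singleton_iff)
      then have "average M \<omega> f = average M a f" "measure M \<omega> = measure M a"
        using ms isum by (auto simp: average_def)
      then show ?thesis using a by simp
    next
      case 2
      then obtain a b where ab: "?C = {a, b}" "a \<noteq> b" by (auto simp: card_2_iff)
      obtain t where t: "0 < t" "t < 1" "measure M a = (1 - t) * measure M \<omega>" "measure M b = t * measure M \<omega>"
        and av: "average M \<omega> f = (1 - t) *\<^sub>R average M a f + t *\<^sub>R average M b f"
        using siblings_average[OF fm F f(1) om ab] .
      have "?r (average M \<omega> f) \<le> (1 - t) * ?r (average M a f) + t * ?r (average M b f)"
        unfolding av using seg[OF om, of a b] ab t by (intro wedge_convex_on_segments[OF L upI eN w]) auto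
      then have "measure M \<omega> * ?r (average M \<omega> f)
          \<le> measure M \<omega> * ((1 - t) * ?r (average M a f) + t * ?r (average M b f))"
        using pos by (intro mult_left_mono) auto
      also have "\<dots> = measure M a * ?r (average M a f) + measure M b * ?r (average M b f)"
        unfolding t(3,4) by (simp add: algebra_simps)
      finally show ?thesis using ab by simp
    qed
  qed
  have avs: "average M (space M) f = (LINT x|M. f x)" by (rule average_whole_space[OF M f(1)])
  have jens: "?r (LINT x|M. f x) \<le> (\<Sum>\<omega>\<in>atoms M (F n). measure M \<omega> * ?r (average M \<omega> f))" for n
    using jensen_along_filtration[OF fm F step, of n] prob_space avs by simp
  obtain \<delta> where \<delta>: "0 < \<delta>"
    "\<And>p. p \<in> fixed_boundary L \<Longrightarrow> tilt e N m w < tilt e N m p \<Longrightarrow> \<delta> \<le> \<bar>e \<bullet> p - e \<bullet> w\<bar>"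
    using boundary_gap_above_tangent[OF L up eN wO] by blast
  \<comment> \<open>the truncation error at height \<open>K\<close>\<close>
  let ?T = "\<lambda>K x. max 0 (tilt e N m (f x) - tilt e N m w - K)"
  have intT: "integrable M (?T K)" for K
    using integrable_tilt[OF f(1), of e N m] by (intro integrable_max) auto
  have main: "?r (LINT x|M. f x) \<le> (LINT x|M. ?r (f x))
      + (1 + \<bar>m\<bar> + K / \<delta>) * (LINT x|M. norm (f x - martingale M F f n x)) + (LINT x|M. ?T K x)" if K: "0 \<le> K" for n K
  proof -
    let ?c = "1 + \<bar>m\<bar> + K / \<delta>"
    let ?h = "\<lambda>x. ?r (f x) + ?c * norm (f x - martingale M F f n x) + ?T K x"
    note im = integrable_martingale[OF fm F, of f n]
    have ih: "integrable M ?h" using integrable_wedge[OF fm f(1)] f(1) im intT[of K]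
      by (intro Bochner_Integration.integrable_add integrable_mult_right integrable_norm Bochner_Integration.integrable_diff)
    have "measure M \<omega> * ?r (average M \<omega> f) \<le> (LINT x:\<omega>|M. ?h x)" if om: "\<omega> \<in> atoms M (F n)" for \<omega>
    proof -
      note ws = atom_sets[OF fa om]
      have "measure M \<omega> * ?r (average M \<omega> f) = (LINT x:\<omega>|M. ?r (average M \<omega> f))"
        using ws by (simp add: set_lebesgue_integral_def emeasure_eq_measure)
      also have "\<dots> \<le> (LINT x:\<omega>|M. ?h x)"
      proof (rule set_integral_mono)
        show "set_integrable M \<omega> (\<lambda>x. ?r (average M \<omega> f))"
          using ws unfolding set_integrable_def by (intro integrable_mult_indicator) auto
        show "set_integrable M \<omega> ?h" using ih ws unfolding set_integrable_def by (intro integrable_mult_indicator) auto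
        fix x assume x: "x \<in> \<omega>"
        then have "f x \<in> fixed_boundary L" using f(2) sets.sets_into_space[OF ws(1)] by blast
        then have gap: "tilt e N m w < tilt e N m (f x) \<Longrightarrow> \<delta> \<le> \<bar>e \<bullet> f x - e \<bullet> w\<bar>" using \<delta>(2) by blast
        show "?r (average M \<omega> f) \<le> ?h x"
          using wedge_near_boundary[OF eN(1,2) \<delta>(1) gap K, where v = "average M \<omega> f"]
            martingale_on_atom[where F=F and n=n, OF fa om x, of f] by (simp add: norm_minus_commute)
      qed
      finally show ?thesis .
    qed
    then have "?r (LINT x|M. f x) \<le> (\<Sum>\<omega>\<in>atoms M (F n). LINT x:\<omega>|M. ?h x)"
      using jens[of n] sum_mono[of "atoms M (F n)"] by (meson order_trans)
    also have "\<dots> = (LINT x:space M|M. ?h x)"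
    proof -
      have "space M \<in> F n" using fa[of n] algebra.top by (auto simp: finite_subalgebra_def)
      moreover have "{\<omega>\<in>atoms M (F n). \<omega> \<subseteq> space M} = atoms M (F n)"
        using atom_sets(1)[OF fa] sets.sets_into_space by blast
      ultimately show ?thesis using integral_eq_sum_atoms[OF fm fa ih, of "space M"] by simp
    qed
    also have "\<dots> = (LINT x|M. ?h x)" by (rule set_integral_space[OF ih])
    also have "\<dots> = (LINT x|M. ?r (f x)) + ?c * (LINT x|M. norm (f x - martingale M F f n x)) + (LINT x|M. ?T K x)"
      using integrable_wedge[OF fm f(1)] f(1) im intT[of K] by simp
    finally show ?thesis .
  qed
  have tail: "(\<lambda>k. LINT x|M. ?T (real k) x) \<longlonglongrightarrow> (LINT x|M. 0)"
  proof (rule integral_dominated_convergence[where w="\<lambda>x. \<bar>tilt e N m (f x) - tilt e N m w\<bar>"])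
    show "integrable M (\<lambda>x. \<bar>tilt e N m (f x) - tilt e N m w\<bar>)"
      using integrable_tilt[OF f(1), of e N m] by auto
    show "AE x in M. (\<lambda>k. ?T (real k) x) \<longlonglongrightarrow> 0"
    proof (intro AE_I2 tendsto_eventually)
      fix x
      show "\<forall>\<^sub>F k in sequentially. ?T (real k) x = 0"
        using eventually_ge_at_top[of "nat \<lceil>tilt e N m (f x) - tilt e N m w\<rceil>"]
        by eventually_elim linarith
    qed
    show "AE x in M. norm (?T (real k) x) \<le> \<bar>tilt e N m (f x) - tilt e N m w\<bar>" for k by (intro AE_I2) auto
  qed (use intT in \<open>auto intro: borel_measurable_integrable\<close>)
  show ?thesis
  proof (rule field_le_epsilon)
    fix \<epsilon> :: real assume e: "0 < \<epsilon>"
    have "eventually (\<lambda>k. (LINT x|M. ?T (real k) x) < \<epsilon> / 2) sequentially"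
      using order_tendstoD(2)[OF tail, of "\<epsilon> / 2"] e by simp
    then obtain k where k: "(LINT x|M. ?T (real k) x) < \<epsilon> / 2" using eventually_happens by fastforce
    let ?c = "1 + \<bar>m\<bar> + real k / \<delta>"
    have c: "0 < ?c" using \<delta>(1) by (intro add_pos_nonneg) auto
    obtain n where n: "(LINT x|M. norm (f x - martingale M F f n x)) < \<epsilon> / 2 / ?c"
      using martingale_converges_in_L1[OF fm F f(1)] e c unfolding L1_convergent_def
      by (meson divide_pos_pos order_refl zero_less_numeral)
    have "?c * (LINT x|M. norm (f x - martingale M F f n x)) < \<epsilon> / 2"
      using iffD1[OF pos_less_divide_eq[OF c] n] by (simp only: mult.commute)
    then show "?r (LINT x|M. f x) \<le> (LINT x|M. ?r (f x)) + \<epsilon>"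
      using main[of "real k" n, OF of_nat_0_le_iff] k by linarith
  qed
qed

text \<open>
  At most one of the two halves of \<open>[x', x'']\<close> can leave the small lens, because the inner domain is
  convex and does not contain \<open>x\<close>. For such a half the jump condition says that the weight of its end
  point is at least \<open>\<alpha>\<close>, so the segment required by the \<open>\<alpha>\<close>-extension property is part of the other,
  good half.
\<close>

lemma alpha_children_segment:
  assumes L: "is_lens L" and ext: "alpha_extension \<alpha> L L'" and a: "0 < \<alpha>" "\<alpha> < 1"
    and xs: "x' \<in> region L" "x'' \<in> region L" "x \<in> region L"
    and t: "0 < t" "t < 1" "x = (1 - t) *\<^sub>R x' + t *\<^sub>R x''"
    and c1: "\<not> closed_segment x'' x \<subseteq> region L \<Longrightarrow> \<alpha> * norm (x' - x'') \<le> norm (x' - x)"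
    and c2: "\<not> closed_segment x' x \<subseteq> region L \<Longrightarrow> \<alpha> * norm (x'' - x') \<le> norm (x'' - x)"
    and sub: "region L \<subseteq> region L'"
  shows "closed_segment x' x'' \<subseteq> region L'"
proof -
  have xc: "x \<notin> inner_dom L" and clO: "x' \<in> closure (outer L)" "x'' \<in> closure (outer L)"
    using xs region_iff[OF L] by auto
  have segc: "closed_segment x' x'' \<subseteq> closure (outer L)"
    using clO is_lensD(4)[OF L] by (intro closed_segment_subset convex_closure) auto
  have xseg: "x \<in> closed_segment x' x''" unfolding in_segment using t by (intro exI[of _ t]) auto
  have main: "closed_segment u'' u' \<subseteq> region L'"
    if u: "u' \<in> region L" "u'' \<in> region L" "x = (1 - s) *\<^sub>R u' + s *\<^sub>R u''" "0 < s" "s < 1"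
      and good: "closed_segment u' x \<subseteq> region L"
      and c: "\<not> closed_segment u'' x \<subseteq> region L \<Longrightarrow> \<alpha> * norm (u' - u'') \<le> norm (u' - x)" for u' u'' s
  proof (cases "closed_segment u'' x \<subseteq> region L")
    case True
    have "x \<in> closed_segment u' u''" unfolding in_segment using u by (intro exI[of _ s]) auto
    then have "closed_segment u'' u' = closed_segment u' x \<union> closed_segment x u''"
      using Un_closed_segment closed_segment_commute by metis
    then show ?thesis using True good sub by (auto simp: closed_segment_commute)
  next
    case False
    have d: "u' - x = s *\<^sub>R (u' - u'')" by (simp add: u(3) algebra_simps)
    have ne: "u' \<noteq> u''" using False good d by auto
    have "\<alpha> * norm (u' - u'') \<le> s * norm (u' - u'')" using c[OF False] u(4) by (simp add: d)
    then have le: "\<alpha> \<le> s" using ne by simp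
    have "\<alpha> *\<^sub>R u'' + (1 - \<alpha>) *\<^sub>R u' \<in> closed_segment u' x"
      unfolding closed_segment_param
    proof (intro exI[of _ "\<alpha> / s"] conjI)
      have "(\<alpha> / s) *\<^sub>R (x - u') = - ((\<alpha> / s) *\<^sub>R (u' - x))" by (simp add: algebra_simps)
      also have "\<dots> = - (\<alpha> *\<^sub>R (u' - u''))" unfolding d using u(4) by simp
      finally show "\<alpha> *\<^sub>R u'' + (1 - \<alpha>) *\<^sub>R u' = u' + (\<alpha> / s) *\<^sub>R (x - u')" by (simp add: algebra_simps)
    qed (use le a u in auto)
    then have "closed_segment (\<alpha> *\<^sub>R u'' + (1 - \<alpha>) *\<^sub>R u') u' \<subseteq> closed_segment u' x"
      by (simp add: subset_closed_segment)
    then show ?thesis using ext u(1,2) good unfolding alpha_extension_def by blast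
  qed
  \<comment> \<open>points of the inner domain in both halves would enclose \<open>x\<close>\<close>
  have "closed_segment x' x \<subseteq> region L \<or> closed_segment x'' x \<subseteq> region L"
  proof (rule ccontr)
    assume n: "\<not> ?thesis"
    have "closed_segment x' x \<subseteq> closed_segment x' x''" "closed_segment x'' x \<subseteq> closed_segment x' x''"
      using xseg by (simp_all add: subset_closed_segment)
    then have sub1: "closed_segment x' x \<subseteq> closure (outer L)" "closed_segment x'' x \<subseteq> closure (outer L)"
      using segc by blast+
    obtain p where p: "p \<in> closed_segment x' x" "p \<in> inner_dom L"
      using n sub1(1) region_iff[OF L] by blast
    obtain q where q: "q \<in> closed_segment x'' x" "q \<in> inner_dom L"
      using n sub1(2) region_iff[OF L] by blast
    have "x \<in> closed_segment p q"
    proof -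
      obtain i where i: "0 \<le> i" "i \<le> 1" "p = x' + i *\<^sub>R (x - x')" using p(1) by (auto simp: closed_segment_param)
      obtain j where j: "0 \<le> j" "j \<le> 1" "q = x'' + j *\<^sub>R (x - x'')" using q(1) by (auto simp: closed_segment_param)
      have px: "p - x = ((1 - i) * t) *\<^sub>R (x' - x'')" and qx: "q - x = - (((1 - j) * (1 - t)) *\<^sub>R (x' - x''))"
        unfolding i(3) j(3) t(3) by (simp_all add: algebra_simps)
      \<comment> \<open>distances of \<open>p\<close> and \<open>q\<close> from \<open>x\<close> in units of \<open>x' - x''\<close>\<close>
      define A B where "A = (1 - i) * t" "B = (1 - j) * (1 - t)"
      have AB: "0 \<le> A" "0 \<le> B" using i j t by (auto simp: A_B_def)
      show ?thesis
      proof (cases "A + B = 0")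
        case True
        then have "A = 0" using AB by linarith
        then have "p = x" using px by (simp add: A_B_def[symmetric])
        then show ?thesis by simp
      next
        case False
        then have AB0: "0 < A + B" using AB by linarith
        have "x - p = (A / (A + B)) *\<^sub>R (q - p)"
        proof -
          have "q - p = (q - x) - (p - x)" by simp
          also have "\<dots> = - ((A + B) *\<^sub>R (x' - x''))"
            unfolding px qx by (simp add: A_B_def algebra_simps)
          finally have qp: "q - p = - ((A + B) *\<^sub>R (x' - x''))" .
          have "(A / (A + B)) *\<^sub>R (q - p) = - (A *\<^sub>R (x' - x''))" unfolding qp using AB0 by simp
          moreover have "p - x = A *\<^sub>R (x' - x'')" using px by (simp add: A_B_def)
          ultimately show ?thesis by (metis minus_diff_eq)
        qed
        then show ?thesis unfolding closed_segment_param
          using AB AB0 by (intro exI[of _ "A / (A + B)"]) (auto simp: algebra_simps)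
      qed
    qed
    then have "x \<in> inner_dom L" using convex_contains_segment is_lensD(8)[OF L] p(2) q(2) by blast
    then show False using xc by simp
  qed
  then show ?thesis
  proof
    assume "closed_segment x' x \<subseteq> region L"
    then show ?thesis using main[of x' x'' t] xs t c1 closed_segment_commute by blast
  next
    assume g: "closed_segment x'' x \<subseteq> region L"
    have "x = (1 - (1 - t)) *\<^sub>R x'' + (1 - t) *\<^sub>R x'" by (simp add: t(3) add.commute)
    then show ?thesis using main[of x'' x' "1 - t"] xs t(1,2) c2 g by simp
  qed
qed

section \<open>Averages of the rearrangement over intervals\<close>

text \<open>
  A line orthogonal to \<open>e\<close> through a point of the outer domain meets the fixed boundary at most once,
  so one of its two halves never leaves the domain.
\<close>

lemma upward_direction_of_injective_projection:
  fixes e :: "real^2"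
  assumes L: "is_lens L" and e: "norm e = 1" "inj_on (\<lambda>v. e \<bullet> v) (fixed_boundary L)"
  obtains N where "norm N = 1" "e \<bullet> N = 0" "upward (outer L) N"
proof -
  obtain n where "norm n = norm e" "e \<bullet> n = 0" using exists_unit_orthogonal .
  then have n: "norm n = 1" "e \<bullet> n = 0" "n \<noteq> 0" using e by auto
  obtain u where u: "u \<in> outer L" using is_lensD(12)[OF L] by blast
  have uc: "u \<in> closure (outer L)" using u closure_subset by blast
  have "(\<forall>t\<ge>0. u + t *\<^sub>R n \<in> outer L) \<or> (\<forall>t\<ge>0. u + t *\<^sub>R (- n) \<in> outer L)"
  proof (rule ccontr)
    assume "\<not> ?thesis"
    then obtain s t where s: "0 \<le> s" "u + s *\<^sub>R n \<notin> outer L" and t: "0 \<le> t" "u + t *\<^sub>R (- n) \<notin> outer L" by blast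
    obtain s' where s': "0 \<le> s'" "u + s' *\<^sub>R n \<in> fixed_boundary L" using ray_meets_fixed_boundary[OF L uc s] .
    obtain t' where t': "0 \<le> t'" "u + t' *\<^sub>R (- n) \<in> fixed_boundary L" using ray_meets_fixed_boundary[OF L uc t] .
    have "u + s' *\<^sub>R n = u + t' *\<^sub>R (- n)"
      using inj_onD[OF e(2) _ s'(2) t'(2)] n(2) by (simp add: inner_add_right inner_diff_right)
    then have "(s' + t') *\<^sub>R n = 0" by (simp add: algebra_simps)
    then have "s' = 0" using n(3) s'(1) t'(1) by simp
    then show False using s'(2) u fixed_boundary_iff[OF L] by simp
  qed
  then show thesis
  proof
    assume "\<forall>t\<ge>0. u + t *\<^sub>R n \<in> outer L"
    then show thesis using that[of n] n upward_if_contains_ray[OF is_lensD(1,2)[OF L] n(3), of u] closure_subset by blast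
  next
    assume r: "\<forall>t\<ge>0. u + t *\<^sub>R (- n) \<in> outer L"
    have "upward (outer L) (- n)"
    proof (rule upward_if_contains_ray[OF is_lensD(1,2)[OF L]])
      show "- n \<noteq> 0" using n(3) by simp
      show "u + t *\<^sub>R (- n) \<in> closure (outer L)" if "0 \<le> t" for t
        using r that closure_subset by blast
    qed
    then show thesis using that[of "- n"] n by simp
  qed
qed

lemma average_linear:
  fixes f :: "'a \<Rightarrow> 'b::euclidean_space"
  assumes "set_integrable M A f" and T: "bounded_linear (T :: 'b \<Rightarrow> real)" and pos: "0 < measure M A"
  shows "(LINT x:A|M. T (f x)) = measure M A * T (average M A f)"
proof -
  interpret bounded_linear T by fact
  have "(LINT x:A|M. T (f x)) = (LINT x|M. T (indicator A x *\<^sub>R f x))"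
    unfolding set_lebesgue_integral_def by (simp add: scaleR)
  also have "\<dots> = T (LINT x:A|M. f x)"
    unfolding set_lebesgue_integral_def using assms(1)
    by (intro integral_bounded_linear[OF T]) (simp add: set_integrable_def)
  also have "\<dots> = T (measure M A *\<^sub>R average M A f)" using pos by (simp add: measure_average)
  finally show ?thesis by (simp add: scaleR)
qed

lemma set_integral_linear_diff:
  fixes f :: "'a \<Rightarrow> 'b::euclidean_space"
  assumes "finite_measure M" and A: "A \<in> sets M" "0 < measure M A" and f: "integrable M f"
    and T: "bounded_linear (T :: 'b \<Rightarrow> real)"
  shows "(LINT x:A|M. T (f x) - c) = measure M A * (T (average M A f) - c)"
proof -
  interpret finite_measure M by fact
  have fA: "set_integrable M A f" unfolding set_integrable_def by (rule integrable_mult_indicator[OF A(1) f])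
  have i1: "set_integrable M A (\<lambda>x. T (f x))"
    unfolding set_integrable_def by (rule integrable_mult_indicator[OF A(1) integrable_bounded_linear[OF T f]])
  have i2: "set_integrable M A (\<lambda>x. c)"
    unfolding set_integrable_def by (rule integrable_mult_indicator[OF A(1)]) simp
  have "A \<inter> space M = A" using sets.sets_into_space[OF A(1)] by blast
  then have "(LINT x:A|M. c) = measure M A * c"
    using A by (simp add: set_lebesgue_integral_def emeasure_eq_measure)
  then show ?thesis
    unfolding set_integral_diff(2)[OF i1 i2] average_linear[OF fA T A(2)] by (simp add: right_diff_distrib)
qed

lemma bounded_linear_tilt: "bounded_linear (tilt e N m)"
  unfolding tilt_def by (intro bounded_linear_sub bounded_linear_inner_right bounded_linear_const_mult)

lemma average_in_closed_convex:
  fixes f :: "'a \<Rightarrow> 'b::euclidean_space"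
  assumes M: "finite_measure M" and C: "closed C" "convex C" and A: "A \<in> sets M" "0 < measure M A"
    and f: "set_integrable M A f" "\<And>x. x \<in> A \<Longrightarrow> f x \<in> C"
  shows "average M A f \<in> C"
proof (rule ccontr)
  interpret finite_measure M by fact
  assume "average M A f \<notin> C"
  then obtain a b where ab: "a \<bullet> average M A f < b" "\<And>x. x \<in> C \<Longrightarrow> b < a \<bullet> x"
    using separating_hyperplane_closed_point[OF C(2,1)] by blast
  have "measure M A * b = (LINT x:A|M. b)"
    using A by (simp add: set_lebesgue_integral_def emeasure_eq_measure)
  also have "\<dots> \<le> (LINT x:A|M. a \<bullet> f x)"
  proof (rule set_integral_mono)
    show "set_integrable M A (\<lambda>x. b)" using A unfolding set_integrable_def by (intro integrable_mult_indicator) auto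
    have "integrable M (\<lambda>x. a \<bullet> (indicator A x *\<^sub>R f x))"
      using f(1) unfolding set_integrable_def by (rule integrable_inner_right)
    then show "set_integrable M A (\<lambda>x. a \<bullet> f x)" unfolding set_integrable_def by simp
    show "\<And>x. x \<in> A \<Longrightarrow> b \<le> a \<bullet> f x" using f(2) ab(2) by (simp add: less_imp_le)
  qed
  also have "\<dots> = measure M A * (a \<bullet> average M A f)"
    by (rule average_linear[OF f(1) bounded_linear_inner_right A(2)])
  finally show False using ab(1) A(2) by simp
qed

lemma AE_eq_if_average_eq:
  fixes g :: "'a \<Rightarrow> real"
  assumes "A \<in> sets M" and g: "integrable M g" "\<And>x. x \<in> A \<Longrightarrow> 0 \<le> g x" and z: "(LINT x:A|M. g x) = 0"
  shows "AE x in M. x \<in> A \<longrightarrow> g x = 0"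
proof -
  have int: "integrable M (\<lambda>x. indicator A x *\<^sub>R g x)" using assms by (intro integrable_mult_indicator) auto
  have "AE x in M. 0 \<le> indicator A x *\<^sub>R g x" using g(2) by (intro AE_I2) (auto simp: indicator_def)
  then have "AE x in M. indicator A x *\<^sub>R g x = 0"
    using integral_nonneg_eq_0_iff_AE[OF int] z by (simp add: set_lebesgue_integral_def)
  then show ?thesis by eventually_elim auto
qed

text \<open>
  \<open>J\<close> plays the role of the interval, and \<open>Jl\<close>, \<open>Jr\<close> are the parts of the probability space where the
  values lie to the left and to the right. A tail value below the supporting line at the exit
  point \<open>y\<close> of \<open>[z, x]\<close> forces the mean \<open>x\<close> to the left of the point where the supporting line
  through \<open>A\<close> touches the inner domain. There the wedge function at \<open>x\<close> is the height over this line,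
  which is larger than the contribution of \<open>Jl\<close>, while the wedge function lives on \<open>Jl\<close> only.
  Stated for sets instead of intervals, the lemma applies to both tails: replacing \<open>e\<close> by \<open>- e\<close>
  exchanges left and right.
\<close>

lemma no_interval_with_tail_below_support:
  fixes e N :: "real^2" and \<psi> :: "'b \<Rightarrow> real^2"
  assumes P: "prob_space P" and L: "is_lens L" and up: "upward (outer L) N"
    and eN: "norm e = 1" "norm N = 1" "e \<bullet> N = 0"
    and \<psi>: "integrable P \<psi>" "\<And>t. t \<in> space P \<Longrightarrow> \<psi> t \<in> fixed_boundary L"
    and sets: "Jl \<in> sets P" "J \<in> sets P" "Jr \<in> sets P"
    and disj: "Jl \<inter> J = {}" "Jl \<inter> Jr = {}" "J \<inter> Jr = {}" and cover: "AE t in P. t \<in> Jl \<union> J \<union> Jr"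
    and J: "0 < measure P J" "average P J \<psi> \<in> inner_dom L"
    and A: "A \<in> fixed_boundary L" and lft: "\<And>t. t \<in> Jl \<Longrightarrow> e \<bullet> \<psi> t \<le> e \<bullet> A"
    and mid: "\<And>t. t \<in> J \<Longrightarrow> e \<bullet> A \<le> e \<bullet> \<psi> t" and rgt: "\<And>t t'. t \<in> J \<Longrightarrow> t' \<in> Jr \<Longrightarrow> e \<bullet> \<psi> t \<le> e \<bullet> \<psi> t'"
    and jensen: "\<And>w m. w \<in> closure (inner_dom L) \<Longrightarrow> wedge e N m w (LINT t|P. \<psi> t) \<le> (LINT t|P. wedge e N m w (\<psi> t))"
    and y: "y \<in> closed_segment (average P J \<psi>) (LINT t|P. \<psi> t)" "y \<in> closure (inner_dom L)" "y \<notin> inner_dom L"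
      "\<And>v. v \<in> closure (inner_dom L) \<Longrightarrow> tilt e N k y \<le> tilt e N k v"
    and bad: "t0 \<in> Jl" "tilt e N k (\<psi> t0) < tilt e N k y"
  shows False
proof -
  interpret prob_space P by fact
  define z where "z = average P J \<psi>"
  define x where "x = (LINT t|P. \<psi> t)"
  have zI: "z \<in> inner_dom L" using J by (simp add: z_def)
  have Ac: "A \<in> closure (outer L)" "A \<notin> outer L" using A fixed_boundary_iff[OF L] by auto
  have zA: "z \<noteq> A" using zI Ac is_lensD(11)[OF L] by blast
  have inJ: "t \<in> space P" if "t \<in> J" for t using that sets.sets_into_space[OF sets(2)] by blast
  have \<psi>J: "set_integrable P J \<psi>" using \<psi>(1) sets unfolding set_integrable_def by (intro integrable_mult_indicator) auto
  have same: "\<psi> t = A" if "t \<in> J" "e \<bullet> \<psi> t = e \<bullet> A" for t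
    using boundary_same_abscissa[OF up eN _ _ Ac that(2)] \<psi>(2)[OF inJ[OF that(1)]] fixed_boundary_iff[OF L] by blast
  have notA: "\<not> (AE t in P. t \<in> J \<longrightarrow> e \<bullet> \<psi> t = e \<bullet> A)"
  proof
    assume ae: "AE t in P. t \<in> J \<longrightarrow> e \<bullet> \<psi> t = e \<bullet> A"
    have "(LINT t:J|P. \<psi> t) = (LINT t:J|P. A)"
      unfolding set_lebesgue_integral_def
    proof (rule integral_cong_AE)
      show "AE t in P. indicator J t *\<^sub>R \<psi> t = indicator J t *\<^sub>R A"
        using ae by eventually_elim (auto simp: indicator_def same)
    qed (use \<psi>J sets in \<open>auto simp: set_integrable_def\<close>)
    also have "\<dots> = measure P J *\<^sub>R A" using sets by (simp add: set_lebesgue_integral_def emeasure_eq_measure)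
    finally have "z = A" using J(1) by (simp add: z_def average_def)
    then show False using zA by simp
  qed
  note lin = set_integral_linear_diff[OF finite_measure_axioms sets(2) J(1) \<psi>(1), folded z_def]
  have ez: "e \<bullet> A < e \<bullet> z"
  proof -
    have eq: "(LINT t:J|P. e \<bullet> \<psi> t - e \<bullet> A) = measure P J * (e \<bullet> z - e \<bullet> A)" using lin[OF bounded_linear_inner_right] .
    have "0 \<le> (LINT t:J|P. e \<bullet> \<psi> t - e \<bullet> A)" 
      unfolding set_lebesgue_integral_def using mid by (intro integral_nonneg_AE AE_I2) (auto simp: indicator_def)
    then have "0 \<le> e \<bullet> z - e \<bullet> A" unfolding eq using J(1) by (simp add: zero_le_mult_iff)
    moreover have "e \<bullet> z \<noteq> e \<bullet> A"
    proof
      assume "e \<bullet> z = e \<bullet> A"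
      then have "AE t in P. t \<in> J \<longrightarrow> e \<bullet> \<psi> t - e \<bullet> A = 0"
        using eq mid \<psi>(1) by (intro AE_eq_if_average_eq[OF sets(2)]) auto
      then show False using notA by simp
    qed
    ultimately show ?thesis by simp
  qed
  \<comment> \<open>slope of the line \<open>Az\<close>; as \<open>z\<close> is an average, some value of \<open>\<psi>\<close> on \<open>J\<close> is not below this line\<close>
  define s where "s = (N \<bullet> z - N \<bullet> A) / (e \<bullet> z - e \<bullet> A)"
  have sz: "tilt e N s z = tilt e N s A" using ez by (simp add: tilt_def s_def field_simps)
  have "\<exists>t\<in>J. e \<bullet> A < e \<bullet> \<psi> t \<and> tilt e N s A \<le> tilt e N s (\<psi> t)"
  proof (rule ccontr)
    assume n: "\<not> ?thesis"
    have lt: "e \<bullet> \<psi> t = e \<bullet> A \<or> tilt e N s (\<psi> t) < tilt e N s A" if "t \<in> J" for t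
      using n mid[OF that] that by force
    have le: "tilt e N s (\<psi> t) \<le> tilt e N s A" if "t \<in> J" for t using lt[OF that] same[OF that] by auto
    have "(LINT t:J|P. tilt e N s A - tilt e N s (\<psi> t)) = - (LINT t:J|P. tilt e N s (\<psi> t) - tilt e N s A)"
      unfolding set_lebesgue_integral_def integral_minus[symmetric]
      by (intro Bochner_Integration.integral_cong) (auto simp: algebra_simps)
    also have "\<dots> = 0" using lin[OF bounded_linear_tilt, of e N s "tilt e N s A"] sz by simp
    finally have "AE t in P. t \<in> J \<longrightarrow> tilt e N s A - tilt e N s (\<psi> t) = 0"
      using le integrable_tilt[OF \<psi>(1), of e N s] by (intro AE_eq_if_average_eq[OF sets(2)]) auto
    then have "AE t in P. t \<in> J \<longrightarrow> e \<bullet> \<psi> t = e \<bullet> A" by eventually_elim (use lt in force)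
    then show False using notA by simp
  qed
  then obtain b where b: "b \<in> J" "e \<bullet> A < e \<bullet> \<psi> b" "tilt e N s A \<le> tilt e N s (\<psi> b)" by blast
  have BG: "\<psi> b \<in> fixed_boundary L" using \<psi>(2)[OF inJ[OF b(1)]] .
  obtain w m where w: "w \<in> closure (inner_dom L)" "w \<notin> inner_dom L" "e \<bullet> A < e \<bullet> w"
    and mw: "tilt e N m w = tilt e N m A"
    and cl: "\<And>v. v \<in> closure (inner_dom L) \<Longrightarrow> tilt e N m A \<le> tilt e N m v"
    and inn: "\<And>v. v \<in> inner_dom L \<Longrightarrow> tilt e N m A < tilt e N m v"
    and tL: "\<And>P. P \<in> fixed_boundary L \<Longrightarrow> e \<bullet> P \<le> e \<bullet> A \<Longrightarrow> tilt e N m A \<le> tilt e N m P"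
    and tM: "\<And>P. P \<in> fixed_boundary L \<Longrightarrow> e \<bullet> A \<le> e \<bullet> P \<Longrightarrow> e \<bullet> P < e \<bullet> w \<Longrightarrow> tilt e N m P \<le> tilt e N m A"
    and tR: "\<And>P. P \<in> fixed_boundary L \<Longrightarrow> e \<bullet> (\<psi> b) \<le> e \<bullet> P \<Longrightarrow> tilt e N m A \<le> tilt e N m P"
    using tangent_from_boundary_point[OF L up eN A BG zI ez b(2) sz b(3)] by blast
  \<comment> \<open>height over the supporting line through \<open>A\<close>\<close>
  define g where "g t = tilt e N m (\<psi> t) - tilt e N m A" for t
  have gi: "integrable P g" unfolding g_def using integrable_tilt[OF \<psi>(1)] by auto
  have gi': "integrable P (\<lambda>t. indicator X t * g t)" if "X \<in> sets P" for X
    using integrable_mult_indicator[OF that gi] by simp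
  have insp: "t \<in> Jl \<or> t \<in> Jr \<Longrightarrow> t \<in> space P" for t using sets sets.sets_into_space by blast
  have gl: "0 \<le> g t" if "t \<in> Jl" for t using tL \<psi>(2) insp lft that by (simp add: g_def)
  have gr: "0 \<le> g t" if "t \<in> Jr" for t using tR \<psi>(2) insp rgt[OF b(1)] that by (simp add: g_def)
  have gJ: "0 < (LINT t|P. indicator J t * g t)"
  proof -
    have "(LINT t|P. indicator J t * g t) = measure P J * (tilt e N m z - tilt e N m A)"
      using lin[OF bounded_linear_tilt, of e N m "tilt e N m A"] by (simp add: set_lebesgue_integral_def g_def)
    then show ?thesis using J(1) inn[OF zI] by simp
  qed
  have gx: "(LINT t|P. g t) = tilt e N m x - tilt e N m A"
  proof -
    have "(LINT t|P. tilt e N m (\<psi> t)) = tilt e N m x" unfolding x_def by (rule integral_bounded_linear[OF bounded_linear_tilt \<psi>(1)])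
    then show ?thesis unfolding g_def using integrable_tilt[OF \<psi>(1)] prob_space by simp
  qed
  have split: "(LINT t|P. g t) = (LINT t|P. indicator Jl t * g t) + (LINT t|P. indicator J t * g t) + (LINT t|P. indicator Jr t * g t)"
  proof -
    have "(LINT t|P. g t) = (LINT t|P. indicator Jl t * g t + indicator J t * g t + indicator Jr t * g t)"
    proof (rule integral_cong_AE)
      show "AE t in P. g t = indicator Jl t * g t + indicator J t * g t + indicator Jr t * g t"
        using cover by eventually_elim (use disj in \<open>auto simp: indicator_def\<close>)
    qed (use gi gi' sets in auto)
    then show ?thesis using gi' sets by simp
  qed
  have g0: "0 \<le> (LINT t|P. indicator Jl t * g t)" "0 \<le> (LINT t|P. indicator Jr t * g t)"
    using gl gr by (auto intro!: integral_nonneg_AE AE_I2 simp: indicator_def)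
  have xA: "tilt e N m A < tilt e N m x" using gx split gJ g0 by linarith
  have "e \<bullet> x < e \<bullet> w"
  proof (rule left_of_tangency_point[OF is_lensD(8)[OF L] lens_inner_upward[OF L _ up] eN w(1)])
    show "N \<noteq> 0" using eN by auto
    show "\<And>v. v \<in> closure (inner_dom L) \<Longrightarrow> tilt e N m w \<le> tilt e N m v" using cl mw by simp
    show "z \<in> inner_dom L" by (rule zI)
    show "tilt e N m w < tilt e N m z" using inn[OF zI] mw by simp
    show "tilt e N m w < tilt e N m x" using xA mw by simp
    show "y \<in> closed_segment z x" using y(1) by (simp add: z_def x_def)
    show "y \<in> closure (inner_dom L)" "y \<notin> inner_dom L" using y by auto
    show "\<And>v. v \<in> closure (inner_dom L) \<Longrightarrow> tilt e N k y \<le> tilt e N k v" by (rule y(4))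
    show "e \<bullet> \<psi> t0 \<le> e \<bullet> w" using lft[OF bad(1)] w(3) by simp
    show "tilt e N m w \<le> tilt e N m (\<psi> t0)" using gl[OF bad(1)] mw by (simp add: g_def)
    show "tilt e N k (\<psi> t0) < tilt e N k y" by (rule bad(2))
  qed
  then have "wedge e N m w x = tilt e N m x - tilt e N m A" using xA mw by (simp add: wedge_def)
  moreover have "(LINT t|P. wedge e N m w (\<psi> t)) \<le> (LINT t|P. indicator Jl t * g t)"
  proof (rule integral_mono_AE)
    show "integrable P (\<lambda>t. wedge e N m w (\<psi> t))" using integrable_wedge[OF finite_measure_axioms \<psi>(1)] .
    show "integrable P (\<lambda>t. indicator Jl t * g t)" using gi' sets by simp
    show "AE t in P. wedge e N m w (\<psi> t) \<le> indicator Jl t * g t"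
      using cover
    proof (eventually_elim)
      case (elim t)
      show ?case
      proof (cases "t \<in> Jl")
        case True
        then show ?thesis using gl[OF True] mw by (simp add: wedge_def g_def)
      next
        case False
        then have "e \<bullet> A \<le> e \<bullet> \<psi> t" using elim mid rgt[OF b(1)] b(2) by force
        moreover have "t \<in> space P" using elim inJ insp by blast
        ultimately have "wedge e N m w (\<psi> t) = 0" using tM \<psi>(2) mw by (simp add: wedge_def)
        then show ?thesis using False by simp
      qed
    qed
  qed
  ultimately have "tilt e N m x - tilt e N m A \<le> (LINT t|P. indicator Jl t * g t)"
    using jensen[OF w(1), of m] by (simp add: x_def)
  then show False using gx split gJ g0 by linarith
qed

abbreviation unit_interval :: "real measure" where "unit_interval \<equiv> lebesgue_on {0..1}"

lemma prob_space_unit_interval: "prob_space unit_interval"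
  by (intro prob_spaceI) (simp add: space_restrict_space emeasure_restrict_space)

lemma sets_unit_interval: "A \<in> sets lebesgue \<Longrightarrow> A \<subseteq> {0..1} \<Longrightarrow> A \<in> sets unit_interval"
  by (simp add: sets_restrict_space_iff)

lemma measure_unit_interval: "A \<subseteq> {0..1} \<Longrightarrow> measure unit_interval A = measure lebesgue A"
  by (simp add: measure_restrict_space)

lemma measure_lebesgue_greaterThanLessThan: "a \<le> b \<Longrightarrow> measure lebesgue {a<..<b::real} = b - a"
  by (simp add: measure_def)

text \<open>
  The supporting line at the exit point \<open>y\<close> has the mean on or below it and the average over the
  interval strictly above, so it has some value of \<open>\<psi>\<close> outside the interval strictly below it.
\<close>

lemma interval_average_avoids_inner:
  fixes e N :: "real^2"
  assumes L: "is_lens L" and up: "upward (outer L) N" and eN: "norm e = 1" "norm N = 1" "e \<bullet> N = 0"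
    and \<psi>: "integrable unit_interval \<psi>" "\<And>t. t \<in> {0..1} \<Longrightarrow> \<psi> t \<in> fixed_boundary L"
    and mono: "antimono_on {0<..<1} (\<lambda>t. e \<bullet> \<psi> t)"
    and jensen: "\<And>e' w m. e' = e \<or> e' = - e \<Longrightarrow> w \<in> closure (inner_dom L) \<Longrightarrow>
        wedge e' N m w (LINT t|unit_interval. \<psi> t) \<le> (LINT t|unit_interval. wedge e' N m w (\<psi> t))"
    and mean: "(LINT t|unit_interval. \<psi> t) \<notin> inner_dom L"
    and ab: "0 \<le> a" "a < b" "b \<le> 1"
  shows "average unit_interval {a<..<b} \<psi> \<notin> inner_dom L"
proof
  interpret prob_space unit_interval by (rule prob_space_unit_interval)
  let ?P = unit_interval
  define z where "z = average ?P {a<..<b} \<psi>"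
  define x where "x = (LINT t|?P. \<psi> t)"
  assume "average unit_interval {a<..<b} \<psi> \<in> inner_dom L"
  then have zI: "z \<in> inner_dom L" by (simp add: z_def)
  have xI: "x \<notin> inner_dom L" using mean by (simp add: x_def)
  have N0: "N \<noteq> 0" using eN by auto
  note upI = lens_inner_upward[OF L N0 up]
  note l = is_lensD[OF L]
  have anti: "e \<bullet> \<psi> t \<le> e \<bullet> \<psi> s" if "0 < s" "s \<le> t" "t < 1" for s t
    using monotone_onD[OF mono, of s t] that by auto
  have "closed_segment z x \<inter> frontier (inner_dom L) \<noteq> {}"
    using zI xI by (intro connected_Int_frontier) auto
  then obtain y where y: "y \<in> closed_segment z x" "y \<in> closure (inner_dom L)" "y \<notin> inner_dom L"
    using l(5) by (auto simp: frontier_def interior_open)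
  obtain k where k: "\<And>v. v \<in> closure (inner_dom L) \<Longrightarrow> tilt e N k y \<le> tilt e N k v"
    "\<And>v. v \<in> inner_dom L \<Longrightarrow> tilt e N k y < tilt e N k v"
    using supporting_line_with_slope[OF l(5,8) upI eN y(2,3)] by blast
  have xle: "tilt e N k x \<le> tilt e N k y"
  proof -
    obtain u where u: "0 \<le> u" "u \<le> 1" "y = (1 - u) *\<^sub>R z + u *\<^sub>R x" using y(1) by (auto simp: in_segment)
    then have ty: "tilt e N k y = (1 - u) * tilt e N k z + u * tilt e N k x" by (simp only: tilt_combination)
    show ?thesis
    proof (rule ccontr)
      assume "\<not> ?thesis"
      then have "(1 - u) * (- tilt e N k z) + u * (- tilt e N k x) < - tilt e N k y"
        using k(2)[OF zI] u by (intro convex_bound_lt) auto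
      then show False using ty by simp
    qed
  qed
  define Jl J Jr where "Jl = {0<..<a}" "J = {a<..<b}" "Jr = {b<..<1::real}"
  have sets: "Jl \<in> sets ?P" "J \<in> sets ?P" "Jr \<in> sets ?P"
    using ab by (auto simp: Jl_J_Jr_def intro!: sets_unit_interval)
  have dj: "Jl \<inter> J = {}" "Jl \<inter> Jr = {}" "J \<inter> Jr = {}" using ab by (auto simp: Jl_J_Jr_def)
  have "AE t in lebesgue. t \<noteq> 0 \<and> t \<noteq> a \<and> t \<noteq> b \<and> t \<noteq> (1::real)"
    by (intro AE_conjI AE_completion AE_lborel_singleton)
  then have "AE t in ?P. t \<noteq> 0 \<and> t \<noteq> a \<and> t \<noteq> b \<and> t \<noteq> (1::real)"
    by (subst AE_restrict_space_iff) (auto)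
  then have cover: "AE t in ?P. t \<in> Jl \<union> J \<union> Jr"
    using AE_space by eventually_elim (auto simp: Jl_J_Jr_def space_restrict_space)
  have mJ: "0 < measure ?P J"
    using ab by (simp add: Jl_J_Jr_def measure_unit_interval subset_iff measure_lebesgue_greaterThanLessThan)
  have zJ: "average ?P J \<psi> = z" by (simp add: z_def Jl_J_Jr_def)
  have gi: "integrable ?P (\<lambda>t. tilt e N k (\<psi> t) - tilt e N k y)" using integrable_tilt[OF \<psi>(1)] by auto
  have "\<exists>t. (t \<in> Jl \<or> t \<in> Jr) \<and> tilt e N k (\<psi> t) < tilt e N k y"
  proof (rule ccontr)
    assume n: "\<not> ?thesis"
    have "(LINT t:J|?P. tilt e N k (\<psi> t) - tilt e N k y) \<le> (LINT t|?P. tilt e N k (\<psi> t) - tilt e N k y)"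
      unfolding set_lebesgue_integral_def
    proof (rule integral_mono_AE)
      show "integrable ?P (\<lambda>t. indicator J t *\<^sub>R (tilt e N k (\<psi> t) - tilt e N k y))"
        by (rule integrable_mult_indicator[OF sets(2) gi])
      show "AE t in ?P. indicator J t *\<^sub>R (tilt e N k (\<psi> t) - tilt e N k y) \<le> tilt e N k (\<psi> t) - tilt e N k y"
        using cover by eventually_elim (use n in \<open>force simp: indicator_def not_less\<close>)
    qed (rule gi)
    also have "\<dots> = tilt e N k x - tilt e N k y"
    proof -
      have "(LINT t|?P. tilt e N k (\<psi> t)) = tilt e N k x" unfolding x_def by (rule integral_bounded_linear[OF bounded_linear_tilt \<psi>(1)])
      then show ?thesis using integrable_tilt[OF \<psi>(1)] prob_space by simp
    qed
    finally have "(LINT t:J|?P. tilt e N k (\<psi> t) - tilt e N k y) \<le> 0" using xle by simp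
    moreover have "(LINT t:J|?P. tilt e N k (\<psi> t) - tilt e N k y) = measure ?P J * (tilt e N k z - tilt e N k y)"
      using set_integral_linear_diff[OF finite_measure_axioms sets(2) mJ \<psi>(1) bounded_linear_tilt] zJ by simp
    ultimately show False using mJ k(2)[OF zI] by (simp add: mult_le_0_iff)
  qed
  then obtain t0 where t0: "t0 \<in> Jl \<or> t0 \<in> Jr" "tilt e N k (\<psi> t0) < tilt e N k y" by blast
  have sp: "t \<in> space ?P \<Longrightarrow> \<psi> t \<in> fixed_boundary L" for t using \<psi>(2) by (simp add: space_restrict_space)
  from t0(1) show False
  proof
    assume t0r: "t0 \<in> Jr"
    then have b1: "b < 1" by (simp add: Jl_J_Jr_def)
    show False
    proof (rule no_interval_with_tail_below_support[OF prob_space_unit_interval L up eN \<psi>(1) sp sets(3,2,1)])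
      show "Jr \<inter> J = {}" "Jr \<inter> Jl = {}" "J \<inter> Jl = {}" using dj by auto
      show "AE t in ?P. t \<in> Jr \<union> J \<union> Jl" using cover by eventually_elim auto
      show "0 < measure ?P J" by (rule mJ)
      show "average ?P J \<psi> \<in> inner_dom L" using zJ zI by simp
      show "\<psi> b \<in> fixed_boundary L" using \<psi>(2) ab by simp
      show "\<And>t. t \<in> Jr \<Longrightarrow> e \<bullet> \<psi> t \<le> e \<bullet> \<psi> b" using ab by (auto simp: Jl_J_Jr_def intro!: anti)
      show "\<And>t. t \<in> J \<Longrightarrow> e \<bullet> \<psi> b \<le> e \<bullet> \<psi> t" using ab b1 by (auto simp: Jl_J_Jr_def intro!: anti)
      show "\<And>t t'. t \<in> J \<Longrightarrow> t' \<in> Jl \<Longrightarrow> e \<bullet> \<psi> t \<le> e \<bullet> \<psi> t'" using ab b1 by (auto simp: Jl_J_Jr_def intro!: anti)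
      show "y \<in> closed_segment (average ?P J \<psi>) (LINT t|?P. \<psi> t)" using y(1) zJ by (simp add: x_def)
      show "y \<in> closure (inner_dom L)" "y \<notin> inner_dom L" using y by auto
      show "\<And>v. v \<in> closure (inner_dom L) \<Longrightarrow> tilt e N k y \<le> tilt e N k v" by (rule k(1))
      show "t0 \<in> Jr" "tilt e N k (\<psi> t0) < tilt e N k y" using t0r t0 by auto
    qed (use jensen in auto)
  next
    assume t0l: "t0 \<in> Jl"
    then have a0: "0 < a" by (simp add: Jl_J_Jr_def)
    have tm: "tilt (- e) N (- k) v = tilt e N k v" for v by (simp add: tilt_def)
    show False
    proof (rule no_interval_with_tail_below_support[OF prob_space_unit_interval L up _ _ _ \<psi>(1) sp sets(1,2,3)])
      show "norm (- e) = 1" "norm N = 1" "- e \<bullet> N = 0" using eN by auto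
      show "Jl \<inter> J = {}" "Jl \<inter> Jr = {}" "J \<inter> Jr = {}" using dj by auto
      show "AE t in ?P. t \<in> Jl \<union> J \<union> Jr" by (rule cover)
      show "0 < measure ?P J" by (rule mJ)
      show "average ?P J \<psi> \<in> inner_dom L" using zJ zI by simp
      show "\<psi> a \<in> fixed_boundary L" using \<psi>(2) ab by simp
      show "\<And>t. t \<in> Jl \<Longrightarrow> - e \<bullet> \<psi> t \<le> - e \<bullet> \<psi> a" using ab by (auto simp: Jl_J_Jr_def intro!: anti)
      show "\<And>t. t \<in> J \<Longrightarrow> - e \<bullet> \<psi> a \<le> - e \<bullet> \<psi> t" using ab a0 by (auto simp: Jl_J_Jr_def intro!: anti)
      show "\<And>t t'. t \<in> J \<Longrightarrow> t' \<in> Jr \<Longrightarrow> - e \<bullet> \<psi> t \<le> - e \<bullet> \<psi> t'" using ab a0 by (auto simp: Jl_J_Jr_def intro!: anti)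
      show "y \<in> closed_segment (average ?P J \<psi>) (LINT t|?P. \<psi> t)" using y(1) zJ by (simp add: x_def)
      show "y \<in> closure (inner_dom L)" "y \<notin> inner_dom L" using y by auto
      show "\<And>v. v \<in> closure (inner_dom L) \<Longrightarrow> tilt (- e) N (- k) y \<le> tilt (- e) N (- k) v" unfolding tm by (rule k(1))
      show "t0 \<in> Jl" "tilt (- e) N (- k) (\<psi> t0) < tilt (- e) N (- k) y" unfolding tm using t0l t0 by auto
    qed (use jensen in auto)
  qed
qed

text \<open>
  The end points of an interval do not affect averages, so open intervals represent all others.
\<close>

lemma interval_average_eq:
  assumes I: "is_interval I" "I \<subseteq> {0..1::real}" "0 < measure lebesgue I"
    and \<psi>: "integrable unit_interval (\<psi> :: real \<Rightarrow> real^2)"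
  obtains a b where "0 \<le> a" "a < b" "b \<le> 1" "average lebesgue I \<psi> = average unit_interval {a<..<b} \<psi>"
proof -
  have ne: "I \<noteq> {}" using I(3) by auto
  have bd: "bdd_below I" "bdd_above I" using I(2) by (auto intro: bdd_below_mono bdd_above_mono)
  define a b where "a = Inf I" "b = Sup I"
  have up: "I \<subseteq> {a..b}" using bd by (auto simp: a_b_def intro: cInf_lower cSup_upper)
  have lo: "{a<..<b} \<subseteq> I"
  proof
    fix t assume t: "t \<in> {a<..<b}"
    obtain u where u: "u \<in> I" "u < t" using t cInf_lessD[OF ne, of t] by (auto simp: a_b_def)
    obtain v where v: "v \<in> I" "t < v" using t less_cSupD[OF ne, of t] by (auto simp: a_b_def)
    show "t \<in> I" using I(1) u v by (meson is_interval_1 less_imp_le)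
  qed
  have a0: "0 \<le> a" "b \<le> 1" 
    unfolding a_b_def using I(2) by (intro cInf_greatest[OF ne] cSup_least[OF ne]; auto)+
  have Im: "I \<in> sets lebesgue" using I(3) measure_notin_sets by force
  have "AE t in lebesgue. t \<noteq> a \<and> t \<noteq> b"
    by (intro AE_conjI AE_completion AE_lborel_singleton)
  then have ae: "AE t in lebesgue. t \<in> I \<longleftrightarrow> t \<in> {a<..<b}"
    by eventually_elim (use up lo in force)
  have mI: "measure lebesgue I = measure lebesgue {a<..<b}"
    using ae Im by (intro measure_eq_AE) auto
  have ab: "a < b"
  proof (rule ccontr)
    assume "\<not> a < b"
    then show False using I(3) unfolding mI by simp
  qed
  have sub: "{a<..<b} \<subseteq> {0..1}" using a0 by auto
  have int01: "set_integrable lebesgue {0..1} \<psi>"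
    using \<psi> integrable_restrict_space[of "{0..1}" lebesgue \<psi>] by (simp add: set_integrable_def)
  have sI: "set_integrable lebesgue S \<psi>" if "S \<in> sets lebesgue" "S \<subseteq> {0..1}" for S
    using set_integrable_subset[OF int01 that] .
  have "(LINT t:I|lebesgue. \<psi> t) = (LINT t:{a<..<b}|lebesgue. \<psi> t)"
    unfolding set_lebesgue_integral_def
  proof (rule integral_cong_AE)
    show "AE t in lebesgue. indicator I t *\<^sub>R \<psi> t = indicator {a<..<b} t *\<^sub>R \<psi> t"
      using ae by eventually_elim (auto simp: indicator_def)
  qed (use sI[OF Im I(2)] sI[OF _ sub] in \<open>auto simp: set_integrable_def\<close>)
  also have "\<dots> = (LINT t:{a<..<b}|unit_interval. \<psi> t)"
    unfolding set_lebesgue_integral_def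
  proof (subst integral_restrict_space)
    show "(LINT t|lebesgue. indicator {a<..<b} t *\<^sub>R \<psi> t)
        = (LINT t|lebesgue. indicator {0..1} t *\<^sub>R indicator {a<..<b} t *\<^sub>R \<psi> t)"
      using sub by (intro Bochner_Integration.integral_cong) (auto simp: indicator_def)
  qed simp
  finally have "average lebesgue I \<psi> = average unit_interval {a<..<b} \<psi>"
    using mI measure_unit_interval[OF sub] by (simp add: average_def)
  then show thesis using that a0 ab by blast
qed

text \<open>
  The wedge inequalities are collected for \<open>e\<close> and for \<open>- e\<close>, since a bad value may occur in either tail.
  Both of their sides are determined by the distribution, so they pass from \<open>\<phi>\<close> to \<open>\<psi>\<close>.
\<close>

theorem rearrangement_in_alpha_extension:
  assumes L: "is_lens L" and E: "extension L L'" and M: "prob_space M"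
    and a: "0 < \<alpha>" "\<alpha> < 1" and ext: "alpha_extension \<alpha> L L'"
    and mart: "binary_alpha_martingale \<alpha> L M F \<phi>" and \<psi>: "monotonic_rearrangement L M \<phi> \<psi>"
  shows "\<psi> \<in> class_A L' {0..1}"
proof -
  interpret prob_space M by fact
  interpret U: prob_space unit_interval by (rule prob_space_unit_interval)
  have L': "is_lens L'" and sub: "region L \<subseteq> region L'" and fb: "fixed_boundary L' = fixed_boundary L"
    using E by (auto simp: extension_def)
  have F: "finite_filtration M F" and bin: "\<And>n \<omega>. \<omega> \<in> atoms M (F n) \<Longrightarrow> card (children M F n \<omega>) \<le> 2"
    and \<phi>: "integrable M \<phi>" "\<And>x. x \<in> space M \<Longrightarrow> \<phi> x \<in> fixed_boundary L"
      "\<And>n \<omega>. \<omega> \<in> atoms M (F n) \<Longrightarrow> average M \<omega> \<phi> \<in> region L"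
    and alph: "\<And>n \<omega> \<omega>' \<omega>''. \<omega> \<in> atoms M (F n) \<Longrightarrow> \<omega>' \<in> children M F n \<omega> \<Longrightarrow> \<omega>'' \<in> children M F n \<omega> \<Longrightarrow> \<omega>' \<noteq> \<omega>'' \<Longrightarrow>
      \<not> closed_segment (average M \<omega>'' \<phi>) (average M \<omega> \<phi>) \<subseteq> region L \<Longrightarrow>
      \<alpha> * norm (average M \<omega>' \<phi> - average M \<omega>'' \<phi>) \<le> norm (average M \<omega>' \<phi> - average M \<omega> \<phi>)"
    using mart by (auto simp: binary_alpha_martingale_def binary_filtration_def class_A_filtration_def)
  obtain e where e: "norm e = 1" "inj_on (\<lambda>x. e \<bullet> x) (fixed_boundary L)" "antimono_on {0<..<1} (\<lambda>t. e \<bullet> \<psi> t)"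
    and \<psi>b: "\<And>t. t \<in> {0..1} \<Longrightarrow> \<psi> t \<in> fixed_boundary L" and \<psi>m: "\<psi> \<in> borel_measurable unit_interval"
    and dist: "distr unit_interval borel \<psi> = distr M borel \<phi>"
    using \<psi> by (auto simp: monotonic_rearrangement_def)
  have \<phi>m: "\<phi> \<in> borel_measurable M" using \<phi>(1) by simp
  have \<psi>i: "integrable unit_interval \<psi>"
  proof -
    have "integrable (distr M borel \<phi>) (\<lambda>v. v)" using integrable_distr_eq[OF \<phi>m, of "\<lambda>v. v"] \<phi>(1) by simp
    then show ?thesis using integrable_distr_eq[OF \<psi>m, of "\<lambda>v. v"] unfolding dist[symmetric] by simp
  qed
  have transfer: "(LINT t|unit_interval. h (\<psi> t)) = (LINT x|M. h (\<phi> x))"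
    if "h \<in> borel_measurable borel" for h :: "real^2 \<Rightarrow> 'c::{banach, second_countable_topology}"
    using integral_distr[OF \<psi>m that] integral_distr[OF \<phi>m that] unfolding dist by simp
  have mean: "(LINT t|unit_interval. \<psi> t) = (LINT x|M. \<phi> x)" using transfer[of "\<lambda>v. v"] by simp
  obtain N where N: "norm N = 1" "e \<bullet> N = 0" "upward (outer L') N"
    using upward_direction_of_injective_projection[OF L' e(1)] e(2) fb by auto
  have seg: "closed_segment (average M \<omega>' \<phi>) (average M \<omega>'' \<phi>) \<subseteq> region L'"
    if om: "\<omega> \<in> atoms M (F n)" and c: "\<omega>' \<in> children M F n \<omega>" "\<omega>'' \<in> children M F n \<omega>" "\<omega>' \<noteq> \<omega>''" for n \<omega> \<omega>' \<omega>''
  proof -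
    note fa = finite_filtrationD(1)[OF F]
    let ?C = "children M F n \<omega>"
    have fin: "finite ?C" using finite_atoms[OF fa] by (simp add: children_def)
    have "card {\<omega>', \<omega>''} = card ?C"
      using card_mono[OF fin, of "{\<omega>', \<omega>''}"] bin[OF om] c by auto
    then have C: "?C = {\<omega>', \<omega>''}" using card_subset_eq[OF fin, of "{\<omega>', \<omega>''}"] c by auto
    have ca: "\<omega>' \<in> atoms M (F (Suc n))" "\<omega>'' \<in> atoms M (F (Suc n))" using c by (auto simp: children_def)
    obtain t where t: "0 < t" "t < 1"
      and av: "average M \<omega> \<phi> = (1 - t) *\<^sub>R average M \<omega>' \<phi> + t *\<^sub>R average M \<omega>'' \<phi>"
      using siblings_average[OF finite_measure_axioms F \<phi>(1) om C c(3)] by blast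
    show ?thesis
    proof (rule alpha_children_segment[OF L ext a \<phi>(3)[OF ca(1)] \<phi>(3)[OF ca(2)] \<phi>(3)[OF om] t(1,2) av _ _ sub])
      show "\<not> closed_segment (average M \<omega>'' \<phi>) (average M \<omega> \<phi>) \<subseteq> region L \<Longrightarrow>
        \<alpha> * norm (average M \<omega>' \<phi> - average M \<omega>'' \<phi>) \<le> norm (average M \<omega>' \<phi> - average M \<omega> \<phi>)"
        by (rule alph[OF om c(1,2,3)])
      show "\<not> closed_segment (average M \<omega>' \<phi>) (average M \<omega> \<phi>) \<subseteq> region L \<Longrightarrow>
        \<alpha> * norm (average M \<omega>'' \<phi> - average M \<omega>' \<phi>) \<le> norm (average M \<omega>'' \<phi> - average M \<omega> \<phi>)"
        by (rule alph[OF om c(2,1) c(3)[symmetric]])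
    qed
  qed
  have jens: "wedge e' N m w (LINT t|unit_interval. \<psi> t) \<le> (LINT t|unit_interval. wedge e' N m w (\<psi> t))"
    if e': "e' = e \<or> e' = - e" and w: "w \<in> closure (inner_dom L')" for e' w m
    unfolding mean transfer[OF wedge_measurable]
  proof (rule wedge_jensen[OF M F bin \<phi>(1) _ seg L' N(3) _ N(1) _ w])
    show "norm e' = 1" "e' \<bullet> N = 0" using e' e(1) N(2) by auto
    show "\<And>x. x \<in> space M \<Longrightarrow> \<phi> x \<in> fixed_boundary L'" using \<phi>(2) fb by simp
  qed
  have "space M \<in> atoms M (F 0)" using prob_space unfolding finite_filtrationD(3)[OF F] atoms_def by auto
  then have "(LINT x|M. \<phi> x) \<in> region L'"
    using \<phi>(3) average_whole_space[OF M \<phi>(1)] sub by fastforce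
  then have x: "(LINT t|unit_interval. \<psi> t) \<notin> inner_dom L'" using region_iff[OF L'] mean by simp
  have \<psi>b': "\<And>t. t \<in> {0..1} \<Longrightarrow> \<psi> t \<in> fixed_boundary L'" using \<psi>b fb by simp
  show ?thesis
    unfolding class_A_def
  proof (intro CollectI conjI ballI allI impI)
    show "set_integrable lebesgue {0..1} \<psi>"
      using \<psi>i integrable_restrict_space[of "{0..1}" lebesgue \<psi>] by (simp add: set_integrable_def)
    show "\<psi> t \<in> fixed_boundary L'" if "t \<in> {0..1}" for t using \<psi>b'[OF that] .
    fix I :: "real set" assume I: "is_interval I \<and> I \<subseteq> {0..1} \<and> 0 < measure lebesgue I"
    obtain s t where st: "0 \<le> s" "s < t" "t \<le> 1" and av: "average lebesgue I \<psi> = average unit_interval {s<..<t} \<psi>"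
      using interval_average_eq[OF _ _ _ \<psi>i, of I] I by blast
    have sub: "{s<..<t} \<subseteq> {0..1}" using st by auto
    have "average unit_interval {s<..<t} \<psi> \<notin> inner_dom L'"
      by (rule interval_average_avoids_inner[OF L' N(3) e(1) N(1,2) \<psi>i \<psi>b' e(3) jens x st])
    moreover have "average unit_interval {s<..<t} \<psi> \<in> closure (outer L')"
    proof (rule average_in_closed_convex[OF U.finite_measure_axioms])
      show sm: "{s<..<t} \<in> sets unit_interval" using sub by (intro sets_unit_interval) auto
      show "0 < measure unit_interval {s<..<t}"
        using st by (simp add: measure_unit_interval[OF sub] measure_lebesgue_greaterThanLessThan)
      show "set_integrable unit_interval {s<..<t} \<psi>" unfolding set_integrable_def by (rule integrable_mult_indicator[OF sm \<psi>i])
      show "convex (closure (outer L'))" using is_lensD(4)[OF L'] by (rule convex_closure)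
      show "\<And>x. x \<in> {s<..<t} \<Longrightarrow> \<psi> x \<in> closure (outer L')" using \<psi>b' sub fixed_boundary_iff[OF L'] by blast
    qed simp
    ultimately show "average lebesgue I \<psi> \<in> region L'" unfolding av using region_iff[OF L'] by blast
  qed
qed

section \<open>Refining a filtration to a binary one\<close>

text \<open>
  The algebra generated by the algebra \<open>\<A>\<close> and the set \<open>B\<close>. It splits each atom in at most two parts.
\<close>

definition refine :: "'a set set \<Rightarrow> 'a set \<Rightarrow> 'a set set" where
  "refine \<A> B = {(A1 \<inter> B) \<union> (A2 - B) | A1 A2. A1 \<in> \<A> \<and> A2 \<in> \<A>}"

lemma finite_subalgebra_refine:
  assumes A: "finite_subalgebra M \<A>" and B: "B \<in> sets M"
  shows "finite_subalgebra M (refine \<A> B)"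
proof -
  interpret algebra "space M" \<A> using A by (simp add: finite_subalgebra_def)
  have sp: "\<A> \<subseteq> Pow (space M)" by (rule space_closed)
  have Bs: "B \<subseteq> space M" using sets.sets_into_space[OF B] .
  have "algebra (space M) (refine \<A> B)"
    unfolding algebra_iff_Un
  proof (intro conjI ballI)
    show "refine \<A> B \<subseteq> Pow (space M)" using sp by (auto simp: refine_def)
    show "{} \<in> refine \<A> B" unfolding refine_def by blast
    show "space M - X \<in> refine \<A> B" if X: "X \<in> refine \<A> B" for X
    proof -
      obtain A1 A2 where a: "X = (A1 \<inter> B) \<union> (A2 - B)" "A1 \<in> \<A>" "A2 \<in> \<A>" using X by (auto simp: refine_def)
      have "space M - X = ((space M - A1) \<inter> B) \<union> ((space M - A2) - B)" using Bs by (auto simp: a(1))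
      then show ?thesis using a unfolding refine_def by blast
    qed
    show "X \<union> Y \<in> refine \<A> B" if X: "X \<in> refine \<A> B" and Y: "Y \<in> refine \<A> B" for X Y
    proof -
      obtain A1 A2 where a: "X = (A1 \<inter> B) \<union> (A2 - B)" "A1 \<in> \<A>" "A2 \<in> \<A>" using X by (auto simp: refine_def)
      obtain B1 B2 where b: "Y = (B1 \<inter> B) \<union> (B2 - B)" "B1 \<in> \<A>" "B2 \<in> \<A>" using Y by (auto simp: refine_def)
      have "X \<union> Y = ((A1 \<union> B1) \<inter> B) \<union> ((A2 \<union> B2) - B)" by (auto simp: a(1) b(1))
      then show ?thesis using a b unfolding refine_def by blast
    qed
  qed
  moreover have "refine \<A> B = (\<lambda>(A1, A2). (A1 \<inter> B) \<union> (A2 - B)) ` (\<A> \<times> \<A>)" by (auto simp: refine_def)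
  then have "finite (refine \<A> B)" using A by (simp add: finite_subalgebra_def)
  moreover have "refine \<A> B \<subseteq> sets M" using A B by (auto simp: refine_def finite_subalgebra_def)
  ultimately show ?thesis by (simp add: finite_subalgebra_def)
qed

lemma refine_contains:
  assumes A: "finite_subalgebra M \<A>" and B: "B \<in> sets M"
  shows "\<A> \<subseteq> refine \<A> B" "B \<in> refine \<A> B"
proof -
  interpret algebra "space M" \<A> using A by (simp add: finite_subalgebra_def)
  have "X = (X \<inter> B) \<union> (X - B)" for X by auto
  then show "\<A> \<subseteq> refine \<A> B" unfolding refine_def by blast
  have "B = (space M \<inter> B) \<union> ({} - B)" using sets.sets_into_space[OF B] by auto
  then show "B \<in> refine \<A> B" unfolding refine_def by blast
qed

lemma refine_least:
  assumes "finite_subalgebra M \<C>" "\<A> \<subseteq> \<C>" "B \<in> \<C>"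
  shows "refine \<A> B \<subseteq> \<C>"
proof -
  interpret algebra "space M" \<C> using assms by (simp add: finite_subalgebra_def)
  show ?thesis using assms by (auto simp: refine_def)
qed

lemma atoms_refine:
  assumes A: "finite_subalgebra M \<A>" and w: "\<omega> \<in> atoms M \<A>" and w': "\<omega>' \<in> atoms M (refine \<A> B)" "\<omega>' \<subseteq> \<omega>"
    and B: "B \<in> sets M"
  shows "\<omega>' = \<omega> \<inter> B \<or> \<omega>' = \<omega> - B"
proof -
  obtain A1 A2 where a: "\<omega>' = (A1 \<inter> B) \<union> (A2 - B)" "A1 \<in> \<A>" "A2 \<in> \<A>"
    using w'(1) by (auto simp: atoms_def refine_def)
  have ne: "\<omega>' \<noteq> {}" using w'(1) by (auto simp: atoms_def)
  have "\<omega>' \<subseteq> B \<or> \<omega>' \<inter> B = {}"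
    using atom_inside_or_disjoint[OF finite_subalgebra_refine[OF A B] w'(1) refine_contains(2)[OF A B]] .
  then show ?thesis
  proof
    assume "\<omega>' \<subseteq> B"
    then have "\<omega>' = A1 \<inter> B" using a(1) by blast
    then show ?thesis using atom_inside_or_disjoint[OF A w a(2)] ne w'(2) by blast
  next
    assume "\<omega>' \<inter> B = {}"
    then have "\<omega>' = A2 - B" using a(1) by blast
    then show ?thesis using atom_inside_or_disjoint[OF A w a(3)] ne w'(2) by blast
  qed
qed

text \<open>
  This turns consecutive blocks into a single sequence, along which the refinement can be defined by
  recursion; the block \<open>xs k\<close> begins at position \<open>m k\<close>.
\<close>

lemma concatenated_sequence:
  fixes xs :: "nat \<Rightarrow> 'a list"
  assumes ne: "\<And>k. xs k \<noteq> []"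
  obtains m C where "strict_mono m" "m 0 = (0::nat)" "\<And>k. m (Suc k) = m k + length (xs k)"
    "\<And>k i. i < length (xs k) \<Longrightarrow> C (m k + i) = xs k ! i"
    "\<And>j. \<exists>k i. j = m k + i \<and> i < length (xs k)"
proof -
  define m where "m k = (\<Sum>i<k. length (xs i))" for k
  have m0: "m 0 = 0" and mS: "m (Suc k) = m k + length (xs k)" for k by (simp_all add: m_def)
  have sm: "strict_mono m" unfolding strict_mono_Suc_iff mS using ne by simp
  define K where "K j = (LEAST k. j < m (Suc k))" for j
  define C where "C j = xs (K j) ! (j - m (K j))" for j
  have K: "K (m k + i) = k" if "i < length (xs k)" for k i
    unfolding K_def
  proof (rule Least_equality)
    show "m k + i < m (Suc k)" using that by (simp add: mS)
    fix k' assume "m k + i < m (Suc k')"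
    then have "m k < m (Suc k')" by simp
    then show "k \<le> k'" using strict_mono_less[OF sm] by simp
  qed
  have "C (m k + i) = xs k ! i" if "i < length (xs k)" for k i using K[OF that] by (simp add: C_def)
  moreover have "\<exists>k i. j = m k + i \<and> i < length (xs k)" for j
  proof -
    have "j < m (Suc j)" using strict_mono_imp_increasing[OF sm, of "Suc j"] by simp
    then have lt: "j < m (Suc (K j))" unfolding K_def by (rule LeastI)
    have "m (K j) \<le> j"
    proof (cases "K j")
      case 0
      then show ?thesis by (simp add: m0)
    next
      case (Suc k)
      then show ?thesis using not_less_Least[of k "\<lambda>k. j < m (Suc k)"] by (simp add: K_def)
    qed
    then show ?thesis using lt by (intro exI[of _ "K j"] exI[of _ "j - m (K j)"]) (simp add: mS)
  qed
  ultimately show thesis using that[OF sm m0 mS] by blast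
qed

text \<open>
  Between \<open>F k\<close> and \<open>F (Suc k)\<close> all members of the larger algebra are added one at a time, which ends
  with the larger algebra itself. The order is free, so that a prescribed set \<open>W\<close> can be added first.
\<close>

lemma binary_refinement_exists:
  assumes F: "finite_filtration M F" and W: "W \<in> F (Suc n0)"
  obtains G m where "binary_filtration M G" "strict_mono m" "\<And>k. G (m k) = F k"
    "G (Suc (m n0)) = refine (F n0) W"
proof -
  note fa = finite_filtrationD(1)[OF F]
  note Fs = finite_filtrationD(4)[OF F]
  have Fmono: "F k \<subseteq> F (Suc k)" for k using monoD[OF finite_filtrationD(2)[OF F], of k "Suc k"] by simp
  have "\<exists>l. set l = F (Suc k) \<and> l \<noteq> [] \<and> (k = n0 \<longrightarrow> hd l = W)" for k
  proof -
    interpret algebra "space M" "F (Suc k)" using fa by (simp add: finite_subalgebra_def)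
    have "finite (F (Suc k))" using fa by (simp add: finite_subalgebra_def)
    then obtain l where l: "set l = F (Suc k)" using finite_list by blast
    have "{} \<in> F (Suc k)" by (rule empty_sets)
    then have "l \<noteq> []" using l by auto
    moreover have "set (W # l) = F (Suc k)" if "k = n0" using l W that by (simp add: insert_absorb)
    ultimately show ?thesis using l by (metis list.distinct(1) list.sel(1))
  qed
  then obtain xs where xs: "\<And>k. set (xs k) = F (Suc k)" "\<And>k. xs k \<noteq> []" "hd (xs n0) = W" by metis
  obtain m C where m: "strict_mono m" "m 0 = (0::nat)" "\<And>k. m (Suc k) = m k + length (xs k)"
    and C: "\<And>k i. i < length (xs k) \<Longrightarrow> C (m k + i) = xs k ! i"
    and blk: "\<And>j. \<exists>k i. j = m k + i \<and> i < length (xs k)"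
    by (rule concatenated_sequence[of xs, OF xs(2)]) (rule that, assumption+)
  define G where "G = rec_nat (F 0) (\<lambda>j A. refine A (C j))"
  have G0: "G 0 = F 0" and GS: "G (Suc j) = refine (G j) (C j)" for j by (simp_all add: G_def)
  have Cs: "C j \<in> sets M" for j
  proof -
    obtain k i where ki: "j = m k + i" "i < length (xs k)" using blk by blast
    then have "C j \<in> set (xs k)" using C by simp
    then show ?thesis using xs(1) Fs by blast
  qed
  have Gf: "finite_subalgebra M (G j)" for j
    by (induction j) (simp_all add: G0 GS fa finite_subalgebra_refine Cs)
  have Gm: "G j \<subseteq> G (Suc j)" for j unfolding GS by (rule refine_contains(1)[OF Gf Cs])
  have Gk: "G (m k) = F k" for k
  proof (induction k)
    case 0
    then show ?case by (simp add: m G0)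
  next
    case (Suc k)
    have "i \<le> length (xs k) \<Longrightarrow> set (take i (xs k)) \<subseteq> G (m k + i) \<and> G (m k + i) \<subseteq> F (Suc k)" for i
    proof (induction i)
      case 0
      then show ?case using Suc Fmono by simp
    next
      case (Suc i)
      then have i: "i < length (xs k)" by simp
      have IH: "set (take i (xs k)) \<subseteq> G (m k + i)" "G (m k + i) \<subseteq> F (Suc k)" using Suc by auto
      have Ci: "C (m k + i) = xs k ! i" using C[OF i] .
      have "set (take (Suc i) (xs k)) = insert (xs k ! i) (set (take i (xs k)))"
        using i by (simp add: take_Suc_conv_app_nth)
      moreover have "xs k ! i \<in> G (Suc (m k + i))" unfolding GS using refine_contains(2)[OF Gf Cs, of "m k + i" "m k + i"] Ci by simp
      moreover have "G (Suc (m k + i)) \<subseteq> F (Suc k)"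
        unfolding GS Ci by (rule refine_least[OF fa IH(2)]) (use i xs(1) nth_mem in blast)
      ultimately show ?case using IH(1) Gm[of "m k + i"] by auto
    qed
    from this[of "length (xs k)"] show ?case by (auto simp: m xs(1))
  qed
  have Gmono: "mono G" unfolding mono_iff_le_Suc using Gm by simp
  have ff: "finite_filtration M G"
    unfolding finite_filtration_def
  proof (intro conjI allI ballI)
    show "algebra (space M) (G n)" "finite (G n)" "G n \<subseteq> sets M" for n using Gf by (auto simp: finite_subalgebra_def)
    show "mono G" by (rule Gmono)
    show "G 0 = {{}, space M}" using G0 finite_filtrationD(3)[OF F] by simp
    fix A assume "A \<in> sets M"
    then obtain B where B: "B \<in> sigma_sets (space M) (\<Union>n. F n)" "sym_diff A B \<in> null_sets M"
      using F by (auto simp: finite_filtration_def)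
    have "(\<Union>n. F n) \<subseteq> (\<Union>n. G n)" using Gk by blast
    then have "sigma_sets (space M) (\<Union>n. F n) \<subseteq> sigma_sets (space M) (\<Union>n. G n)" by (rule sigma_sets_mono')
    then show "\<exists>B\<in>sigma_sets (space M) (\<Union>n. G n). sym_diff A B \<in> null_sets M" using B by blast
  qed
  have "card (children M G n \<omega>) \<le> 2" if w: "\<omega> \<in> atoms M (G n)" for n \<omega>
  proof -
    have "children M G n \<omega> \<subseteq> {\<omega> \<inter> C n, \<omega> - C n}"
      using atoms_refine[OF Gf w _ _ Cs] by (auto simp: children_def GS)
    then have "card (children M G n \<omega>) \<le> card {\<omega> \<inter> C n, \<omega> - C n}" by (intro card_mono) auto
    also have "\<dots> \<le> 2" by (simp add: card_insert_if)
    finally show ?thesis .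
  qed
  then have bin: "binary_filtration M G" using ff by (simp add: binary_filtration_def)
  have "C (m n0 + 0) = W" using C[of 0 n0] xs(2)[of n0] xs(3) by (simp add: hd_conv_nth)
  then have "G (Suc (m n0)) = refine (F n0) W" using Gk GS[of "m n0"] by simp
  then show thesis using that[OF bin m(1) Gk] by blast
qed

section \<open>Functions with three values\<close>

text \<open>
  In the unit interval the measure of \<open>B \<inter> {0..t}\<close> depends continuously on \<open>t\<close>. The set found there
  is pulled back to the completion, and its part in the original sigma-algebra has the same measure.
\<close>

lemma standard_prob_space_subset_of_measure:
  assumes M: "standard_prob_space M" and A: "A \<in> sets M" and c: "0 \<le> c" "c \<le> measure M A"
  obtains D where "D \<in> sets M" "D \<subseteq> A" "measure M D = c"
proof -
  interpret prob_space M using M by (simp add: standard_prob_space_def)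
  let ?M = "completion M" and ?N = "lebesgue_on {0..1::real}"
  have iso: "isomorphic_mod_0 ?M ?N" using M by (simp add: standard_prob_space_def)
  obtain S T f where S: "S \<in> sets ?M" and "T \<in> sets ?N" and all:
      "space ?M - S \<in> null_sets ?M \<and> space ?N - T \<in> null_sets ?N \<and> bij_betw f S T \<and>
       (\<forall>A. A \<subseteq> S \<longrightarrow> (A \<in> sets ?M \<longleftrightarrow> f ` A \<in> sets ?N)) \<and>
       (\<forall>A\<in>sets ?M. A \<subseteq> S \<longrightarrow> emeasure ?N (f ` A) = emeasure ?M A)"
    using iso unfolding isomorphic_mod_0_def by (elim bexE exE) rule
  have Snull: "space ?M - S \<in> null_sets ?M" using all by (rule conjunct1)
  have fs: "A \<in> sets ?M \<longleftrightarrow> f ` A \<in> sets ?N" if "A \<subseteq> S" for A using all that by meson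
  have fe: "emeasure ?N (f ` A) = emeasure ?M A" if "A \<in> sets ?M" "A \<subseteq> S" for A using all that by meson
  have AM: "A \<in> sets ?M" using A by simp
  have AS: "A \<inter> S \<in> sets ?M" using AM S by blast
  define B where "B = f ` (A \<inter> S)"
  have BN: "B \<in> sets ?N" using fs[of "A \<inter> S"] AS by (simp add: B_def)
  then have B: "B \<in> sets lebesgue" "B \<subseteq> {0..1}" by (auto simp: sets_restrict_space_iff)
  have "emeasure ?M (A \<inter> S) = emeasure ?M A"
  proof (rule emeasure_eq_AE[OF _ AS AM])
    have "AE x in ?M. x \<notin> space ?M - S" by (rule AE_not_in[OF Snull])
    then show "AE x in ?M. x \<in> A \<inter> S \<longleftrightarrow> x \<in> A" using AE_space by eventually_elim auto
  qed
  then have eB: "emeasure ?N B = emeasure M A"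
    using fe[OF AS] A by (simp add: B_def)
  have fin: "emeasure lebesgue (B \<inter> {0..t}) \<noteq> \<infinity>" for t
  proof -
    have "emeasure lebesgue (B \<inter> {0..t}) \<le> emeasure lebesgue {0..1::real}" using B by (intro emeasure_mono) auto
    then show ?thesis by (auto simp: top_unique)
  qed
  define h where "h t = measure lebesgue (B \<inter> {0..t})" for t
  have hdiff: "0 \<le> h t - h s \<and> h t - h s \<le> t - s" if st: "s \<le> t" for s t
  proof -
    have lm: "B \<inter> {0..s} \<in> lmeasurable" "B \<inter> {0..t} \<in> lmeasurable"
      using B fin by (auto simp: fmeasurable_def top.not_eq_extremum)
    have "h t - h s = measure lebesgue (B \<inter> {0..t} - B \<inter> {0..s})"
      unfolding h_def using st lm by (intro measurable_measure_Diff[symmetric]) (auto simp: fmeasurable_def)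
    also have "\<dots> \<le> measure lebesgue {s..t}" using lm B st by (intro measure_mono_fmeasurable) auto
    finally have "h t - h s \<le> t - s" using st by simp
    moreover have "h s \<le> h t" unfolding h_def using st lm by (intro measure_mono_fmeasurable) auto
    ultimately show ?thesis by simp
  qed
  have "continuous_on {0..1} h"
  proof (rule lipschitz_on_continuous_on, rule lipschitz_onI)
    show "dist (h x) (h y) \<le> 1 * dist x y" for x y
      using hdiff[of x y] hdiff[of y x] by (cases "x \<le> y") (auto simp: dist_real_def)
  qed simp
  moreover have "h 0 = 0"
  proof -
    have "B \<inter> {0..0} = {} \<or> B \<inter> {0..0} = {0}" by auto
    then have "emeasure lebesgue (B \<inter> {0..0}) = 0" by (elim disjE) (simp_all only:, simp_all)
    then show ?thesis by (simp add: h_def measure_def)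
  qed
  moreover have "h 1 = measure M A"
  proof -
    have "B \<inter> {0..1} = B" using B by blast
    moreover have "measure lebesgue B = measure ?N B" using B by (simp add: measure_restrict_space)
    ultimately show ?thesis using eB by (simp add: h_def measure_def)
  qed
  ultimately obtain t where t: "0 \<le> t" "t \<le> 1" "h t = c" using IVT'[of h 0 c 1] c by auto
  define E where "E = {x \<in> A \<inter> S. f x \<in> {0..t}}"
  have fE: "f ` E = B \<inter> {0..t}" by (auto simp: E_def B_def)
  have ES: "E \<subseteq> S" "E \<subseteq> A" by (auto simp: E_def)
  have "f ` E \<in> sets ?N" unfolding fE using B by (auto simp: sets_restrict_space_iff)
  then have EM: "E \<in> sets ?M" using fs[OF ES(1)] by simp
  have "emeasure M (main_part M E) = emeasure ?M E" using EM by simp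
  also have "\<dots> = emeasure ?N (B \<inter> {0..t})" using fe[OF EM ES(1)] fE by simp
  also have "\<dots> = emeasure lebesgue (B \<inter> {0..t})" using B by (intro emeasure_restrict_space) auto
  finally have "measure M (main_part M E) = c" using t(3) by (simp add: h_def measure_def)
  moreover have "main_part M E \<subseteq> A" using main_part_null_part_Un[OF EM] ES(2) by blast
  moreover have "main_part M E \<in> sets M" using EM by simp
  ultimately show thesis using that by blast
qed

definition three_valued :: "'a set \<Rightarrow> 'a set \<Rightarrow> 'b \<Rightarrow> 'b \<Rightarrow> 'b \<Rightarrow> 'a \<Rightarrow> 'b" where
  "three_valued D W p q y x = (if x \<in> D then p else if x \<in> W then q else y)"

lemma three_valued_expand:
  fixes p q y :: "'b::real_vector"
  assumes "D \<subseteq> W"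
  shows "indicator \<sigma> x *\<^sub>R three_valued D W p q y x
    = indicator (\<sigma> \<inter> D) x *\<^sub>R p + indicator (\<sigma> \<inter> (W - D)) x *\<^sub>R q + indicator (\<sigma> - W) x *\<^sub>R y"
  using assms by (auto simp: three_valued_def indicator_def)

lemma set_integral_three_valued:
  fixes p q y :: "'b::euclidean_space"
  assumes D: "D \<in> sets M" "W \<in> sets M" "D \<subseteq> W" and s: "\<sigma> \<in> sets M" "emeasure M \<sigma> < \<infinity>"
  shows "set_integrable M \<sigma> (three_valued D W p q y)"
    and "(LINT x:\<sigma>|M. three_valued D W p q y x)
      = measure M (\<sigma> \<inter> D) *\<^sub>R p + measure M (\<sigma> \<inter> (W - D)) *\<^sub>R q + measure M (\<sigma> - W) *\<^sub>R y"
proof -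
  have fin: "emeasure M X < \<infinity>" if "X \<subseteq> \<sigma>" for X
    using emeasure_mono[OF that s(1)] s(2) by (rule le_less_trans)
  have i: "integrable M (\<lambda>x. indicator X x *\<^sub>R (v::'b))" "(LINT x|M. indicator X x *\<^sub>R v) = measure M X *\<^sub>R v"
    if "X \<in> sets M" "X \<subseteq> \<sigma>" for X v
    using that fin[OF that(2)] by (auto intro!: integrable_scaleR_left simp: integrable_indicator_iff Int_absorb2 sets.sets_into_space)
  note ii = i[of "\<sigma> \<inter> D"] i[of "\<sigma> \<inter> (W - D)"] i[of "\<sigma> - W"]
  show "set_integrable M \<sigma> (three_valued D W p q y)"
    unfolding set_integrable_def three_valued_expand[OF D(3)]
    using D s by (intro Bochner_Integration.integrable_add ii) auto
  show "(LINT x:\<sigma>|M. three_valued D W p q y x)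
      = measure M (\<sigma> \<inter> D) *\<^sub>R p + measure M (\<sigma> \<inter> (W - D)) *\<^sub>R q + measure M (\<sigma> - W) *\<^sub>R y"
  proof -
    have m: "\<sigma> \<inter> D \<in> sets M" "\<sigma> \<inter> (W - D) \<in> sets M" "\<sigma> - W \<in> sets M" using D s by auto
    show ?thesis unfolding set_lebesgue_integral_def three_valued_expand[OF D(3)]
      using i[OF m(1)] i[OF m(2)] i[OF m(3)]
      by (subst Bochner_Integration.integral_add Bochner_Integration.integrable_add, blast?)+ auto
  qed
qed

lemma emeasure_distr_three_valued:
  fixes p q y :: "'b::euclidean_space"
  assumes D: "D \<in> sets M" "W \<in> sets M" "D \<subseteq> W" and X: "X \<in> sets borel"
  shows "emeasure (distr M borel (three_valued D W p q y)) X
      = emeasure M D * indicator X p + emeasure M (W - D) * indicator X q + emeasure M (space M - W) * indicator X y"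
proof -
  have me: "three_valued D W p q y \<in> borel_measurable M"
    unfolding three_valued_def using D by measurable
  have sp: "D \<subseteq> space M" "W \<subseteq> space M" using D sets.sets_into_space by auto
  have "emeasure (distr M borel (three_valued D W p q y)) X = (\<integral>\<^sup>+x. indicator X (three_valued D W p q y x) \<partial>M)"
    using X me nn_integral_indicator[of X "distr M borel (three_valued D W p q y)"]
    by (subst nn_integral_distr[symmetric]) auto
  also have "\<dots> = (\<integral>\<^sup>+x. indicator D x * indicator X p + indicator (W - D) x * indicator X q
      + indicator (space M - W) x * indicator X y \<partial>M)"
    using D(3) sp by (intro nn_integral_cong) (auto simp: three_valued_def indicator_def)
  also have "\<dots> = emeasure M D * indicator X p + emeasure M (W - D) * indicator X q + emeasure M (space M - W) * indicator X y"
    using D by (simp add: nn_integral_add nn_integral_multc)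
  finally show ?thesis .
qed

lemma three_valued_measurable:
  fixes p q y :: "'b::euclidean_space"
  assumes "D \<in> sets M" "W \<in> sets M"
  shows "three_valued D W p q y \<in> borel_measurable M"
  unfolding three_valued_def using assms by measurable

lemma measure_lebesgue_atLeastLessThan: "a \<le> b \<Longrightarrow> measure lebesgue {a..<b::real} = b - a"
  by (simp add: measure_def)

section \<open>The two implications\<close>

lemma weighted_average_in_segment:
  fixes x y :: "real^2"
  assumes b: "0 \<le> \<beta>" "\<beta> \<le> \<alpha>" "0 < \<alpha>"
  shows "\<beta> *\<^sub>R x + (1 - \<beta>) *\<^sub>R y \<in> closed_segment (\<alpha> *\<^sub>R x + (1 - \<alpha>) *\<^sub>R y) y"
proof -
  define r where "r = \<beta> / \<alpha>"
  have r: "0 \<le> r" "r \<le> 1" "r * \<alpha> = \<beta>" using b by (auto simp: r_def)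
  have "\<beta> *\<^sub>R x + (1 - \<beta>) *\<^sub>R y = (1 - (1 - r)) *\<^sub>R (\<alpha> *\<^sub>R x + (1 - \<alpha>) *\<^sub>R y) + (1 - r) *\<^sub>R y"
    unfolding r(3)[symmetric] by (simp add: algebra_simps)
  then show ?thesis unfolding in_segment using r by (intro exI[of _ "1 - r"]) auto
qed

text \<open>
  Up to the level of \<open>\<omega>\<close> an atom contains \<open>\<omega>\<close> or is disjoint from it, so its average is a
  combination of \<open>x\<close> and \<open>y\<close> in which \<open>x\<close> has at most the weight \<open>\<alpha>\<close>. From the next level of the refinement on, an atom is contained in \<open>W\<close> or
  disjoint from it, so its average lies in \<open>[p, q]\<close> or is \<open>y\<close>. In between, \<open>\<omega>\<close> is split into \<open>W\<close> and
  \<open>\<omega> - W\<close> with averages \<open>x\<close> and \<open>y\<close>. The two values on \<open>W\<close> need the right proportion on \<open>W\<close> only, not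
  on the atoms inside \<open>W\<close>, because \<open>W\<close> is an atom of the refined filtration.
\<close>

lemma one_jump_alpha_martingale:
  assumes L: "is_lens L" and M: "standard_prob_space M" and F: "finite_filtration M F"
    and a: "0 < \<alpha>" "\<alpha> < 1"
    and om: "\<omega> \<in> atoms M (F n0)" and W: "W \<in> F (Suc n0)" "W \<subseteq> \<omega>" "measure M W = \<alpha> * measure M \<omega>"
    and D: "D \<in> sets M" "D \<subseteq> W" "measure M D = l * measure M W"
    and pqy: "p \<in> fixed_boundary L" "q \<in> fixed_boundary L" "y \<in> fixed_boundary L"
    and x: "x = l *\<^sub>R p + (1 - l) *\<^sub>R q"
    and pq: "closed_segment p q \<subseteq> region L" and zy: "closed_segment (\<alpha> *\<^sub>R x + (1 - \<alpha>) *\<^sub>R y) y \<subseteq> region L"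
  shows "three_valued D W p q y \<in> class_A_filtration L M F"
    and "alpha_martingale \<alpha> L M F (three_valued D W p q y)"
proof -
  interpret prob_space M using M by (simp add: standard_prob_space_def)
  let ?f = "three_valued D W p q y"
  let ?z = "\<alpha> *\<^sub>R x + (1 - \<alpha>) *\<^sub>R y"
  note fa = finite_filtrationD(1)[OF F]
  have Ws: "W \<in> sets M" using W(1) finite_filtrationD(4)[OF F] by blast
  have mom: "0 < measure M \<omega>" using atom_sets(3)[OF fa om] .
  have mW: "0 < measure M W" using mom a W(3) by simp
  have mWD: "measure M (W - D) = (1 - l) * measure M W"
    using finite_measure_Diff[OF Ws D(1,2)] D(3) by (simp add: algebra_simps)
  obtain G m where G: "binary_filtration M G" and m: "strict_mono m" and Gm: "\<And>k. G (m k) = F k"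
    and GW: "G (Suc (m n0)) = refine (F n0) W"
    using binary_refinement_exists[OF F W(1)] by blast
  have Gf: "finite_filtration M G" using G by (simp add: binary_filtration_def)
  note ga = finite_filtrationD(1)[OF Gf]
  have Gmono: "G i \<subseteq> G j" if "i \<le> j" for i j using monoD[OF finite_filtrationD(2)[OF Gf] that] .
  have int: "(LINT u:\<sigma>|M. ?f u) = measure M (\<sigma> \<inter> D) *\<^sub>R p + measure M (\<sigma> \<inter> (W - D)) *\<^sub>R q + measure M (\<sigma> - W) *\<^sub>R y"
    if "\<sigma> \<in> sets M" for \<sigma>
    using that by (intro set_integral_three_valued(2)[OF D(1) Ws D(2)]) (auto simp: emeasure_eq_measure)
  have av: "average M \<sigma> ?f = (measure M (\<sigma> \<inter> D) / measure M \<sigma>) *\<^sub>R p + (measure M (\<sigma> \<inter> (W - D)) / measure M \<sigma>) *\<^sub>R q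
      + (measure M (\<sigma> - W) / measure M \<sigma>) *\<^sub>R y" if "\<sigma> \<in> sets M" for \<sigma>
    unfolding average_def int[OF that] by (simp add: scaleR_add_right)
  have off: "average M \<sigma> ?f = y" if s: "\<sigma> \<in> sets M" "0 < measure M \<sigma>" "\<sigma> \<inter> W = {}" for \<sigma>
  proof -
    have "\<sigma> \<inter> D = {}" "\<sigma> \<inter> (W - D) = {}" "\<sigma> - W = \<sigma>" using s D by auto
    then show ?thesis using av[OF s(1)] s(2) by simp
  qed
  have inside: "average M \<sigma> ?f \<in> closed_segment p q" if s: "\<sigma> \<in> sets M" "0 < measure M \<sigma>" "\<sigma> \<subseteq> W" for \<sigma>
  proof -
    have e: "\<sigma> \<inter> (W - D) = \<sigma> - D" "\<sigma> - W = {}" using s by auto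
    have "measure M \<sigma> = measure M (\<sigma> \<inter> D) + measure M (\<sigma> - D)"
      using finite_measure_Diff'[OF s(1) D(1)] by simp
    then have "measure M (\<sigma> \<inter> D) / measure M \<sigma> = 1 - measure M (\<sigma> - D) / measure M \<sigma>" using s(2) by (simp add: field_simps)
    then have "average M \<sigma> ?f = (1 - measure M (\<sigma> - D) / measure M \<sigma>) *\<^sub>R p + (measure M (\<sigma> - D) / measure M \<sigma>) *\<^sub>R q"
      using av[OF s(1)] e by simp
    moreover have "measure M (\<sigma> - D) / measure M \<sigma> \<le> 1" using s D finite_measure_mono[of "\<sigma> - D" \<sigma>] by simp
    ultimately show ?thesis unfolding in_segment by (intro exI[of _ "measure M (\<sigma> - D) / measure M \<sigma>"]) simp
  qed
  have around: "average M \<sigma> ?f = (measure M W / measure M \<sigma>) *\<^sub>R x + (1 - measure M W / measure M \<sigma>) *\<^sub>R y"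
    if s: "\<sigma> \<in> sets M" "0 < measure M \<sigma>" "W \<subseteq> \<sigma>" for \<sigma>
  proof -
    have e: "\<sigma> \<inter> D = D" "\<sigma> \<inter> (W - D) = W - D" using s D by auto
    have "measure M (\<sigma> - W) / measure M \<sigma> = 1 - measure M W / measure M \<sigma>"
      using finite_measure_Diff[OF s(1) Ws s(3)] s(2) by (simp add: diff_divide_distrib)
    then have "average M \<sigma> ?f = (l * measure M W / measure M \<sigma>) *\<^sub>R p
        + ((1 - l) * measure M W / measure M \<sigma>) *\<^sub>R q + (1 - measure M W / measure M \<sigma>) *\<^sub>R y"
      unfolding av[OF s(1)] e D(3) mWD by simp
    then show ?thesis by (simp add: x scaleR_add_right mult.commute)
  qed
  \<comment> \<open>up to the level of \<open>\<omega>\<close> an atom contains \<open>\<omega>\<close> or misses it\<close>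
  have early: "average M \<sigma> ?f \<in> closed_segment ?z y" if s: "\<sigma> \<in> atoms M (G j)" and j: "j \<le> m n0" for \<sigma> j
  proof -
    note ss = atom_sets[OF ga s]
    have "\<sigma> \<in> F n0" using ss(2) Gmono[OF j] Gm by blast
    then consider "\<omega> \<subseteq> \<sigma>" | "\<omega> \<inter> \<sigma> = {}" using atom_inside_or_disjoint[OF fa om] by blast
    then show ?thesis
    proof cases
      case 1
      have "\<alpha> * measure M \<omega> \<le> \<alpha> * measure M \<sigma>" using finite_measure_mono[OF 1 ss(1)] a by simp
      then have "measure M W / measure M \<sigma> \<le> \<alpha>" using ss(3) W(3) by (simp add: divide_le_eq)
      then show ?thesis
        using around[OF ss(1,3)] 1 W(2) weighted_average_in_segment[of "measure M W / measure M \<sigma>" \<alpha> x y] a by simp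
    next
      case 2
      then have "\<sigma> \<inter> W = {}" using W(2) by blast
      then show ?thesis using off[OF ss(1,3)] by simp
    qed
  qed
  \<comment> \<open>from the split of \<open>\<omega>\<close> on, \<open>W\<close> belongs to the algebras\<close>
  have late: "\<sigma> \<subseteq> W \<or> \<sigma> \<inter> W = {}" if s: "\<sigma> \<in> atoms M (G j)" and j: "m n0 < j" for \<sigma> j
  proof -
    have "W \<in> G (Suc (m n0))" unfolding GW by (rule refine_contains(2)[OF fa Ws])
    then have "W \<in> G j" using Gmono[of "Suc (m n0)" j] j by auto
    then show ?thesis using atom_inside_or_disjoint[OF ga s] by blast
  qed
  have yr: "y \<in> region L" using pqy fixed_boundary_subset_region[OF L] by blast
  have reg: "average M \<sigma> ?f \<in> region L" if s: "\<sigma> \<in> atoms M (G j)" for \<sigma> j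
  proof (cases "j \<le> m n0")
    case True
    then show ?thesis using early[OF s] zy by blast
  next
    case False
    then have "\<sigma> \<subseteq> W \<or> \<sigma> \<inter> W = {}" using late[OF s] by simp
    then show ?thesis
    proof
      assume "\<sigma> \<subseteq> W"
      then show ?thesis using inside[OF atom_sets(1,3)[OF ga s]] pq by blast
    next
      assume "\<sigma> \<inter> W = {}"
      then show ?thesis using off[OF atom_sets(1,3)[OF ga s]] yr by simp
    qed
  qed
  have fi: "integrable M ?f"
  proof -
    have "set_integrable M (space M) ?f"
      by (intro set_integral_three_valued(1)[OF D(1) Ws D(2)]) (auto simp: emeasure_eq_measure)
    then have "integrable M (\<lambda>x. indicator (space M) x *\<^sub>R ?f x)" by (simp add: set_integrable_def)
    then show ?thesis by (subst Bochner_Integration.integrable_cong[OF refl, of _ _ "\<lambda>x. indicator (space M) x *\<^sub>R ?f x"]) auto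
  qed
  have fb: "?f u \<in> fixed_boundary L" for u using pqy by (simp add: three_valued_def)
  have cG: "?f \<in> class_A_filtration L M G" using fi fb reg by (auto simp: class_A_filtration_def)
  show "?f \<in> class_A_filtration L M F"
    using fi fb reg[of _ "m _"] unfolding class_A_filtration_def Gm by auto
  have jump: "\<alpha> * norm (average M \<sigma>' ?f - average M \<sigma>'' ?f) \<le> norm (average M \<sigma>' ?f - average M \<sigma> ?f)"
    if s: "\<sigma> \<in> atoms M (G j)" "\<sigma>' \<in> children M G j \<sigma>" "\<sigma>'' \<in> children M G j \<sigma>" "\<sigma>' \<noteq> \<sigma>''"
      and n: "\<not> closed_segment (average M \<sigma>'' ?f) (average M \<sigma> ?f) \<subseteq> region L" for j \<sigma> \<sigma>' \<sigma>''
  proof -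
    have c: "\<sigma>' \<in> atoms M (G (Suc j))" "\<sigma>' \<subseteq> \<sigma>" "\<sigma>'' \<in> atoms M (G (Suc j))" "\<sigma>'' \<subseteq> \<sigma>"
      using s by (auto simp: children_def)
    note p = atom_sets(1,3)[OF ga s(1)] atom_sets(1,3)[OF ga c(1)] atom_sets(1,3)[OF ga c(3)]
    consider "j < m n0" | "j = m n0" | "m n0 < j" by linarith
    then show ?thesis
    proof cases
      case 1
      then have "average M \<sigma>'' ?f \<in> closed_segment ?z y" "average M \<sigma> ?f \<in> closed_segment ?z y"
        using early[OF c(3)] early[OF s(1)] by auto
      then have "closed_segment (average M \<sigma>'' ?f) (average M \<sigma> ?f) \<subseteq> closed_segment ?z y"
        by (simp add: subset_closed_segment)
      then show ?thesis using n zy by blast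
    next
      case 3
      have "closed_segment (average M \<sigma>'' ?f) (average M \<sigma> ?f) \<subseteq> region L"
        using late[OF s(1) 3]
      proof
        assume "\<sigma> \<subseteq> W"
        then have "average M \<sigma>'' ?f \<in> closed_segment p q" "average M \<sigma> ?f \<in> closed_segment p q"
          using inside[OF p(1,2)] inside[OF p(5,6)] c(4) by auto
        then have "closed_segment (average M \<sigma>'' ?f) (average M \<sigma> ?f) \<subseteq> closed_segment p q"
          by (simp add: subset_closed_segment)
        then show ?thesis using pq by blast
      next
        assume "\<sigma> \<inter> W = {}"
        then have "average M \<sigma>'' ?f = y" "average M \<sigma> ?f = y" using off[OF p(1,2)] off[OF p(5,6)] c(4) by auto
        then show ?thesis using yr by simp
      qed
      then show ?thesis using n by blast
    next
      case 2
      have sF: "\<sigma> \<in> atoms M (F n0)" using s(1) 2 Gm by simp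
      have ref: "\<eta> = \<sigma> \<inter> W \<or> \<eta> = \<sigma> - W" if "\<eta> \<in> atoms M (G (Suc j))" "\<eta> \<subseteq> \<sigma>" for \<eta>
        using atoms_refine[OF fa sF _ that(2) Ws] that(1) 2 GW by simp
      show ?thesis
      proof (cases "\<sigma> = \<omega>")
        case False
        then have "\<sigma> \<inter> \<omega> = {}" using atoms_eqI[OF fa sF om] by blast
        then have "\<sigma> \<inter> W = {}" using W(2) by blast
        then have "average M \<sigma>'' ?f = y" "average M \<sigma> ?f = y" using off[OF p(1,2)] off[OF p(5,6)] c(4) by auto
        then show ?thesis using n yr by simp
      next
        case True
        have "\<sigma> \<inter> W = W" using True W(2) by blast
        then have ch: "\<sigma>' = W \<or> \<sigma>' = \<sigma> - W" "\<sigma>'' = W \<or> \<sigma>'' = \<sigma> - W" using ref c by auto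
        have avs: "average M \<sigma> ?f = ?z"
          using around[OF p(1,2)] True W mom by simp
        show ?thesis
        proof (cases "\<sigma>'' = W")
          case False
          then have "\<sigma>'' \<inter> W = {}" using ch by blast
          then have "average M \<sigma>'' ?f = y" using off[OF p(5,6)] by simp
          then show ?thesis using n avs zy by (simp add: closed_segment_commute)
        next
          case t: True
          then have "\<sigma>' \<inter> W = {}" using ch s(4) by blast
          then have ay: "average M \<sigma>' ?f = y" using off[OF p(3,4)] by simp
          have ax: "average M \<sigma>'' ?f = x" using around[OF p(5,6)] t mW by simp
          have "y - ?z = \<alpha> *\<^sub>R (y - x)" by (simp add: algebra_simps)
          then show ?thesis unfolding ay ax avs using a by simp
        qed
      qed
    qed
  qed
  have "binary_alpha_martingale \<alpha> L M G ?f"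
    unfolding binary_alpha_martingale_def using G cG jump by auto
  moreover have "martingale M F ?f k u = martingale M G ?f (m k) u" for k u
    by (simp add: martingale_def Gm)
  ultimately show "alpha_martingale \<alpha> L M F ?f" unfolding alpha_martingale_def using m by blast
qed

lemma three_valued_rearrangement:
  fixes p q y :: "real^2"
  assumes M: "prob_space M" and D: "D \<in> sets M" "W \<in> sets M" "D \<subseteq> W"
    and pqy: "p \<in> fixed_boundary L" "q \<in> fixed_boundary L" "y \<in> fixed_boundary L"
    and e: "norm e = 1" "inj_on (\<lambda>v. e \<bullet> v) (fixed_boundary L)" "e \<bullet> q \<le> e \<bullet> p" "e \<bullet> y \<le> e \<bullet> q"
  shows "monotonic_rearrangement L M (three_valued D W p q y)
    (three_valued {0..<measure M D} {0..<measure M W} p q y)"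
proof -
  interpret prob_space M by fact
  interpret U: prob_space unit_interval by (rule prob_space_unit_interval)
  let ?D = "{0..<measure M D}" and ?W = "{0..<measure M W}"
  have le: "0 \<le> measure M D" "measure M D \<le> measure M W" "measure M W \<le> 1"
    using finite_measure_mono[OF D(3,2)] by auto
  have sub: "?D \<subseteq> {0..1}" "?W \<subseteq> {0..1}" "?D \<subseteq> ?W"
    using le by (meson atLeastLessThan_iff atLeastAtMost_iff less_imp_le less_le_trans order_trans subsetI)+
  have sets: "?D \<in> sets unit_interval" "?W \<in> sets unit_interval" using sub by (auto intro!: sets_unit_interval)
  have mD: "measure unit_interval ?D = measure M D" "measure unit_interval ?W = measure M W"
    using measure_unit_interval[OF sub(1)] measure_unit_interval[OF sub(2)]
    by (simp_all add: measure_lebesgue_atLeastLessThan)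
  have dist: "distr unit_interval borel (three_valued ?D ?W p q y) = distr M borel (three_valued D W p q y)"
  proof (rule measure_eqI)
    fix X assume "X \<in> sets (distr unit_interval borel (three_valued ?D ?W p q y))"
    then have X: "X \<in> sets borel" by simp
    have "emeasure unit_interval ?D = emeasure M D"
      by (simp add: U.emeasure_eq_measure emeasure_eq_measure mD)
    moreover have "emeasure unit_interval (?W - ?D) = emeasure M (W - D)"
      using U.finite_measure_Diff[OF sets(2,1) sub(3)] finite_measure_Diff[OF D(2,1,3)]
      by (simp add: U.emeasure_eq_measure emeasure_eq_measure mD)
    moreover have "emeasure unit_interval (space unit_interval - ?W) = emeasure M (space M - W)"
      using U.prob_compl[OF sets(2)] prob_compl[OF D(2)]
      by (simp add: U.emeasure_eq_measure emeasure_eq_measure mD)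
    ultimately show "emeasure (distr unit_interval borel (three_valued ?D ?W p q y)) X
        = emeasure (distr M borel (three_valued D W p q y)) X"
      by (simp only: emeasure_distr_three_valued[OF sets sub(3) X] emeasure_distr_three_valued[OF D X])
  qed simp
  show ?thesis
    unfolding monotonic_rearrangement_def
  proof (intro conjI exI[of _ e] ballI)
    show "three_valued ?D ?W p q y t \<in> fixed_boundary L" for t using pqy by (simp add: three_valued_def)
    show "antimono_on {0<..<1} (\<lambda>t. e \<bullet> three_valued ?D ?W p q y t)"
      using e(3,4) by (intro monotone_onI) (auto simp: three_valued_def)
    show "three_valued ?D ?W p q y \<in> borel_measurable unit_interval" by (rule three_valued_measurable[OF sets])
  qed (use e dist in auto)
qed

text \<open>
  For a rearrangement with the values \<open>p, q, y\<close> in this order, where \<open>p\<close> and \<open>q\<close> average to \<open>x\<close> on an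
  initial interval of length \<open>\<beta>\<close>, the average over the initial interval of length \<open>s \<ge> \<beta>\<close> is the point
  of \<open>[x, y]\<close> at which \<open>x\<close> has the weight \<open>\<beta> / s\<close>. The point \<open>c\<close> outside the large lens is among them, as
  the weight of \<open>x\<close> in it exceeds \<open>\<alpha> \<ge> \<beta>\<close>.
\<close>

theorem alpha_extension_if_rearrangements_in_class:
  assumes L: "is_lens L" and E: "extension L L'" and M: "standard_prob_space M" and F: "finite_filtration M F"
    and a: "0 < \<alpha>" "\<alpha> < 1" and adm: "admissible \<alpha> M F"
    and hyp: "\<And>\<phi> \<psi>. \<phi> \<in> class_A_filtration L M F \<Longrightarrow> alpha_martingale \<alpha> L M F \<phi> \<Longrightarrow>
        monotonic_rearrangement L M \<phi> \<psi> \<Longrightarrow> \<psi> \<in> class_A L' {0..1}"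
  shows "alpha_extension \<alpha> L L'"
proof (rule ccontr)
  interpret prob_space M using M by (simp add: standard_prob_space_def)
  have pM: "prob_space M" by (rule prob_space_axioms)
  have L': "is_lens L'" and sub: "region L \<subseteq> region L'" using E by (auto simp: extension_def)
  assume "\<not> alpha_extension \<alpha> L L'"
  then obtain x y0 where xy: "x \<in> region L" "y0 \<in> region L"
    "closed_segment (\<alpha> *\<^sub>R x + (1 - \<alpha>) *\<^sub>R y0) y0 \<subseteq> region L" "\<not> closed_segment x y0 \<subseteq> region L'"
    unfolding alpha_extension_def using L' by blast
  then obtain c where c: "c \<in> closed_segment x y0" "c \<notin> region L'" by blast
  have "closed_segment x y0 \<subseteq> closure (outer L)"
    using xy region_iff[OF L] is_lensD(4)[OF L] by (intro closed_segment_subset convex_closure) auto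
  then have cI': "c \<in> inner_dom L'" using c region_iff[OF L'] extension_outer_eq[OF L E] by auto
  then have cI: "c \<in> inner_dom L" using extension_inner_subset[OF L E] by blast
  obtain y where y: "y \<in> fixed_boundary L" "c \<in> closed_segment x y"
    "closed_segment (\<alpha> *\<^sub>R x + (1 - \<alpha>) *\<^sub>R y) y \<subseteq> region L"
    using bad_pair_reaches_boundary[OF L xy(1,2) a xy(3) c(1) cI] .
  obtain p q l e where p: "p \<in> fixed_boundary L" and q: "q \<in> fixed_boundary L" and l: "0 \<le> l" "l \<le> 1"
    and x: "x = l *\<^sub>R p + (1 - l) *\<^sub>R q" and pq: "closed_segment p q \<subseteq> region L"
    and e: "norm e = 1" "inj_on (\<lambda>v. e \<bullet> v) (fixed_boundary L)" "e \<bullet> q \<le> e \<bullet> p" "e \<bullet> y \<le> e \<bullet> q"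
    using chord_through_point[OF L xy(1) y(1,2) cI] .
  obtain n0 \<omega> W where om: "\<omega> \<in> atoms M (F n0)" and W: "W \<in> F (Suc n0)" "W \<subseteq> \<omega>" "measure M W = \<alpha> * measure M \<omega>"
    using adm unfolding admissible_def by blast
  have Ws: "W \<in> sets M" using W(1) finite_filtrationD(4)[OF F] by blast
  have mom: "0 < measure M \<omega>" using atom_sets(3)[OF finite_filtrationD(1)[OF F] om] .
  have "l * measure M W \<le> 1 * measure M W" using l by (intro mult_right_mono) auto
  then obtain D where D: "D \<in> sets M" "D \<subseteq> W" "measure M D = l * measure M W"
    using standard_prob_space_subset_of_measure[OF M Ws, of "l * measure M W"] l by auto
  define \<beta> where "\<beta> = measure M W"
  let ?\<psi> = "three_valued {0..<measure M D} {0..<measure M W} p q y"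
  have "?\<psi> \<in> class_A L' {0..1}"
  proof (rule hyp)
    show "three_valued D W p q y \<in> class_A_filtration L M F" "alpha_martingale \<alpha> L M F (three_valued D W p q y)"
      using one_jump_alpha_martingale[OF L M F a om W D p q y(1) x pq y(3)] by auto
    show "monotonic_rearrangement L M (three_valued D W p q y) ?\<psi>"
      by (rule three_valued_rearrangement[OF pM D(1) Ws D(2) p q y(1) e])
  qed
  then have avreg: "average lebesgue I ?\<psi> \<in> region L'" if "is_interval I" "I \<subseteq> {0..1}" "0 < measure lebesgue I" for I
    using that by (auto simp: class_A_def)
  obtain \<tau> where t: "0 \<le> \<tau>" "\<tau> \<le> 1" "c = (1 - \<tau>) *\<^sub>R x + \<tau> *\<^sub>R y" using y(2) by (auto simp: in_segment)
  have tau: "\<tau> < 1 - \<alpha>"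
  proof (rule ccontr)
    assume "\<not> ?thesis"
    then have "(1 - \<tau>) *\<^sub>R x + (1 - (1 - \<tau>)) *\<^sub>R y \<in> closed_segment (\<alpha> *\<^sub>R x + (1 - \<alpha>) *\<^sub>R y) y"
      using t(1,2) a(1) by (intro weighted_average_in_segment) auto
    then have "c \<in> region L'" using y(3) sub by (auto simp: t(3))
    then show False using c(2) by simp
  qed
  have b0: "0 < \<beta>" using W(3) a mom by (simp add: \<beta>_def)
  have "\<beta> \<le> \<alpha> * 1" unfolding \<beta>_def W(3) using a by (intro mult_left_mono) auto
  then have b1: "\<beta> < 1 - \<tau>" using tau by simp
  \<comment> \<open>length of the initial interval with average \<open>c\<close>\<close>
  define s where "s = \<beta> / (1 - \<tau>)"
  have s: "\<beta> \<le> s" "s < 1" "0 < s" "\<beta> / s = 1 - \<tau>"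
  proof -
    show "s < 1" "0 < s" "\<beta> / s = 1 - \<tau>" using b0 b1 by (auto simp: s_def)
    have "\<beta> * (1 - \<tau>) \<le> \<beta> * 1" using b0 t by (intro mult_left_mono) auto
    then show "\<beta> \<le> s" using b0 b1 by (simp add: s_def le_divide_eq)
  qed
  have Db: "0 \<le> measure M D" "measure M D \<le> \<beta>" using finite_measure_mono[OF D(2) Ws] by (auto simp: \<beta>_def)
  let ?I = "{0..<s}"
  have mI: "measure lebesgue ?I = s" using s(3) by (simp add: measure_lebesgue_atLeastLessThan)
  have "(LINT t:?I|lebesgue. ?\<psi> t) = measure lebesgue (?I \<inter> {0..<measure M D}) *\<^sub>R p
      + measure lebesgue (?I \<inter> ({0..<measure M W} - {0..<measure M D})) *\<^sub>R q
      + measure lebesgue (?I - {0..<measure M W}) *\<^sub>R y"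
    using Db s(3) by (intro set_integral_three_valued(2)) (auto simp: \<beta>_def)
  also have "?I \<inter> {0..<measure M D} = {0..<measure M D}" using s Db by auto
  also have "?I \<inter> ({0..<measure M W} - {0..<measure M D}) = {measure M D..<\<beta>}" using s Db by (auto simp: \<beta>_def)
  also have "?I - {0..<measure M W} = {\<beta>..<s}" using b0 by (auto simp: \<beta>_def)
  also have "measure lebesgue {0..<measure M D} = l * \<beta>" using Db D(3) by (simp add: measure_lebesgue_atLeastLessThan \<beta>_def)
  also have "measure lebesgue {measure M D..<\<beta>} = (1 - l) * \<beta>" using Db D(3) by (simp add: measure_lebesgue_atLeastLessThan \<beta>_def left_diff_distrib)
  also have "measure lebesgue {\<beta>..<s} = s - \<beta>" using s by (simp add: measure_lebesgue_atLeastLessThan)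
  also have "(l * \<beta>) *\<^sub>R p + ((1 - l) * \<beta>) *\<^sub>R q + (s - \<beta>) *\<^sub>R y = \<beta> *\<^sub>R x + (s - \<beta>) *\<^sub>R y"
    by (simp add: x scaleR_add_right mult.commute)
  finally have "average lebesgue ?I ?\<psi> = (1 / s) *\<^sub>R (\<beta> *\<^sub>R x + (s - \<beta>) *\<^sub>R y)"
    by (simp only: average_def mI)
  also have "\<dots> = (\<beta> / s) *\<^sub>R x + (1 - \<beta> / s) *\<^sub>R y" using s(3) by (simp add: scaleR_add_right diff_divide_distrib)
  also have "\<dots> = c" by (simp add: s(4) t(3))
  finally have "average lebesgue ?I ?\<psi> = c" .
  moreover have "average lebesgue ?I ?\<psi> \<in> region L'"
    using s mI by (intro avreg) (auto simp: is_interval_co)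
  ultimately show False using c(2) by simp
qed

theorem theorem1:
  fixes L L' :: lens
    and M :: "'a measure"
    and F :: "nat \<Rightarrow> 'a set set"
    and \<alpha> :: real
  assumes "is_lens L"
    and "extension L L'"
    and "standard_prob_space M"
    and "finite_filtration M F"
    and "0 < \<alpha>" and "\<alpha> < 1"
    and "admissible \<alpha> M F"
  shows "(\<forall>\<phi>\<in>class_A_filtration L M F. alpha_martingale \<alpha> L M F \<phi> \<longrightarrow>
            (\<forall>\<psi>. monotonic_rearrangement L M \<phi> \<psi> \<longrightarrow> \<psi> \<in> class_A L' {0..1}))
         \<longleftrightarrow> alpha_extension \<alpha> L L'"
proof
  assume "\<forall>\<phi>\<in>class_A_filtration L M F. alpha_martingale \<alpha> L M F \<phi> \<longrightarrow>
            (\<forall>\<psi>. monotonic_rearrangement L M \<phi> \<psi> \<longrightarrow> \<psi> \<in> class_A L' {0..1})"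
  then show "alpha_extension \<alpha> L L'"
    by (intro alpha_extension_if_rearrangements_in_class[OF assms]) blast
next
  assume "alpha_extension \<alpha> L L'"
  moreover have "prob_space M" using assms(3) by (simp add: standard_prob_space_def)
  ultimately show "\<forall>\<phi>\<in>class_A_filtration L M F. alpha_martingale \<alpha> L M F \<phi> \<longrightarrow>
            (\<forall>\<psi>. monotonic_rearrangement L M \<phi> \<psi> \<longrightarrow> \<psi> \<in> class_A L' {0..1})"
    unfolding alpha_martingale_def using rearrangement_in_alpha_extension[OF assms(1,2) _ assms(5,6)] by blast
qed

end
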